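(* Let $\Delta$ be a doubly homotopy Cohen-Macaulay simplicial complex on the vertex set $[n]=\{1,\dots,n\}$. (i) If $P=([n],\preceq_P)$ is a poset, then the Boolean cell complex $\Gamma(\Delta,P)$ is doubly homotopy Cohen-Macaulay. (ii) If $G=([n],E)$ is a graph on vertex set $[n]$, then the Boolean cell complex $\Gamma/G(\Delta)$ is doubly homotopy Cohen-Macaulay.
   Context: Injective words over $[n]$ are words with no repeated letter, ordered by subword containment ($\omega_1\cdots\omega_s\le\sigma_1\cdots\sigma_r$ iff $\omega_j=\sigma_{i_j}$ for some $i_1<\dots<i_s$); the content of $w=w_1\cdots w_s$ is $c(w)=\{w_1,\dots,w_s\}$. These words form the face poset of a regular (Boolean) cell complex $\Gamma$, a word of length $d+1$ being a $d$-cell whose faces are its subwords. $\Gamma(\Delta)$ is the subcomplex of words $w$ with $c(w)\in\Delta$. For a poset $P=([n],\preceq_P)$, $\Gamma(\Delta,P)$ is the subcomplex of $\Gamma(\Delta)$ of words $w=w_1\cdots w_s$ such that $w_i\prec_P w_j$ implies $i<j$. For a graph $G=([n],E)$, two words are equivalent if one is obtained from the other by a sequence of commutations of adjacent letters $ss'\to s's$ with $\{s,s'\}\notin E$; $\Gamma/G(\Delta)$ is the set of equivalence classes $[w]$ of words $w\in\Gamma(\Delta)$, ordered by $[v]\preceq[w]$ iff some representatives satisfy $v'\le w'$; it is the face poset of a Boolean cell complex. Topological properties of these cell complexes refer to the order complex (simplicial complex of chains) of their poset of nonempty cells. A simplicial complex $\Delta$ is homotopy Cohen-Macaulay if for every face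 $F$ (including $\emptyset$) its link $\{G: F\cup G\in\Delta, F\cap G=\emptyset\}$ is $(\dim\mathrm{link}_\Delta(F)-1)$-connected. A complex is doubly homotopy Cohen-Macaulay if it is homotopy Cohen-Macaulay and for every vertex $v$ the complex obtained by removing $v$ (i.e. all faces/cells containing $v$) is homotopy Cohen-Macaulay of the same dimension. *)

theory Defs
  imports "HOL-Analysis.Analysis" "HOL-Library.Sublist"
begin

section \<open>Abstract simplicial complexes\<close>

definition simplicial_complex_on :: "'a set \<Rightarrow> 'a set set \<Rightarrow> bool" where
  "simplicial_complex_on V K \<longleftrightarrow>
     finite V \<and> K \<subseteq> Pow V \<and> {} \<in> K \<and> (\<forall>F\<in>K. \<forall>G. G \<subseteq> F \<longrightarrow> G \<in> K)"

text \<open>Only meaningful for finite nonempty \<^term>\<open>K\<close>; the complex \<open>{{}}\<close> has dimension \<open>-1\<close>.\<close>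

definition complex_dim :: "'a set set \<Rightarrow> int" where
  "complex_dim K = int (Max (card ` K)) - 1"

definition link :: "'a set set \<Rightarrow> 'a set \<Rightarrow> 'a set set" where
  "link K F = {G. F \<union> G \<in> K \<and> F \<inter> G = {}}"

definition deletion :: "'a set set \<Rightarrow> 'a \<Rightarrow> 'a set set" where
  "deletion K v = {F \<in> K. v \<notin> F}"

text \<open>Points are given by barycentric coordinates. The complexes considered are finite, so the
  topology inherited from the product topology is the usual one.\<close>

definition realization :: "'a set set \<Rightarrow> ('a \<Rightarrow> real) topology" where
  "realization K = subtopology (powertop_real UNIV)
     {x. (\<forall>v. 0 \<le> x v) \<and> {v. x v \<noteq> 0} \<in> K \<and> (\<Sum>v | x v \<noteq> 0. x v) = 1}"

text \<open>The index \<open>k\<close> is an integer: \<open>(-1)\<close>-connected means nonempty, and every space is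
  \<open>k\<close>-connected for \<open>k \<le> -2\<close>.\<close>

definition k_connected :: "int \<Rightarrow> 'a topology \<Rightarrow> bool" where
  "k_connected k X \<longleftrightarrow>
     (-1 \<le> k \<longrightarrow> topspace X \<noteq> {}) \<and>
     (\<forall>i::nat. int i \<le> k \<longrightarrow>
        (\<forall>f. continuous_map (nsphere i) X f \<longrightarrow>
           (\<exists>c. homotopic_with (\<lambda>_. True) (nsphere i) X f (\<lambda>_. c))))"

definition homotopy_CM :: "'a set set \<Rightarrow> bool" where
  "homotopy_CM K \<longleftrightarrow>
     (\<forall>F\<in>K. k_connected (complex_dim (link K F) - 1) (realization (link K F)))"

definition doubly_homotopy_CM :: "'a set set \<Rightarrow> bool" where
  "doubly_homotopy_CM K \<longleftrightarrow> homotopy_CM K \<and>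
     (\<forall>v. {v} \<in> K \<longrightarrow>
        homotopy_CM (deletion K v) \<and> complex_dim (deletion K v) = complex_dim K)"

section \<open>Cell complexes, given by their face posets\<close>

text \<open>A cell complex is given by its set \<open>A\<close> of cells, including the empty cell, and the face
  relation \<open>le\<close>. The empty cell is the least element of \<open>A\<close>.\<close>

definition nonempty_cells :: "'a set \<Rightarrow> ('a \<Rightarrow> 'a \<Rightarrow> bool) \<Rightarrow> 'a set" where
  "nonempty_cells A le = {x \<in> A. \<not> (\<forall>y\<in>A. le x y)}"

definition cell_vertices :: "'a set \<Rightarrow> ('a \<Rightarrow> 'a \<Rightarrow> bool) \<Rightarrow> 'a set" where
  "cell_vertices A le =
     {v \<in> nonempty_cells A le. \<forall>u \<in> nonempty_cells A le. le u v \<longrightarrow> u = v}"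

definition cell_deletion :: "'a set \<Rightarrow> ('a \<Rightarrow> 'a \<Rightarrow> bool) \<Rightarrow> 'a \<Rightarrow> 'a set" where
  "cell_deletion A le v = {x \<in> A. \<not> le v x}"

definition order_complex :: "'a set \<Rightarrow> ('a \<Rightarrow> 'a \<Rightarrow> bool) \<Rightarrow> 'a set set" where
  "order_complex A le = {C. C \<subseteq> A \<and> finite C \<and> (\<forall>x\<in>C. \<forall>y\<in>C. le x y \<or> le y x)}"

definition cell_order_complex :: "'a set \<Rightarrow> ('a \<Rightarrow> 'a \<Rightarrow> bool) \<Rightarrow> 'a set set" where
  "cell_order_complex A le = order_complex (nonempty_cells A le) le"

definition cell_homotopy_CM :: "'a set \<Rightarrow> ('a \<Rightarrow> 'a \<Rightarrow> bool) \<Rightarrow> bool" where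
  "cell_homotopy_CM A le \<longleftrightarrow> homotopy_CM (cell_order_complex A le)"

text \<open>The dimension of a regular cell complex is that of the order complex of its nonempty cells.\<close>

definition cell_dim :: "'a set \<Rightarrow> ('a \<Rightarrow> 'a \<Rightarrow> bool) \<Rightarrow> int" where
  "cell_dim A le = complex_dim (cell_order_complex A le)"

definition cell_doubly_homotopy_CM :: "'a set \<Rightarrow> ('a \<Rightarrow> 'a \<Rightarrow> bool) \<Rightarrow> bool" where
  "cell_doubly_homotopy_CM A le \<longleftrightarrow> cell_homotopy_CM A le \<and>
     (\<forall>v \<in> cell_vertices A le.
        cell_homotopy_CM (cell_deletion A le v) le \<and>
        cell_dim (cell_deletion A le v) le = cell_dim A le)"

section \<open>Complexes of injective words\<close>

text \<open>Words are lists, the subword order is \<^term>\<open>subseq\<close>, and the content of \<open>w\<close> is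
  \<^term>\<open>set w\<close>.\<close>

definition injective_words :: "nat \<Rightarrow> nat list set" where
  "injective_words n = {w. distinct w \<and> set w \<subseteq> {1..n}}"

definition Gamma :: "nat \<Rightarrow> nat set set \<Rightarrow> nat list set" where
  "Gamma n \<Delta> = {w \<in> injective_words n. set w \<in> \<Delta>}"

definition Gamma_poset :: "nat \<Rightarrow> nat set set \<Rightarrow> nat rel \<Rightarrow> nat list set" where
  "Gamma_poset n \<Delta> P = {w \<in> Gamma n \<Delta>. \<forall>i < length w. \<forall>j < length w.
     (w ! i, w ! j) \<in> P \<and> w ! i \<noteq> w ! j \<longrightarrow> i < j}"

definition graph_on :: "'a set \<Rightarrow> 'a set set \<Rightarrow> bool" where
  "graph_on V E \<longleftrightarrow> (\<forall>e\<in>E. e \<subseteq> V \<and> card e = 2)"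

definition commutation :: "'a set set \<Rightarrow> 'a list \<Rightarrow> 'a list \<Rightarrow> bool" where
  "commutation E w w' \<longleftrightarrow>
     (\<exists>u s s' v. w = u @ [s, s'] @ v \<and> w' = u @ [s', s] @ v \<and> {s, s'} \<notin> E)"

text \<open>\<^term>\<open>commutation E\<close> is symmetric, so its reflexive transitive closure is an equivalence.\<close>

definition commutation_class :: "'a set set \<Rightarrow> 'a list \<Rightarrow> 'a list set" where
  "commutation_class E w = {w'. (commutation E)\<^sup>*\<^sup>* w w'}"

definition Gamma_graph :: "nat \<Rightarrow> nat set set \<Rightarrow> nat set set \<Rightarrow> nat list set set" where
  "Gamma_graph n \<Delta> E = commutation_class E ` Gamma n \<Delta>"

definition class_le :: "'a list set \<Rightarrow> 'a list set \<Rightarrow> bool" where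
  "class_le C D \<longleftrightarrow> (\<exists>v\<in>C. \<exists>w\<in>D. subseq v w)"

end

theory Submission
  imports Defs "HOL-Library.List_Lexorder"
begin

text \<open>Deleting a vertex \<open>v\<close> from \<open>\<Gamma>(\<Delta>, P)\<close> or \<open>\<Gamma>/G(\<Delta>)\<close> gives the same construction for \<open>\<Delta> - v\<close>, so it
  suffices to show that both constructions preserve homotopy Cohen-Macaulayness. Both are complexes
  of traces (acyclic orientations of induced subgraphs): words are traces for the complete graph.

  A finite complex is \<open>k\<close>-connected iff all maps into it from closed subsets of cubes of dimension
  at most \<open>k + 1\<close> extend to the cube. With this criterion, attaching a cone over a
  \<open>(k - 1)\<close>-connected subcomplex, or removing a cone over a \<open>k\<close>-connected one, is seen to preserve
  \<open>k\<close>-connectedness without simplicial approximation.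

  The link of a chain of traces is a join of proper parts of Boolean lattices with the
  traces above the top \<open>p\<close> of the chain. The latter poset maps to the link of the content of \<open>p\<close> in
  \<open>\<Delta>\<close>. By Quillen's fiber theorem, it is as connected as that link, because the fibers, which consist of
  the traces above \<open>p\<close> on a fixed set of letters, are shelled by the lexicographic order of words.\<close>

section \<open>Extension of maps from closed subsets of cubes\<close>

text \<open>Closed subsets of cubes are a convenient test class: partial extensions can be glued
  along closed sets, cubes can be cut into boxes, their faces are cubes again, and neither base
  points nor homotopy groups occur. The obstacle that shapes the combinatorial half is the join of
  two complexes that are merely highly connected. Such joins arise in links of chains and again
  inside the fiber theorem. They are avoided by keeping one factor combinatorial:
  \<open>built\<close> certifies connectivity by successive coning, and certificates exist for
  Boolean intervals and for the fibers, so that \<Delta> enters only through the other factor. The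
  connectivity of links has to match their dimension after faces are removed. For this, homotopy
  Cohen-Macaulay complexes are shown to be pure, which turns the dimension of a link into a
  difference of cardinalities. Both parts of the theorem fit one hypothesis: the graph is complete
  or the order is trivial. The shelling appeals to this alternative at a single place.\<close>

definition cube :: "nat set \<Rightarrow> (nat \<Rightarrow> real) set" where
  "cube J = {x. (\<forall>j\<in>J. \<bar>x j\<bar> \<le> 1) \<and> (\<forall>j. j \<notin> J \<longrightarrow> x j = 0)}"

definition cube_bd :: "nat set \<Rightarrow> (nat \<Rightarrow> real) set" where
  "cube_bd J = {x \<in> cube J. \<exists>j\<in>J. \<bar>x j\<bar> = 1}"

text \<open>The closed set is arbitrary, not only the boundary; this makes the property pass to
  finite unions of closed sets and to retracts. For cubes, \<open>extensor_cube\<close> recovers it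
  from \<open>fills\<close>.\<close>

definition extensor :: "(nat \<Rightarrow> real) set \<Rightarrow> 'b::topological_space set \<Rightarrow> bool" where
  "extensor Z X \<longleftrightarrow> (\<forall>C f. closed C \<and> C \<subseteq> Z \<and> continuous_on C f \<and> f ` C \<subseteq> X \<longrightarrow>
     (\<exists>g. continuous_on Z g \<and> g ` Z \<subseteq> X \<and> (\<forall>x\<in>C. g x = f x)))"

text \<open>The boundary of a cube with \<open>i + 1\<close> coordinates plays the role of the
  \<open>i\<close>-sphere. For \<open>J = {}\<close> the boundary is empty, and the property says
  that \<open>X\<close> is nonempty.\<close>

definition fills :: "nat set \<Rightarrow> 'b::topological_space set \<Rightarrow> bool" where
  "fills J X \<longleftrightarrow> (\<forall>f. continuous_on (cube_bd J) f \<and> f ` cube_bd J \<subseteq> X \<longrightarrow>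
     (\<exists>g. continuous_on (cube J) g \<and> g ` cube J \<subseteq> X \<and> (\<forall>x\<in>cube_bd J. g x = f x)))"

lemma continuous_on_coordinate [continuous_intros]:
  "continuous_on S (\<lambda>x. (x :: 'i \<Rightarrow> real) i)"
  by (rule continuous_on_product_then_coordinatewise) (rule continuous_on_id)

lemma continuous_on_fun_upd_const: "continuous_on S (\<lambda>x :: 'i \<Rightarrow> real. x(j := c))"
proof (rule continuous_on_coordinatewise_then_product)
  show "continuous_on S (\<lambda>x. (x(j := c)) i)" for i
    by (cases "i = j") (auto intro: continuous_on_coordinate)
qed

lemma continuous_on_Max:
  fixes f :: "'i \<Rightarrow> 'a::topological_space \<Rightarrow> real"
  assumes "finite I" "I \<noteq> {}" "\<And>i. i \<in> I \<Longrightarrow> continuous_on S (f i)"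
  shows "continuous_on S (\<lambda>x. Max ((\<lambda>i. f i x) ` I))"
  using assms
proof (induction I rule: finite_ne_induct)
  case (insert i I)
  then have "continuous_on S (\<lambda>x. max (f i x) (Max ((\<lambda>i. f i x) ` I)))"
    by (intro continuous_on_max) auto
  with insert show ?case by simp
qed simp

lemma continuous_on_Min:
  fixes f :: "'i \<Rightarrow> 'a::topological_space \<Rightarrow> real"
  assumes "finite I" "I \<noteq> {}" "\<And>i. i \<in> I \<Longrightarrow> continuous_on S (f i)"
  shows "continuous_on S (\<lambda>x. Min ((\<lambda>i. f i x) ` I))"
  using assms
proof (induction I rule: finite_ne_induct)
  case (insert i I)
  then have "continuous_on S (\<lambda>x. min (f i x) (Min ((\<lambda>i. f i x) ` I)))"
    by (intro continuous_on_min) auto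
  with insert show ?case by simp
qed simp

lemma compact_cube: "compact (cube J)"
proof -
  have "cube J = PiE UNIV (\<lambda>j. if j \<in> J then {-1..1} else {0})"
    by (rule set_eqI) (auto simp: cube_def PiE_iff abs_le_iff minus_le_iff)
  moreover have "compactin (powertop_real UNIV) (PiE UNIV (\<lambda>j::nat. if j \<in> J then {-1..1} else {0}))"
    by (subst compactin_PiE) auto
  ultimately show ?thesis
    by (simp add: euclidean_product_topology)
qed

lemma closed_cube: "closed (cube J)"
  by (simp add: compact_cube compact_imp_closed)

lemma closed_coordinate_eq: "closed {x :: nat \<Rightarrow> real. x j = c}"
  by (intro closed_Collect_eq continuous_intros)

lemma closed_slice: "closed {x \<in> cube J. x j = c}"
  using closed_Int[OF closed_cube closed_coordinate_eq] by (simp add: Int_def)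

lemma cube_bd_eq: "cube_bd J = (\<Union>j\<in>J. {x \<in> cube J. x j = 1} \<union> {x \<in> cube J. x j = -1})"
  by (force simp: cube_bd_def abs_eq_iff)

lemma closed_cube_bd: "finite J \<Longrightarrow> closed (cube_bd J)"
  unfolding cube_bd_eq by (intro closed_UN ballI closed_Un closed_slice)

lemma cube_bd_subset: "cube_bd J \<subseteq> cube J"
  by (auto simp: cube_bd_def)

lemma extensorD:
  assumes "extensor Z X" "closed C" "C \<subseteq> Z" "continuous_on C f" "f ` C \<subseteq> X"
  obtains g where "continuous_on Z g" "g ` Z \<subseteq> X" "\<And>x. x \<in> C \<Longrightarrow> g x = f x"
  using assms unfolding extensor_def by metis

lemma extensor_empty: "extensor {} X"
  by (auto simp: extensor_def)

text \<open>Extend from \<open>C \<inter> Y\<close> to \<open>Y\<close>; together with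
  \<open>f\<close> this gives a map on \<open>Y \<union> C\<close>, whose restriction to
  \<open>Z\<close> is again defined on a closed set and extends to \<open>Z\<close>.\<close>

lemma extensor_Un:
  assumes Y: "extensor Y X" and Z: "extensor Z X" and "closed Y" "closed Z"
  shows "extensor (Y \<union> Z) X"
  unfolding extensor_def
proof clarify
  fix C and f :: "(nat \<Rightarrow> real) \<Rightarrow> 'a"
  assume C: "closed C" "C \<subseteq> Y \<union> Z" and f: "continuous_on C f" "f ` C \<subseteq> X"
  obtain g where g: "continuous_on Y g" "g ` Y \<subseteq> X" "\<And>x. x \<in> C \<inter> Y \<Longrightarrow> g x = f x"
    by (rule extensorD[OF Y, of "C \<inter> Y" f]) (use C f \<open>closed Y\<close> in \<open>auto intro: continuous_on_subset\<close>)
  define f' where "f' = (\<lambda>x. if x \<in> Y then g x else f x)"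
  have f': "continuous_on (Y \<union> C) f'"
    unfolding f'_def
    by (rule continuous_on_cases) (use g f C \<open>closed Y\<close> in auto)
  have f'X: "f' ` (Y \<union> C) \<subseteq> X" using g f by (auto simp: f'_def)
  obtain h where h: "continuous_on Z h" "h ` Z \<subseteq> X" "\<And>x. x \<in> (Y \<union> C) \<inter> Z \<Longrightarrow> h x = f' x"
    by (rule extensorD[OF Z, of "(Y \<union> C) \<inter> Z" f'])
       (use C f' f'X assms in \<open>auto intro: continuous_on_subset\<close>)
  define k where "k = (\<lambda>x. if x \<in> Y then g x else h x)"
  have "continuous_on (Y \<union> Z) k"
    unfolding k_def
    by (rule continuous_on_cases) (use g h assms in \<open>auto simp: f'_def\<close>)
  moreover have "k ` (Y \<union> Z) \<subseteq> X" using g h by (auto simp: k_def)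
  moreover have "\<forall>x\<in>C. k x = f x" using g h C by (auto simp: k_def f'_def)
  ultimately show "\<exists>g. continuous_on (Y \<union> Z) g \<and> g ` (Y \<union> Z) \<subseteq> X \<and> (\<forall>x\<in>C. g x = f x)"
    by blast
qed

lemma extensor_UN:
  assumes "finite I" "\<And>i. i \<in> I \<Longrightarrow> extensor (Z i) X" "\<And>i. i \<in> I \<Longrightarrow> closed (Z i)"
  shows "extensor (\<Union>i\<in>I. Z i) X"
  using assms
  by (induction I rule: finite_induct) (auto intro!: extensor_Un closed_UN simp: extensor_empty)

text \<open>Problems on \<open>Y\<close> are moved to \<open>Z\<close> along \<open>p\<close> and
  back along its left inverse \<open>q\<close>. Compactness of \<open>Y\<close> makes the image of a
  closed set under \<open>p\<close> closed.\<close>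

lemma extensor_retract:
  assumes Z: "extensor Z X" and "closed Z" "compact Y" 
    and p: "continuous_on Y p" "p ` Y \<subseteq> Z" and q: "continuous_on Z q" "q ` Z \<subseteq> Y"
    and qp: "\<And>y. y \<in> Y \<Longrightarrow> q (p y) = y"
  shows "extensor Y X"
  unfolding extensor_def
proof clarify
  fix C and f :: "(nat \<Rightarrow> real) \<Rightarrow> 'a"
  assume C: "closed C" "C \<subseteq> Y" and f: "continuous_on C f" "f ` C \<subseteq> X"
  have "compact C" using C \<open>compact Y\<close> by (metis compact_Int_closed inf.absorb2)
  then have "compact (p ` C)" using p C by (meson compact_continuous_image continuous_on_subset)
  have "q ` p ` C = C" using C qp by (force simp: image_iff)
  then have *: "continuous_on (p ` C) (f \<circ> q)"
    using C p f by (intro continuous_on_compose continuous_on_subset[OF q(1)]) auto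
  obtain g where g: "continuous_on Z g" "g ` Z \<subseteq> X" "\<And>x. x \<in> p ` C \<Longrightarrow> g x = (f \<circ> q) x"
    by (rule extensorD[OF Z, of "p ` C" "f \<circ> q"])
       (use \<open>compact (p ` C)\<close> * p C f qp in \<open>auto intro: compact_imp_closed simp: subset_iff\<close>)
  show "\<exists>g. continuous_on Y g \<and> g ` Y \<subseteq> X \<and> (\<forall>x\<in>C. g x = f x)"
    by (intro exI[of _ "g \<circ> p"] conjI continuous_on_compose p continuous_on_subset[OF g(1)])
       (use p g qp C in \<open>auto simp: subset_iff\<close>)
qed

text \<open>A slice is a translate of a smaller cube. Cubes are indexed by sets of coordinates, with
  zeros elsewhere, to make this a change of a single coordinate.\<close>

lemma extensor_slice:
  assumes "extensor (cube (J - {j})) X" "j \<in> J"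
  shows "extensor {x \<in> cube J. x j = c} X"
proof (cases "\<bar>c\<bar> \<le> 1")
  case True
  show ?thesis
  proof (rule extensor_retract[OF assms(1) closed_cube, where p = "\<lambda>x. x(j := 0)" and q = "\<lambda>x. x(j := c)"])
    show "compact {x \<in> cube J. x j = c}"
      using compact_Int_closed[OF compact_cube closed_coordinate_eq] by (simp add: Int_def)
    show "continuous_on {x \<in> cube J. x j = c} (\<lambda>x. x(j := 0))"
         "continuous_on (cube (J - {j})) (\<lambda>x. x(j := c))"
      by (rule continuous_on_fun_upd_const)+
  qed (use True assms(2) in \<open>auto simp: cube_def fun_upd_def split: if_splits\<close>)
next
  case False
  then have "{x \<in> cube J. x j = c} = {}" using assms(2) by (auto simp: cube_def)
  then show ?thesis by (simp only: extensor_empty)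
qed

lemma extensor_cube_bd:
  assumes "finite J" "\<And>j. j \<in> J \<Longrightarrow> extensor (cube (J - {j})) X"
  shows "extensor (cube_bd J) X"
  unfolding cube_bd_eq using assms
  by (intro extensor_UN extensor_Un closed_Un closed_slice extensor_slice) auto

text \<open>Absolute neighbourhood extensors, restricted to the domains needed here. This local
  property is what lets \<open>fills\<close>, a statement about boundaries only, imply extension
  from arbitrary closed sets.\<close>

definition nbhd_extensor :: "'b::topological_space set \<Rightarrow> bool" where
  "nbhd_extensor X \<longleftrightarrow> (\<forall>(C :: (nat \<Rightarrow> real) set) f. closed C \<and> continuous_on C f \<and> f ` C \<subseteq> X \<longrightarrow>
     (\<exists>U g. open U \<and> C \<subseteq> U \<and> continuous_on U g \<and> g ` U \<subseteq> X \<and> (\<forall>x\<in>C. g x = f x)))"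

lemma fills_box:
  fixes c :: "nat \<Rightarrow> real" and e :: real and J :: "nat set"
  defines "Q \<equiv> {x. (\<forall>j\<in>J. \<bar>x j - c j\<bar> \<le> e) \<and> (\<forall>j. j \<notin> J \<longrightarrow> x j = 0)}"
  assumes "fills J X" "e > 0"
    and f: "continuous_on {x \<in> Q. \<exists>j\<in>J. \<bar>x j - c j\<bar> = e} f" "f ` {x \<in> Q. \<exists>j\<in>J. \<bar>x j - c j\<bar> = e} \<subseteq> X"
  obtains g where "continuous_on Q g" "g ` Q \<subseteq> X"
    "\<And>x. x \<in> Q \<Longrightarrow> \<exists>j\<in>J. \<bar>x j - c j\<bar> = e \<Longrightarrow> g x = f x"
proof -
  define a where "a = (\<lambda>(x :: nat \<Rightarrow> real) j. if j \<in> J then c j + e * x j else 0)"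
  define b where "b = (\<lambda>(x :: nat \<Rightarrow> real) j. if j \<in> J then (x j - c j) / e else 0)"
  have cont: "continuous_on S a" "continuous_on S b" for S
  proof -
    show "continuous_on S a"
    proof (rule continuous_on_coordinatewise_then_product)
      show "continuous_on S (\<lambda>x. a x i)" for i
        by (cases "i \<in> J") (auto simp: a_def intro!: continuous_intros)
    qed
    show "continuous_on S b"
    proof (rule continuous_on_coordinatewise_then_product)
      show "continuous_on S (\<lambda>x. b x i)" for i
        using \<open>e > 0\<close> by (cases "i \<in> J") (auto simp: b_def intro!: continuous_intros)
    qed
  qed
  have a: "a ` cube_bd J \<subseteq> {x \<in> Q. \<exists>j\<in>J. \<bar>x j - c j\<bar> = e}"
    using \<open>e > 0\<close> by (fastforce simp: a_def cube_bd_def cube_def Q_def abs_mult)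
  have bQ: "b ` Q \<subseteq> cube J"
    using \<open>e > 0\<close> by (auto simp: b_def cube_def Q_def)
  have bQb: "b x \<in> cube_bd J" if "x \<in> Q" "\<exists>j\<in>J. \<bar>x j - c j\<bar> = e" for x
    using that bQ \<open>e > 0\<close> by (auto simp: b_def cube_bd_def)
  have ab: "a (b x) = x" if "x \<in> Q" for x
    using that \<open>e > 0\<close> by (auto simp: a_def b_def Q_def)
  have "continuous_on (cube_bd J) (f \<circ> a)"
    by (intro continuous_on_compose cont continuous_on_subset[OF f(1) a])
  moreover have "(f \<circ> a) ` cube_bd J \<subseteq> X" using a f(2) by (auto simp: image_subset_iff)
  ultimately obtain g where g: "continuous_on (cube J) g" "g ` cube J \<subseteq> X"
    "\<And>x. x \<in> cube_bd J \<Longrightarrow> g x = f (a x)"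
    using \<open>fills J X\<close> unfolding fills_def by (metis comp_apply)
  show thesis
  proof
    show "continuous_on Q (g \<circ> b)"
      by (intro continuous_on_compose cont continuous_on_subset[OF g(1) bQ])
    show "(g \<circ> b) ` Q \<subseteq> X" using bQ g(2) by auto
    show "(g \<circ> b) x = f x" if "x \<in> Q" "\<exists>j\<in>J. \<bar>x j - c j\<bar> = e" for x
      using g(3)[OF bQb[OF that]] ab[OF that(1)] by simp
  qed
qed

text \<open>A Lebesgue number: the compact sets \<open>C\<close> and \<open>cube J - U\<close> have
  positive distance in the maximum norm. The degenerate cases are split off because the minimum and
  \<open>Max\<close> need nonempty sets.\<close>

lemma cube_nbhd_uniform:
  assumes "finite J" "closed C" "C \<subseteq> cube J" "open U" "C \<subseteq> U"
  obtains e where "e > 0" "\<And>x y. x \<in> C \<Longrightarrow> y \<in> cube J \<Longrightarrow> (\<And>j. j \<in> J \<Longrightarrow> \<bar>x j - y j\<bar> \<le> e) \<Longrightarrow> y \<in> U"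
proof (cases "C \<times> (cube J - U) = {} \<or> J = {}")
  case True
  then show thesis
  proof
    assume "C \<times> (cube J - U) = {}"
    then show thesis by (intro that[of 1]) auto
  next
    assume "J = {}"
    then have "cube J = {\<lambda>_. 0}" by (auto simp: cube_def)
    then show thesis using assms by (intro that[of 1]) auto
  qed
next
  case False
  define d where "d = (\<lambda>z :: (nat \<Rightarrow> real) \<times> (nat \<Rightarrow> real). Max ((\<lambda>j. \<bar>fst z j - snd z j\<bar>) ` J))"
  have "compact C" using assms compact_cube by (metis compact_Int_closed inf.absorb2)
  moreover have "compact (cube J - U)" by (simp add: compact_diff compact_cube assms)
  ultimately have "compact (C \<times> (cube J - U))" by (rule compact_Times)
  moreover have "continuous_on (C \<times> (cube J - U)) d"
    unfolding d_def using False assms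
    by (intro continuous_on_Max continuous_intros continuous_on_product_then_coordinatewise[OF continuous_on_fst]
        continuous_on_product_then_coordinatewise[OF continuous_on_snd]) auto
  ultimately obtain z where z: "z \<in> C \<times> (cube J - U)" "\<And>w. w \<in> C \<times> (cube J - U) \<Longrightarrow> d z \<le> d w"
    using False continuous_attains_inf[of "C \<times> (cube J - U)" d] by metis
  have "\<exists>j\<in>J. fst z j \<noteq> snd z j"
  proof (rule ccontr)
    assume eq: "\<not> ?thesis"
    have "fst z \<in> cube J" "snd z \<in> cube J" using z(1) assms(3) by auto
    then have "fst z j = snd z j" for j using eq by (cases "j \<in> J") (auto simp: cube_def)
    then have "fst z = snd z" by (rule ext)
    then show False using z(1) assms(5) by auto
  qed
  then have "d z > 0" unfolding d_def using False assms by (subst Max_gr_iff) auto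
  show thesis
  proof (rule that[of "d z / 2"])
    show "d z / 2 > 0" using \<open>d z > 0\<close> by simp
    fix x y assume x: "x \<in> C" "y \<in> cube J" and le: "\<And>j. j \<in> J \<Longrightarrow> \<bar>x j - y j\<bar> \<le> d z / 2"
    show "y \<in> U"
    proof (rule ccontr)
      assume "y \<notin> U"
      then have "d z \<le> d (x, y)" using z(2) x by auto
      moreover have "d (x, y) \<le> d z / 2" unfolding d_def using le False assms
        by (subst Max_le_iff) (auto simp: d_def)
      ultimately show False using \<open>d z > 0\<close> by simp
    qed
  qed
qed

lemma cube_grid_index:
  fixes t :: real
  assumes "\<bar>t\<bar> \<le> 1" "n > 0"
  shows "\<exists>k<n. \<bar>t - (-1 + (2 * real k + 1) / real n)\<bar> \<le> 1 / real n"
\<comment> \<open>The right end is separate, since rounding down would give the index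
  \<open>n\<close> there.\<close>
proof (cases "t = 1")
  case True
  then show ?thesis using assms by (intro exI[of _ "n - 1"]) (auto simp: of_nat_diff field_simps)
next
  case False
  define s where "s = (t + 1) * real n / 2"
  define k where "k = nat \<lfloor>s\<rfloor>"
  have "0 \<le> t + 1" "t + 1 < 2" using assms(1) False by auto
  then have "0 \<le> s" "s < n" using assms(2) by (auto simp: s_def simp del: distrib_right_numeral)
  then have "k < n" "real k \<le> s" "s \<le> real k + 1" unfolding k_def by linarith+
  moreover have "t = -1 + 2 * s / n" using assms by (simp add: s_def field_simps)
  ultimately show ?thesis using assms
    by (intro exI[of _ k]) (auto simp: abs_le_iff field_simps)
qed

text \<open>Induction on the dimension with a fine grid. The map is first extended to a
  neighbourhood of \<open>C\<close> and kept on all boxes that meet \<open>C\<close>. It is then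
  extended over the walls of the grid, which are smaller cubes, and finally \<open>fills\<close> is
  applied to each remaining box.\<close>

theorem extensor_cube:
  assumes "finite J" "nbhd_extensor X" "\<And>I. I \<subseteq> J \<Longrightarrow> fills I X"
  shows "extensor (cube J) X"
  using assms(1,3)
proof (induction J rule: finite_psubset_induct)
  case (psubset J)
  show ?case
  proof (cases "J = {}")
    case True
    have "fills {} X" using psubset.prems True by auto
    then obtain g where g: "continuous_on (cube {}) g" "g ` cube {} \<subseteq> X"
      unfolding fills_def by (auto simp: cube_bd_def)
    have c: "cube {} = {\<lambda>_. 0}" by (auto simp: cube_def)
    show ?thesis unfolding extensor_def True
    proof clarify
      fix C and f :: "(nat \<Rightarrow> real) \<Rightarrow> 'a" assume "C \<subseteq> cube {}" "f ` C \<subseteq> X"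
      then show "\<exists>g. continuous_on (cube {}) g \<and> g ` cube {} \<subseteq> X \<and> (\<forall>x\<in>C. g x = f x)"
        using g c by (intro exI[of _ "if C = {} then g else f"]) auto
    qed
  next
    case False
    note J = \<open>finite J\<close>
    show ?thesis unfolding extensor_def
    proof clarify
      fix C and f :: "(nat \<Rightarrow> real) \<Rightarrow> 'a"
      assume C: "closed C" "C \<subseteq> cube J" and f: "continuous_on C f" "f ` C \<subseteq> X"
      obtain U g where U: "open U" "C \<subseteq> U" and g: "continuous_on U g" "g ` U \<subseteq> X" "\<forall>x\<in>C. g x = f x"
        using assms(2) C f unfolding nbhd_extensor_def by metis
      obtain e where e: "e > 0"
        "\<And>x y. x \<in> C \<Longrightarrow> y \<in> cube J \<Longrightarrow> (\<And>j. j \<in> J \<Longrightarrow> \<bar>x j - y j\<bar> \<le> e) \<Longrightarrow> y \<in> U"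
        using cube_nbhd_uniform[OF J C U] by blast
      \<comment> \<open>Boxes will have side \<open>2 / n \<le> e\<close>, so a box that meets
        \<open>C\<close> lies in \<open>U\<close>.\<close>
      obtain n :: nat where n: "2 / e < real n" using reals_Archimedean2 by blast
      have "0 < real n" using n e(1) by (meson divide_pos_pos less_trans zero_less_numeral)
      then have n0: "n > 0" by simp
      have ne: "2 / real n \<le> e" using n e(1) \<open>0 < real n\<close> by (simp add: field_simps)
      define c where "c = (\<lambda>(\<kappa> :: nat \<Rightarrow> nat) j. -1 + (2 * real (\<kappa> j) + 1) / real n)"
      define Q where "Q = (\<lambda>\<kappa>. {x. (\<forall>j\<in>J. \<bar>x j - c \<kappa> j\<bar> \<le> 1 / real n) \<and> (\<forall>j. j \<notin> J \<longrightarrow> x j = 0)})"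
      define Qb where "Qb = (\<lambda>\<kappa>. {x \<in> Q \<kappa>. \<exists>j\<in>J. \<bar>x j - c \<kappa> j\<bar> = 1 / real n})"
      define I where "I = PiE J (\<lambda>_. {..<n})"
      \<comment> \<open>The walls of the grid. They contain the boundary of every box, and each is a
        slice of \<open>cube J\<close>, to which the induction hypothesis applies.\<close>
      define H where "H = (\<Union>j\<in>J. \<Union>k\<in>{..n}. {x \<in> cube J. x j = -1 + 2 * real k / real n})"
      have "finite I" unfolding I_def using J by (intro finite_PiE) auto
      have Q_closed: "closed (Q \<kappa>)" for \<kappa>
      proof -
        have "Q \<kappa> = (\<Inter>j. {x. if j \<in> J then \<bar>x j - c \<kappa> j\<bar> \<le> 1 / real n else x j = 0})"
          by (auto simp: Q_def split: if_splits)
        also have "closed \<dots>"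
        proof (rule closed_INT, rule ballI)
          show "closed {x. if j \<in> J then \<bar>x j - c \<kappa> j\<bar> \<le> 1 / real n else x j = 0}" for j
            by (cases "j \<in> J") (auto intro!: closed_Collect_le closed_Collect_eq continuous_intros)
        qed
        finally show ?thesis .
      qed
      have Q_cube: "Q \<kappa> \<subseteq> cube J" if "\<kappa> \<in> I" for \<kappa>
      proof
        fix x assume x: "x \<in> Q \<kappa>"
        have "\<bar>x j\<bar> \<le> 1" if "j \<in> J" for j
        proof -
          have "real (\<kappa> j) + 1 \<le> real n" using \<open>\<kappa> \<in> I\<close> that unfolding I_def
            by (metis PiE_mem Suc_eq_plus1 Suc_leI lessThan_iff of_nat_1 of_nat_add of_nat_le_iff)
          moreover have "\<bar>x j - (-1 + (2 * real (\<kappa> j) + 1) / real n)\<bar> \<le> 1 / real n"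
            using x that by (auto simp: Q_def c_def)
          moreover from this have "real n * (x j + 1) \<le> 2 + real (\<kappa> j) * 2" "real (\<kappa> j) * 2 \<le> real n * (x j + 1)"
            using \<open>0 < real n\<close> by (auto simp: abs_le_iff field_simps)
          ultimately have "real n * (x j + 1) \<le> real n * 2" "real n * 0 \<le> real n * (x j + 1)"
            by linarith+
          then have "x j + 1 \<le> 2" "0 \<le> x j + 1"
            using \<open>0 < real n\<close> by (simp_all only: mult_le_cancel_left_pos)
          then show ?thesis by auto
        qed
        then show "x \<in> cube J" using x by (auto simp: Q_def cube_def)
      qed
      have cover: "cube J \<subseteq> (\<Union>\<kappa>\<in>I. Q \<kappa>)"
      proof
        fix x assume x: "x \<in> cube J"
        then have "\<forall>j\<in>J. \<exists>k<n. \<bar>x j - (-1 + (2 * real k + 1) / real n)\<bar> \<le> 1 / real n"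
          using cube_grid_index n0 by (auto simp: cube_def)
        then obtain k where k: "\<forall>j\<in>J. k j < n \<and> \<bar>x j - (-1 + (2 * real (k j) + 1) / real n)\<bar> \<le> 1 / real n"
          by metis
        then have "restrict k J \<in> I" "x \<in> Q (restrict k J)"
          using x by (auto simp: I_def Q_def c_def cube_def)
        then show "x \<in> (\<Union>\<kappa>\<in>I. Q \<kappa>)" by blast
      qed
      have Qb_H: "Qb \<kappa> \<subseteq> H" if "\<kappa> \<in> I" for \<kappa>
      proof
        fix x assume x: "x \<in> Qb \<kappa>"
        then obtain j where j: "j \<in> J" "\<bar>x j - c \<kappa> j\<bar> = 1 / real n" by (auto simp: Qb_def)
        have "\<kappa> j < n" using that j by (auto simp: I_def PiE_iff)
        have "x j = -1 + 2 * real (\<kappa> j) / real n \<or> x j = -1 + 2 * real (Suc (\<kappa> j)) / real n"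
        proof -
          have "x j = c \<kappa> j + 1 / real n \<or> x j = c \<kappa> j - 1 / real n"
            using j(2) by (auto simp: abs_if split: if_splits)
          then show ?thesis unfolding c_def by (auto simp: add_divide_distrib)
        qed
        then have "\<exists>k\<in>{..n}. x j = -1 + 2 * real k / real n"
          using \<open>\<kappa> j < n\<close> by (metis Suc_leI atMost_iff less_imp_le)
        then show "x \<in> H" using j x Q_cube[OF that] by (auto simp: H_def Qb_def)
      qed
      \<comment> \<open>The centres of different boxes differ by at least one full side
        \<open>2 / n\<close> in some coordinate. So boxes meet only in their boundaries, where all
        the fillings equal \<open>h\<close>, and the pieces can be pasted.\<close>
      have overlap: "x \<in> Qb \<kappa>" if A: "\<kappa> \<in> I" "\<kappa>' \<in> I" "\<kappa> \<noteq> \<kappa>'" "x \<in> Q \<kappa>" "x \<in> Q \<kappa>'" for x \<kappa> \<kappa>'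
      proof -
        obtain j where j: "j \<in> J" "\<kappa> j \<noteq> \<kappa>' j" using A(1-3) unfolding I_def by (meson PiE_ext)
        have 1: "\<bar>x j - c \<kappa> j\<bar> \<le> 1 / real n" "\<bar>x j - c \<kappa>' j\<bar> \<le> 1 / real n" using A j by (auto simp: Q_def)
        have "\<bar>real (\<kappa> j) - real (\<kappa>' j)\<bar> \<ge> 1" using j(2) by linarith
        then have "\<bar>c \<kappa> j - c \<kappa>' j\<bar> \<ge> 2 / real n"
        proof -
          have "c \<kappa> j - c \<kappa>' j = 2 * (real (\<kappa> j) - real (\<kappa>' j)) / real n" using \<open>0 < real n\<close>
            by (simp add: c_def field_simps)
          then have "\<bar>c \<kappa> j - c \<kappa>' j\<bar> = 2 * \<bar>real (\<kappa> j) - real (\<kappa>' j)\<bar> / real n"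
            using \<open>0 < real n\<close> by (simp only: abs_divide abs_mult abs_numeral abs_of_nat)
          then show ?thesis using \<open>\<bar>real (\<kappa> j) - real (\<kappa>' j)\<bar> \<ge> 1\<close> \<open>0 < real n\<close>
            by (simp add: divide_right_mono)
        qed
        moreover have "2 / real n = 1 / real n + 1 / real n" by simp
        ultimately have "\<bar>x j - c \<kappa> j\<bar> = 1 / real n" using 1 by linarith
        then show ?thesis using A j by (auto simp: Qb_def)
      qed
      have "extensor H X" unfolding H_def
      proof (intro extensor_UN)
        fix j k assume "j \<in> J"
        then have "extensor (cube (J - {j})) X"
          by (intro psubset.IH psubset.prems) auto
        then show "extensor {x \<in> cube J. x j = -1 + 2 * real k / real n} X"
          using \<open>j \<in> J\<close> by (rule extensor_slice)
      qed (use J in \<open>auto intro!: closed_slice closed_UN\<close>)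
      have "closed H" unfolding H_def using J by (intro closed_UN ballI closed_slice) auto
      define I' where "I' = {\<kappa> \<in> I. Q \<kappa> \<inter> C \<noteq> {}}"
      define C' where "C' = (\<Union>\<kappa>\<in>I'. Q \<kappa>)"
      have "finite I'" using \<open>finite I\<close> by (auto simp: I'_def)
      then have "closed C'" unfolding C'_def using Q_closed by (intro closed_UN) auto
      have C'U: "C' \<subseteq> U"
      proof
        fix y assume "y \<in> C'"
        then obtain \<kappa> x where *: "\<kappa> \<in> I" "y \<in> Q \<kappa>" "x \<in> Q \<kappa>" "x \<in> C" by (auto simp: C'_def I'_def)
        have "\<bar>x j - y j\<bar> \<le> e" if "j \<in> J" for j
        proof -
          have "\<bar>x j - c \<kappa> j\<bar> \<le> 1 / real n" "\<bar>y j - c \<kappa> j\<bar> \<le> 1 / real n" using * that by (auto simp: Q_def)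
          moreover have "2 / real n = 1 / real n + 1 / real n" by simp
          ultimately show ?thesis using ne by linarith
        qed
        then show "y \<in> U" using e(2) * Q_cube by blast
      qed
      have "g ` (C' \<inter> H) \<subseteq> X" "continuous_on (C' \<inter> H) g"
        using C'U g(1,2) by (blast, blast intro: continuous_on_subset)
      \<comment> \<open>The boxes around \<open>C\<close> keep \<open>g\<close>, so the map on the
        walls has to agree with \<open>g\<close> there.\<close>
      then obtain h where h: "continuous_on H h" "h ` H \<subseteq> X" "\<And>x. x \<in> C' \<inter> H \<Longrightarrow> h x = g x"
        using extensorD[OF \<open>extensor H X\<close> closed_Int[OF \<open>closed C'\<close> \<open>closed H\<close>] Int_lower2] by metis
      have "\<exists>q. continuous_on (Q \<kappa>) q \<and> q ` Q \<kappa> \<subseteq> X \<and> (\<forall>x\<in>Qb \<kappa>. q x = h x) \<and>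
              (\<kappa> \<in> I' \<longrightarrow> q = g)" if "\<kappa> \<in> I" for \<kappa>
      proof (cases "\<kappa> \<in> I'")
        case True
        then have "Q \<kappa> \<subseteq> C'" by (auto simp: C'_def)
        then have QU: "Q \<kappa> \<subseteq> U" and QbC: "Qb \<kappa> \<subseteq> C' \<inter> H"
          using C'U Qb_H[OF that] unfolding Qb_def by blast+
        have "continuous_on (Q \<kappa>) g" using QU g(1) by (rule continuous_on_subset[rotated])
        moreover have "g ` Q \<kappa> \<subseteq> X" using QU g(2) by blast
        moreover have "\<forall>x\<in>Qb \<kappa>. g x = h x" using QbC h(3) by (metis subsetD)
        ultimately show ?thesis by blast
      next
        case F: False
        have QbH: "Qb \<kappa> \<subseteq> H" by (rule Qb_H[OF that])
        have "fills J X" using psubset.prems by auto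
        then obtain q where "continuous_on (Q \<kappa>) q" "q ` Q \<kappa> \<subseteq> X"
          "\<And>x. x \<in> Q \<kappa> \<Longrightarrow> \<exists>j\<in>J. \<bar>x j - c \<kappa> j\<bar> = 1 / real n \<Longrightarrow> q x = h x"
          unfolding Q_def
        proof (rule fills_box[where c = "c \<kappa>" and e = "1 / real n" and f = h], goal_cases)
          case 2
          show ?case using QbH h(1) unfolding Qb_def Q_def by (rule continuous_on_subset[rotated])
        next
          case 3
          show ?case using QbH h(2) unfolding Qb_def Q_def by blast
        qed (use \<open>0 < real n\<close> in auto)
        then show ?thesis using F by (intro exI[of _ q]) (auto simp: Qb_def)
      qed
      then obtain q where q: "\<And>\<kappa>. \<kappa> \<in> I \<Longrightarrow> continuous_on (Q \<kappa>) (q \<kappa>)" "\<And>\<kappa>. \<kappa> \<in> I \<Longrightarrow> q \<kappa> ` Q \<kappa> \<subseteq> X"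
        "\<And>\<kappa> x. \<kappa> \<in> I \<Longrightarrow> x \<in> Qb \<kappa> \<Longrightarrow> q \<kappa> x = h x" "\<And>\<kappa>. \<kappa> \<in> I' \<Longrightarrow> q \<kappa> = g"
        using I'_def by (metis (no_types, lifting) mem_Collect_eq)
      obtain G where G: "continuous_map (top_of_set (cube J)) (euclidean :: 'a topology) G"
        "\<And>x \<kappa>. \<lbrakk>\<kappa> \<in> I; x \<in> topspace (top_of_set (cube J)) \<inter> Q \<kappa>\<rbrakk> \<Longrightarrow> G x = q \<kappa> x"
      proof (rule pasting_lemma_exists_closed[OF \<open>finite I\<close>, of "top_of_set (cube J)" Q euclidean q])
        show "topspace (top_of_set (cube J)) \<subseteq> \<Union> (Q ` I)" using cover by simp
        show "closedin (top_of_set (cube J)) (Q \<kappa>)" if "\<kappa> \<in> I" for \<kappa>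
          using that Q_closed Q_cube by (simp add: closed_subset)
        show "continuous_map (subtopology (top_of_set (cube J)) (Q \<kappa>)) euclidean (q \<kappa>)" if "\<kappa> \<in> I" for \<kappa>
          using q(1)[OF that] Q_cube[OF that] by (simp add: subtopology_subtopology Int_absorb1)
        show "q \<kappa> x = q \<kappa>' x" if "\<kappa> \<in> I" "\<kappa>' \<in> I" "x \<in> topspace (top_of_set (cube J)) \<inter> Q \<kappa> \<inter> Q \<kappa>'" for \<kappa> \<kappa>' x
          using that overlap[of \<kappa> \<kappa>' x] overlap[of \<kappa>' \<kappa> x] q(3)[of \<kappa> x] q(3)[of \<kappa>' x]
          by (cases "\<kappa> = \<kappa>'") auto
      qed (rule that)
      show "\<exists>g. continuous_on (cube J) g \<and> g ` cube J \<subseteq> X \<and> (\<forall>x\<in>C. g x = f x)"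
      proof (intro exI[of _ G] conjI ballI)
        show "continuous_on (cube J) G" using G(1) by simp
        show "G ` cube J \<subseteq> X"
        proof clarify
          fix x assume "x \<in> cube J"
          moreover then obtain \<kappa> where "\<kappa> \<in> I" "x \<in> Q \<kappa>" using cover by auto
          ultimately show "G x \<in> X" using G(2) q(2) by (auto simp: image_subset_iff)
        qed
        fix x assume x: "x \<in> C"
        then obtain \<kappa> where \<kappa>: "\<kappa> \<in> I" "x \<in> Q \<kappa>" using cover C by auto
        then have "\<kappa> \<in> I'" using x by (auto simp: I'_def)
        then show "G x = f x" using G(2) q(4) \<kappa> x C g(3) by auto
      qed
    qed
  qed
qed

section \<open>Connectivity of finite complexes as an extension property\<close>

definition geo :: "'a set set \<Rightarrow> ('a \<Rightarrow> real) set" where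
  "geo K = {x. (\<forall>v. 0 \<le> x v) \<and> {v. x v \<noteq> 0} \<in> K \<and> (\<Sum>v | x v \<noteq> 0. x v) = 1}"

lemma realization_eq: "realization K = top_of_set (geo K)"
  by (simp add: realization_def geo_def euclidean_product_topology)

lemma simplicial_complex_onD:
  assumes "simplicial_complex_on V K"
  shows "finite V" "\<And>F. F \<in> K \<Longrightarrow> F \<subseteq> V" "{} \<in> K" "\<And>F G. F \<in> K \<Longrightarrow> G \<subseteq> F \<Longrightarrow> G \<in> K"
    "finite K" "\<And>F. F \<in> K \<Longrightarrow> finite F"
  using assms unfolding simplicial_complex_on_def
  by (blast, blast, blast, blast, meson finite_Pow_iff finite_subset, meson PowD finite_subset subset_iff)

lemma geo_iff:
  assumes "simplicial_complex_on V K"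
  shows "x \<in> geo K \<longleftrightarrow> (\<forall>v. 0 \<le> x v) \<and> {v. x v \<noteq> 0} \<in> K \<and> sum x V = 1"
proof -
  have "(\<Sum>v | x v \<noteq> 0. x v) = sum x V" if "{v. x v \<noteq> 0} \<in> K"
    using simplicial_complex_onD(1,2)[OF assms] that by (intro sum.mono_neutral_left) auto
  then show ?thesis by (auto simp: geo_def)
qed

text \<open>Tietze extends each barycentric coordinate separately, which may give a support outside
  \<open>K\<close>. Subtracting a threshold \<open>t\<close>, truncating at zero and normalising
  repairs this near \<open>C\<close>, without any simplicial subdivision.\<close>

lemma nbhd_extensor_geo:
  assumes K: "simplicial_complex_on V K"
  shows "nbhd_extensor (geo K)"
  unfolding nbhd_extensor_def
proof clarify
  fix C :: "(nat \<Rightarrow> real) set" and f :: "(nat \<Rightarrow> real) \<Rightarrow> 'a \<Rightarrow> real"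
  assume C: "closed C" and f: "continuous_on C f" "f ` C \<subseteq> geo K"
  have "\<exists>g. continuous_on UNIV g \<and> (\<forall>x\<in>C. g x = f x v)" for v
  proof -
    have "continuous_on C (\<lambda>x. f x v)" using f(1) by (rule continuous_on_product_then_coordinatewise)
    moreover have "closedin (top_of_set UNIV) C" using C by simp
    ultimately show ?thesis by (metis Tietze_unbounded)
  qed
  then obtain F where F: "\<And>v. continuous_on UNIV (F v)" "\<And>v x. x \<in> C \<Longrightarrow> F v x = f x v" by metis
  define N where "N = Pow V - K"
  \<comment> \<open>Every non-face has a coordinate that is at most \<open>t x\<close>. So the
    coordinates above \<open>t x\<close> form a face. On \<open>C\<close> each non-face already has
    a vanishing coordinate, which gives \<open>t x = 0\<close>; the inserted 0 keeps
    \<open>t\<close> nonnegative.\<close>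
  define t where "t = (\<lambda>x. Max (insert 0 ((\<lambda>S. Min ((\<lambda>v. F v x) ` S)) ` N)))"
  define G where "G = (\<lambda>x v. max 0 (F v x - t x))"
  define s where "s = (\<lambda>x. \<Sum>v\<in>V. G x v)"
  have "finite V" using simplicial_complex_onD(1)[OF K] .
  then have "finite N" by (simp add: N_def)
  have N: "finite S" "S \<noteq> {}" if "S \<in> N" for S
    using that simplicial_complex_onD(1,3)[OF K] by (auto simp: N_def intro: finite_subset)
  have t: "continuous_on UNIV t"
  proof (cases "N = {}")
    case True
    then show ?thesis by (simp add: t_def)
  next
    case False
    then have "t = (\<lambda>x. max 0 (Max ((\<lambda>S. Min ((\<lambda>v. F v x) ` S)) ` N)))"
      using \<open>finite N\<close> by (simp add: t_def)
    then show ?thesis using False \<open>finite N\<close> N F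
      by (simp add: continuous_on_max continuous_on_Max continuous_on_Min)
  qed
  have G: "continuous_on UNIV (\<lambda>x. G x v)" for v
    unfolding G_def by (intro continuous_intros F t)
  have s: "continuous_on UNIV s" unfolding s_def by (intro continuous_intros G)
  have tN: "Min ((\<lambda>v. F v x) ` S) \<le> t x" if "S \<in> N" for S x
    unfolding t_def using \<open>finite N\<close> that by (intro Max_ge) auto
  have tC: "t x = 0" if "x \<in> C" for x
    unfolding t_def
  proof (rule Max_eqI)
    fix y assume "y \<in> insert 0 ((\<lambda>S. Min ((\<lambda>v. F v x) ` S)) ` N)"
    then show "y \<le> 0"
    proof
      assume "y \<in> (\<lambda>S. Min ((\<lambda>v. F v x) ` S)) ` N"
      then obtain S where S: "S \<in> N" "y = Min ((\<lambda>v. F v x) ` S)" by auto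
      have "f x \<in> geo K" using f that by auto
      then have "{v. f x v \<noteq> 0} \<in> K" by (simp add: geo_def)
      then have "\<not> S \<subseteq> {v. f x v \<noteq> 0}"
        using S simplicial_complex_onD(4)[OF K] by (auto simp: N_def)
      then obtain v where "v \<in> S" "f x v = 0" by auto
      then have "F v x = 0" using F that by simp
      then show "y \<le> 0" using S N \<open>v \<in> S\<close> by (metis Min_le finite_imageI imageI)
    qed simp
  qed (use \<open>finite N\<close> in auto)
  have GC: "G x v = f x v" if "x \<in> C" for x v
  proof -
    have "0 \<le> f x v" using f that by (auto simp: geo_def)
    then show ?thesis using that tC F by (simp add: G_def)
  qed
  define U where "U = {x. 0 < s x}"
  have "open U" unfolding U_def by (intro open_Collect_less s continuous_intros)
  moreover have CU: "C \<subseteq> U" and sC: "\<And>x. x \<in> C \<Longrightarrow> s x = 1"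
  proof -
    show *: "s x = 1" if "x \<in> C" for x
    proof -
      have "f x \<in> geo K" using f that by auto
      then show ?thesis using that GC by (simp add: s_def geo_iff[OF K])
    qed
    show "C \<subseteq> U" using * by (auto simp: U_def)
  qed
  define g where "g = (\<lambda>x v. if v \<in> V then G x v / s x else 0)"
  have "continuous_on U g"
  proof (rule continuous_on_coordinatewise_then_product)
    fix v
    have "continuous_on U (\<lambda>x. G x v / s x)"
      by (intro continuous_intros continuous_on_subset[OF G] continuous_on_subset[OF s])
         (auto simp: U_def)
    then show "continuous_on U (\<lambda>x. g x v)" by (cases "v \<in> V") (auto simp: g_def)
  qed
  moreover have "g ` U \<subseteq> geo K"
  proof clarify
    fix x assume x: "x \<in> U"
    then have "s x > 0" by (simp add: U_def)
    let ?S = "{v \<in> V. F v x > t x}"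
    have "{v. g x v \<noteq> 0} = ?S" using \<open>s x > 0\<close> by (auto simp: g_def G_def max_def)
    moreover have "?S \<in> K"
    proof (rule ccontr)
      assume "?S \<notin> K"
      then have S: "?S \<in> N" by (auto simp: N_def)
      then have "Min ((\<lambda>v. F v x) ` ?S) > t x" using N[OF S] by (subst Min_gr_iff) auto
      then show False using tN[OF S, of x] by simp
    qed
    moreover have "sum (g x) V = 1"
      using \<open>s x > 0\<close> by (simp add: g_def s_def flip: sum_divide_distrib)
    ultimately show "g x \<in> geo K" using \<open>s x > 0\<close>
      by (auto simp: geo_iff[OF K] g_def G_def)
  qed
  moreover have "\<forall>x\<in>C. g x = f x"
  proof (intro ballI ext)
    fix x v assume x: "x \<in> C"
    then have "f x \<in> geo K" using f by auto
    then have "{v. f x v \<noteq> 0} \<subseteq> V" using simplicial_complex_onD(2)[OF K] by (auto simp: geo_def)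
    then show "g x v = f x v" using x GC sC by (auto simp: g_def)
  qed
  ultimately show "\<exists>U g. open U \<and> C \<subseteq> U \<and> continuous_on U g \<and> g ` U \<subseteq> geo K \<and> (\<forall>x\<in>C. g x = f x)"
    using CU by (intro exI[of _ U] exI[of _ g] conjI)
qed

definition sphere_set :: "nat \<Rightarrow> (nat \<Rightarrow> real) set" where
  "sphere_set i = {x. (\<Sum>j\<le>i. (x j)\<^sup>2) = 1 \<and> (\<forall>j>i. x j = 0)}"

lemma nsphere_eq: "nsphere i = top_of_set (sphere_set i)"
  by (simp add: nsphere sphere_set_def euclidean_product_topology)

lemma homotopic_constD:
  assumes "homotopic_with (\<lambda>_. True) (top_of_set S) (top_of_set X) f (\<lambda>_. c)"
  obtains h where "continuous_on ({0..1::real} \<times> S) h" "h ` ({0..1} \<times> S) \<subseteq> X"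
    "\<And>x. h (0, x) = f x" "\<And>x. h (1, x) = c"
proof -
  obtain h where "continuous_map (prod_topology (top_of_set {0..1::real}) (top_of_set S)) (top_of_set X) h"
    "\<forall>x. h (0, x) = f x" "\<forall>x. h (1, x) = c"
    using assms unfolding homotopic_with_def by blast
  then show thesis by (intro that[of h]) auto
qed

text \<open>Radial rescaling between Euclidean and maximum norm carries the sphere to the boundary
  of the cube and back. The null-homotopy is spread over the outer collar, and the inner half of the
  cube goes to the final constant.\<close>

lemma fills_of_null_homotopic:
  assumes I: "finite I" "card I = Suc i"
    and null: "\<And>f. continuous_on (sphere_set i) f \<Longrightarrow> f ` sphere_set i \<subseteq> X \<Longrightarrow>
          \<exists>c. homotopic_with (\<lambda>_. True) (top_of_set (sphere_set i)) (top_of_set X) f (\<lambda>_. c)"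
  shows "fills I X"
  unfolding fills_def
proof clarify
  fix f :: "(nat \<Rightarrow> real) \<Rightarrow> 'a"
  assume f: "continuous_on (cube_bd I) f" "f ` cube_bd I \<subseteq> X"
  have "I \<noteq> {}" using I by auto
  \<comment> \<open>The sphere uses the coordinates \<open>0, ..., i\<close>, the cube those in
    \<open>I\<close>; \<open>\<sigma>\<close> matches them.\<close>
  obtain \<sigma> where "bij_betw \<sigma> {0..<card I} I" using ex_bij_betw_nat_finite[OF I(1)] by blast
  then have \<sigma>: "bij_betw \<sigma> {..i} I" using I(2) by (simp add: atLeast0LessThan lessThan_Suc_atMost)
  define \<tau> where "\<tau> = inv_into {..i} \<sigma>"
  have \<tau>: "\<tau> j \<le> i" "\<sigma> (\<tau> j) = j" if "j \<in> I" for j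
    using that \<sigma> by (auto simp: \<tau>_def bij_betw_def inv_into_into f_inv_into_f)
  have \<sigma>I: "\<sigma> k \<in> I" "\<tau> (\<sigma> k) = k" if "k \<le> i" for k
    using that \<sigma> by (auto simp: \<tau>_def bij_betw_def)
  define M where "M = (\<lambda>s :: nat \<Rightarrow> real. Max ((\<lambda>j. \<bar>s (\<tau> j)\<bar>) ` I))"
  define N where "N = (\<lambda>x :: nat \<Rightarrow> real. Max ((\<lambda>j. \<bar>x j\<bar>) ` I))"
  define R where "R = (\<lambda>x :: nat \<Rightarrow> real. sqrt (\<Sum>k\<le>i. (x (\<sigma> k))\<^sup>2))"
  define \<beta> where "\<beta> = (\<lambda>(s :: nat \<Rightarrow> real) j. if j \<in> I then s (\<tau> j) / M s else 0)"
  define \<gamma> where "\<gamma> = (\<lambda>(x :: nat \<Rightarrow> real) k. if k \<le> i then x (\<sigma> k) / R x else 0)"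
  have Mc: "continuous_on S M" and Nc: "continuous_on S N" and Rc: "continuous_on S R" for S
    unfolding M_def N_def R_def using I(1) \<open>I \<noteq> {}\<close>
    by (intro continuous_on_Max continuous_intros; simp)+
  have Mge: "\<bar>s (\<tau> j)\<bar> \<le> M s" if "j \<in> I" for s j
    unfolding M_def using that I(1) by (intro Max_ge) auto
  have Nge: "\<bar>s j\<bar> \<le> N s" if "j \<in> I" for s j
    unfolding N_def using that I(1) by (intro Max_ge) auto
  have Mpos: "0 < M s" if "s \<in> sphere_set i" for s
  proof -
    have "\<exists>k\<le>i. s k \<noteq> 0"
    proof (rule ccontr)
      assume "\<not> ?thesis"
      then have "(\<Sum>j\<le>i. (s j)\<^sup>2) = 0" by (intro sum.neutral) auto
      then show False using that by (simp add: sphere_set_def)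
    qed
    then obtain k where "k \<le> i" "s k \<noteq> 0" by auto
    then show ?thesis using Mge[of "\<sigma> k" s] \<sigma>I[of k] by auto
  qed
  have Rpos: "0 < R x" if "0 < N x" for x
  proof -
    have "N x \<in> (\<lambda>j. \<bar>x j\<bar>) ` I" unfolding N_def using I(1) \<open>I \<noteq> {}\<close> by (intro Max_in) auto
    then obtain j where "j \<in> I" "N x = \<bar>x j\<bar>" by auto
    then have j: "j \<in> I" "x j \<noteq> 0" using that by auto
    have "0 < (x (\<sigma> (\<tau> j)))\<^sup>2" using j \<tau> by simp
    also have "\<dots> \<le> (\<Sum>k\<le>i. (x (\<sigma> k))\<^sup>2)" using \<tau>(1)[OF j(1)] by (intro member_le_sum) auto
    finally show ?thesis by (simp add: R_def)
  qed
  have \<beta>: "\<beta> ` sphere_set i \<subseteq> cube_bd I"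
  proof clarify
    fix s assume s: "s \<in> sphere_set i"
    have "M s \<in> (\<lambda>j. \<bar>s (\<tau> j)\<bar>) ` I" unfolding M_def using I(1) \<open>I \<noteq> {}\<close> by (intro Max_in) auto
    then obtain j where "j \<in> I" "\<bar>s (\<tau> j)\<bar> = M s" by auto
    then have "\<exists>j\<in>I. \<bar>\<beta> s j\<bar> = 1" using Mpos[OF s] by (intro bexI[of _ j]) (auto simp: \<beta>_def)
    then show "\<beta> s \<in> cube_bd I" using Mpos[OF s] Mge[of _ s]
      by (auto simp: cube_bd_def cube_def \<beta>_def)
  qed
  have \<beta>c: "continuous_on (sphere_set i) \<beta>"
  proof (rule continuous_on_coordinatewise_then_product)
    fix j
    have "continuous_on (sphere_set i) (\<lambda>s. s (\<tau> j) / M s)"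
      using Mpos by (intro continuous_intros Mc) force
    then show "continuous_on (sphere_set i) (\<lambda>s. \<beta> s j)" by (cases "j \<in> I") (auto simp: \<beta>_def)
  qed
  have \<gamma>: "\<gamma> x \<in> sphere_set i" if "0 < N x" for x
  proof -
    have "(\<Sum>k\<le>i. (\<gamma> x k)\<^sup>2) = (\<Sum>k\<le>i. (x (\<sigma> k))\<^sup>2) / (R x)\<^sup>2"
      by (simp add: \<gamma>_def power_divide sum_divide_distrib)
    also have "(R x)\<^sup>2 = (\<Sum>k\<le>i. (x (\<sigma> k))\<^sup>2)" by (simp add: R_def sum_nonneg)
    finally show ?thesis using Rpos[OF that] by (auto simp: sphere_set_def \<gamma>_def R_def)
  qed
  have \<beta>\<gamma>: "\<beta> (\<gamma> x) = x" and N1: "N x = 1" if A: "x \<in> cube_bd I" for x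
  proof -
    show "N x = 1" unfolding N_def
      using A I(1) by (intro Max_eqI) (auto simp: cube_bd_def cube_def image_iff)
    then have Rx: "0 < R x" using Rpos by simp
    have "M (\<gamma> x) = 1 / R x" unfolding M_def
    proof (rule Max_eqI)
      fix y assume "y \<in> (\<lambda>j. \<bar>\<gamma> x (\<tau> j)\<bar>) ` I"
      then show "y \<le> 1 / R x" using A \<tau> Rx by (auto simp: \<gamma>_def cube_bd_def cube_def divide_right_mono)
    next
      obtain j where "j \<in> I" "\<bar>x j\<bar> = 1" using A by (auto simp: cube_bd_def)
      then show "1 / R x \<in> (\<lambda>j. \<bar>\<gamma> x (\<tau> j)\<bar>) ` I" using \<tau> Rx by (auto simp: \<gamma>_def image_iff intro!: bexI[of _ j])
    qed (use I in auto)
    then show "\<beta> (\<gamma> x) = x" using A \<tau> Rx by (auto simp: \<beta>_def \<gamma>_def cube_bd_def cube_def fun_eq_iff)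
  qed
  have "continuous_on (sphere_set i) (f \<circ> \<beta>)"
    by (intro continuous_on_compose \<beta>c continuous_on_subset[OF f(1) \<beta>])
  moreover have "(f \<circ> \<beta>) ` sphere_set i \<subseteq> X" using \<beta> f(2) by auto
  ultimately obtain c where
    "homotopic_with (\<lambda>_. True) (top_of_set (sphere_set i)) (top_of_set X) (f \<circ> \<beta>) (\<lambda>_. c)"
    using null by blast
  then obtain h where h: "continuous_on ({0..1::real} \<times> sphere_set i) h" "h ` ({0..1} \<times> sphere_set i) \<subseteq> X"
    "\<And>x. h (0, x) = (f \<circ> \<beta>) x" "\<And>x. h (1, x) = c" by (rule homotopic_constD) (rule that)
  have "(\<Sum>j\<le>i. (if j = 0 then 1 else 0 :: real)\<^sup>2) = (\<Sum>j\<le>i. if j = 0 then 1 else 0)"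
    by (rule sum.cong) auto
  then have "(\<lambda>j. if j = 0 then 1 else 0) \<in> sphere_set i" by (simp add: sphere_set_def)
  then have "c \<in> X" using h(2,4) by (metis atLeastAtMost_iff imageI mem_Sigma_iff order_refl subset_iff zero_le_one)
  \<comment> \<open>The time \<open>2 - 2 * N x\<close> runs from 1 at \<open>N x = 1/2\<close> to 0
    on the boundary, where \<open>h\<close> is the given map.\<close>
  define g where "g = (\<lambda>x. if N x \<le> 1/2 then c else h (2 - 2 * N x, \<gamma> x))"
  have N0: "N x \<le> 1" if "x \<in> cube I" for x
    unfolding N_def using that I(1) \<open>I \<noteq> {}\<close> by (subst Max_le_iff) (auto simp: cube_def)
  have dom: "(2 - 2 * N x, \<gamma> x) \<in> {0..1} \<times> sphere_set i" if "x \<in> cube I" "1/2 \<le> N x" for x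
    using that N0 \<gamma>[of x] by auto
  have \<gamma>c: "continuous_on {x. 0 < N x} \<gamma>"
  proof (rule continuous_on_coordinatewise_then_product)
    fix k
    have "continuous_on {x. 0 < N x} (\<lambda>x. x (\<sigma> k) / R x)"
      using Rpos by (intro continuous_intros Rc) force
    then show "continuous_on {x. 0 < N x} (\<lambda>s. \<gamma> s k)" by (cases "k \<le> i") (auto simp: \<gamma>_def)
  qed
  have "continuous_on (cube I) g" unfolding g_def
  proof (rule continuous_on_cases_le)
    have "continuous_on {x \<in> cube I. 1/2 \<le> N x} (h \<circ> (\<lambda>x. (2 - 2 * N x, \<gamma> x)))"
      by (intro continuous_on_compose continuous_on_subset[OF h(1)] continuous_intros Nc
            continuous_on_subset[OF \<gamma>c]) (use dom in auto)
    then show "continuous_on {x \<in> cube I. 1/2 \<le> N x} (\<lambda>x. h (2 - 2 * N x, \<gamma> x))" by (simp add: comp_def)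
    fix x assume "N x = 1 / 2"
    then have "2 - 2 * N x = 1" by simp
    then show "c = h (2 - 2 * N x, \<gamma> x)" by (simp only: h(4))
  qed (use Nc in auto)
  moreover have "g ` cube I \<subseteq> X" using \<open>c \<in> X\<close> dom h(2) by (fastforce simp: g_def)
  moreover have "\<forall>x\<in>cube_bd I. g x = f x" using N1 h(3) \<beta>\<gamma> by (simp add: g_def)
  ultimately show "\<exists>g. continuous_on (cube I) g \<and> g ` cube I \<subseteq> X \<and> (\<forall>x\<in>cube_bd I. g x = f x)" by blast
qed

text \<open>For the realization \<open>X\<close> of a finite complex, \<open>conn m X\<close> means that \<open>X\<close> is
  \<open>(m - 2)\<close>-connected: the shift makes \<open>m\<close> the number of vertices of a facet when \<open>X\<close> is
  a spherical complex, and makes connectivity additive under joins.\<close>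

definition conn :: "nat \<Rightarrow> 'b::topological_space set \<Rightarrow> bool" where
  "conn m X \<longleftrightarrow> (\<forall>J. finite J \<and> card J < m \<longrightarrow> extensor (cube J) X)"

lemma conn_mono: "conn m X \<Longrightarrow> k \<le> m \<Longrightarrow> conn k X"
  by (auto simp: conn_def)

lemma extensor_nonempty:
  assumes "extensor (cube J) X" shows "X \<noteq> {}"
proof -
  have "(\<lambda>_. 0) \<in> cube J" by (simp add: cube_def)
  then show ?thesis using assms unfolding extensor_def by fastforce
qed

lemma fills_empty: "X \<noteq> {} \<Longrightarrow> fills {} X"
proof -
  assume "X \<noteq> {}"
  then obtain c where "c \<in> X" by auto
  then show ?thesis unfolding fills_def by (auto intro!: exI[of _ "\<lambda>_. c"] simp: cube_bd_def)
qed

lemma connI: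
  assumes "simplicial_complex_on V K" "m > 0 \<Longrightarrow> geo K \<noteq> {}"
    and "\<And>J. finite J \<Longrightarrow> J \<noteq> {} \<Longrightarrow> card J < m \<Longrightarrow> fills J (geo K)"
  shows "conn m (geo K)"
  unfolding conn_def
proof clarify
  fix J :: "nat set" assume J: "finite J" "card J < m"
  show "extensor (cube J) (geo K)"
  proof (rule extensor_cube[OF J(1) nbhd_extensor_geo[OF assms(1)]])
    fix I assume "I \<subseteq> J"
    then have "finite I" "card I < m"
      using J finite_subset[of I J] card_mono[of J I] by simp_all
    then show "fills I (geo K)" using assms(2,3) fills_empty J by (cases "I = {}") auto
  qed
qed

text \<open>A map on the \<open>i\<close>-sphere is tested on a cube with \<open>i + 1\<close>
  coordinates, and \<open>i \<le> k\<close> means \<open>i + 1 < k + 2\<close>. For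
  \<open>k \<le> -2\<close> the bound \<open>nat (k + 2)\<close> is 0 and both sides hold trivially.
  Conversely to the collar argument, the sphere is a closed subset of the cube, and an extension to
  the cube is contracted to its value at the origin.\<close>

theorem k_connected_iff_conn:
  assumes "simplicial_complex_on V K"
  shows "k_connected k (realization K) \<longleftrightarrow> conn (nat (k + 2)) (geo K)"
proof
  assume k: "k_connected k (realization K)"
  show "conn (nat (k + 2)) (geo K)"
  proof (rule connI[OF assms])
    show "geo K \<noteq> {}" if "0 < nat (k + 2)"
      using k that by (simp add: k_connected_def realization_eq)
    fix J :: "nat set" assume J: "finite J" "J \<noteq> {}" "card J < nat (k + 2)"
    then obtain i where i: "card J = Suc i" by (metis card_gt_0_iff gr0_implies_Suc)
    then have "int i \<le> k" using J by linarith
    show "fills J (geo K)"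
    proof (rule fills_of_null_homotopic[OF J(1) i])
      fix f :: "(nat \<Rightarrow> real) \<Rightarrow> 'a \<Rightarrow> real"
      assume "continuous_on (sphere_set i) f" "f ` sphere_set i \<subseteq> geo K"
      then have "continuous_map (nsphere i) (realization K) f"
        by (auto simp: nsphere_eq realization_eq continuous_map_subtopology_eu)
      then show "\<exists>c. homotopic_with (\<lambda>_. True) (top_of_set (sphere_set i)) (top_of_set (geo K)) f (\<lambda>_. c)"
        using k \<open>int i \<le> k\<close> unfolding k_connected_def by (simp add: nsphere_eq realization_eq)
    qed
  qed
next
  assume c: "conn (nat (k + 2)) (geo K)"
  show "k_connected k (realization K)"
    unfolding k_connected_def realization_eq nsphere_eq
  proof (intro conjI allI impI)
    assume "-1 \<le> k"
    then have "extensor (cube {}) (geo K)" using c by (auto simp: conn_def)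
    then show "topspace (top_of_set (geo K)) \<noteq> {}" using extensor_nonempty by auto
  next
    fix i f assume i: "int i \<le> k" and "continuous_map (top_of_set (sphere_set i)) (top_of_set (geo K)) f"
    then have f: "continuous_on (sphere_set i) f" "f ` sphere_set i \<subseteq> geo K" 
      by (auto simp: continuous_map_subtopology_eu)
    have ext: "extensor (cube {..i}) (geo K)" using c i by (auto simp: conn_def)
    have "\<bar>x j\<bar> \<le> 1" if "x \<in> sphere_set i" "j \<le> i" for x j
    proof -
      have "(x j)\<^sup>2 \<le> (\<Sum>j\<le>i. (x j)\<^sup>2)" using that(2) by (intro member_le_sum) auto
      then show ?thesis using that(1) by (simp add: sphere_set_def abs_square_le_1)
    qed
    then have sub: "sphere_set i \<subseteq> cube {..i}" by (auto simp: cube_def sphere_set_def)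
    have "closed (sphere_set i)"
    proof -
      have "sphere_set i = {x. (\<Sum>j\<le>i. (x j)\<^sup>2) = 1} \<inter> (\<Inter>j\<in>{i<..}. {x. x j = 0})"
        by (auto simp: sphere_set_def)
      then show ?thesis
        by (auto intro!: closed_Int closed_INT closed_Collect_eq continuous_intros)
    qed
    then obtain g where g: "continuous_on (cube {..i}) g" "g ` cube {..i} \<subseteq> geo K"
      "\<And>x. x \<in> sphere_set i \<Longrightarrow> g x = f x"
      using extensorD[OF ext _ sub f] by metis
    define h where "h = (\<lambda>z :: real \<times> (nat \<Rightarrow> real). g (\<lambda>j. (1 - fst z) * snd z j))"
    have cube: "(\<lambda>j. (1 - t) * x j) \<in> cube {..i}" if "t \<in> {0..1}" "x \<in> sphere_set i" for t x
      using sub that by (force simp: cube_def abs_mult intro: mult_le_one)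
    have "continuous_on ({0..1} \<times> sphere_set i) (g \<circ> (\<lambda>z j. (1 - fst z) * snd z j))"
    proof (rule continuous_on_compose)
      show "continuous_on ({0..1} \<times> sphere_set i) (\<lambda>z j. (1 - fst z) * snd z j)"
        by (rule continuous_on_coordinatewise_then_product)
           (intro continuous_intros continuous_on_product_then_coordinatewise[OF continuous_on_snd])
      show "continuous_on ((\<lambda>z j. (1 - fst z) * snd z j) ` ({0..1} \<times> sphere_set i)) g"
        using cube by (intro continuous_on_subset[OF g(1)]) auto
    qed
    then have "continuous_on ({0..1} \<times> sphere_set i) h" by (simp add: h_def comp_def)
    moreover have "h ` ({0..1} \<times> sphere_set i) \<subseteq> geo K" using cube g(2) by (auto simp: h_def)
    ultimately have "homotopic_with (\<lambda>_. True) (top_of_set (sphere_set i)) (top_of_set (geo K)) g (\<lambda>_. g (\<lambda>_. 0))"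
      unfolding homotopic_with_def 
      by (intro exI[of _ h]) (auto simp: h_def)
    then show "\<exists>c. homotopic_with (\<lambda>_. True) (top_of_set (sphere_set i)) (top_of_set (geo K)) f (\<lambda>_. c)"
      by (intro exI[of _ "g (\<lambda>_. 0)"]) (rule homotopic_with_eq, assumption, auto simp: g(3))
  qed
qed

section \<open>Gluing along links\<close>

definition cube_norm :: "nat set \<Rightarrow> (nat \<Rightarrow> real) \<Rightarrow> real" where
  "cube_norm J x = Max ((\<lambda>j. \<bar>x j\<bar>) ` J)"

lemma cube_norm:
  assumes "finite J" "J \<noteq> {}"
  shows continuous_on_cube_norm: "continuous_on S (cube_norm J)"
    and cube_norm_ge: "j \<in> J \<Longrightarrow> \<bar>x j\<bar> \<le> cube_norm J x"
    and cube_norm_attained: "\<exists>j\<in>J. \<bar>x j\<bar> = cube_norm J x"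
    and cube_norm_le_1: "x \<in> cube J \<Longrightarrow> cube_norm J x \<le> 1"
    and cube_norm_bd: "x \<in> cube_bd J \<Longrightarrow> cube_norm J x = 1"
proof -
  show "continuous_on S (cube_norm J)" unfolding cube_norm_def
    by (intro continuous_on_Max continuous_intros assms)
  show ge: "j \<in> J \<Longrightarrow> \<bar>x j\<bar> \<le> cube_norm J x" for j
    unfolding cube_norm_def using assms by (intro Max_ge) auto
  have "cube_norm J x \<in> (\<lambda>j. \<bar>x j\<bar>) ` J" unfolding cube_norm_def using assms by (intro Max_in) auto
  then show att: "\<exists>j\<in>J. \<bar>x j\<bar> = cube_norm J x" by (metis imageE)
  show le: "cube_norm J x \<le> 1" if "x \<in> cube J"
  proof -
    obtain j where "j \<in> J" "\<bar>x j\<bar> = cube_norm J x" using att by blast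
    then show ?thesis using that by (metis (mono_tags, lifting) cube_def mem_Collect_eq)
  qed
  show "cube_norm J x = 1" if bd: "x \<in> cube_bd J"
  proof (rule antisym)
    show "cube_norm J x \<le> 1" using that cube_bd_subset le by blast
    obtain j where "j \<in> J" "\<bar>x j\<bar> = 1" using bd by (auto simp: cube_bd_def)
    then show "1 \<le> cube_norm J x" using ge by metis
  qed
qed

lemma geo_combination:
  assumes "simplicial_complex_on V K" "y \<in> geo K" "z \<in> geo K" "{v. y v \<noteq> 0} \<union> {v. z v \<noteq> 0} \<in> K"
    "0 \<le> t" "t \<le> 1"
  shows "(\<lambda>u. (1 - t) * y u + t * z u) \<in> geo K"
proof -
  let ?w = "\<lambda>u. (1 - t) * y u + t * z u"
  have yz: "\<And>v. 0 \<le> y v" "\<And>v. 0 \<le> z v" "sum y V = 1" "sum z V = 1"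
    using assms(2,3) by (auto simp: geo_iff[OF assms(1)])
  have "{v. ?w v \<noteq> 0} \<subseteq> {v. y v \<noteq> 0} \<union> {v. z v \<noteq> 0}" by auto
  then have "{v. ?w v \<noteq> 0} \<in> K" using simplicial_complex_onD(4)[OF assms(1)] assms(4) by blast
  moreover have "sum ?w V = 1" by (simp add: sum.distrib yz flip: sum_distrib_left)
  ultimately show ?thesis using yz assms by (auto simp: geo_iff[OF assms(1)])
qed

lemma continuous_on_combination:
  fixes f g :: "'a::topological_space \<Rightarrow> 'v \<Rightarrow> real"
  assumes "continuous_on S f" "continuous_on S g" "continuous_on S t"
  shows "continuous_on S (\<lambda>x u. (1 - t x) * f x u + t x * g x u)"
  by (rule continuous_on_coordinatewise_then_product)
     (intro continuous_intros assms(3) continuous_on_product_then_coordinatewise[OF assms(1)]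
        continuous_on_product_then_coordinatewise[OF assms(2)])

text \<open>Contiguous maps are joined by the straight-line homotopy, which is inserted into a collar.\<close>

lemma fill_contiguous:
  assumes K: "simplicial_complex_on V K" and J: "finite J" "J \<noteq> {}"
    and f: "continuous_on (cube_bd J) f" "f ` cube_bd J \<subseteq> geo K"
    and h: "continuous_on (cube J) h" "h ` cube J \<subseteq> geo K"
    and fh: "\<And>x. x \<in> cube_bd J \<Longrightarrow> {v. f x v \<noteq> 0} \<union> {v. h x v \<noteq> 0} \<in> K"
  shows "\<exists>g. continuous_on (cube J) g \<and> g ` cube J \<subseteq> geo K \<and> (\<forall>x\<in>cube_bd J. g x = f x)"
proof -
  let ?N = "cube_norm J"
  define e where "e = (\<lambda>(x :: nat \<Rightarrow> real) j. x j / ?N x)"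
  define d where "d = (\<lambda>(x :: nat \<Rightarrow> real) j. 2 * x j)"
  \<comment> \<open>The weight \<open>2 * ?N x - 1\<close> grows from 0 in the middle of the cube,
    where \<open>h\<close> is run at double speed, to 1 on the boundary, where
    \<open>e x = x\<close>.\<close>
  define k where "k = (\<lambda>x u. (1 - (2 * ?N x - 1)) * h (e x) u + (2 * ?N x - 1) * f (e x) u)"
  define g where "g = (\<lambda>x. if ?N x \<le> 1/2 then h (d x) else k x)"
  have e: "e x \<in> cube_bd J" if x: "x \<in> cube J" and "1/2 \<le> ?N x" for x
  proof -
    obtain j where "j \<in> J" "\<bar>x j\<bar> = ?N x" using cube_norm_attained[OF J] by blast
    then have "\<bar>e x j\<bar> = 1" using \<open>1/2 \<le> ?N x\<close> by (simp add: e_def)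
    then have "\<exists>j\<in>J. \<bar>e x j\<bar> = 1" using \<open>j \<in> J\<close> by blast
    moreover have "\<bar>e x j\<bar> \<le> 1" if "j \<in> J" for j
      using cube_norm_ge[OF J that, of x] \<open>1/2 \<le> ?N x\<close> by (simp add: e_def)
    ultimately show ?thesis using x by (auto simp: cube_bd_def cube_def e_def)
  qed
  have d: "d x \<in> cube J" if "x \<in> cube J" "?N x \<le> 1/2" for x
    using that cube_norm_ge[OF J, of _ x] by (force simp: cube_def d_def)
  have ec: "continuous_on {x \<in> cube J. 1/2 \<le> ?N x} e" unfolding e_def
    by (rule continuous_on_coordinatewise_then_product)
       (intro continuous_intros continuous_on_cube_norm[OF J]; force)
  have dc: "continuous_on S d" for S unfolding d_def
    by (rule continuous_on_coordinatewise_then_product) (intro continuous_intros)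
  have de: "d x = e x" if "?N x = 1/2" for x unfolding d_def e_def that by (simp add: mult.commute)
  have bd: "cube_bd J \<subseteq> cube J" by (rule cube_bd_subset)
  have fe: "continuous_on {x \<in> cube J. 1/2 \<le> ?N x} (\<lambda>x. f (e x))"
    by (rule continuous_on_compose2[OF f(1) ec]) (use e in auto)
  have he: "continuous_on {x \<in> cube J. 1/2 \<le> ?N x} (\<lambda>x. h (e x))"
    by (rule continuous_on_compose2[OF h(1) ec]) (use e bd in auto)
  have "continuous_on (cube J) g" unfolding g_def
  proof (rule continuous_on_cases_le)
    show "continuous_on {x \<in> cube J. ?N x \<le> 1/2} (\<lambda>x. h (d x))"
      by (rule continuous_on_compose2[OF h(1) dc]) (use d in auto)
    show "continuous_on {x \<in> cube J. 1/2 \<le> ?N x} k" unfolding k_def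
      by (intro continuous_on_combination fe he continuous_intros continuous_on_cube_norm[OF J])
    show "h (d x) = k x" if "?N x = 1/2" for x
      unfolding k_def de[OF that] that by simp
  qed (rule continuous_on_cube_norm[OF J])
  moreover have "g ` cube J \<subseteq> geo K"
  proof clarify
    fix x assume x: "x \<in> cube J"
    show "g x \<in> geo K"
    proof (cases "?N x \<le> 1/2")
      case True
      then show ?thesis using d[OF x] h(2) by (auto simp: g_def)
    next
      case False
      then have ex: "e x \<in> cube_bd J" using e x by simp
      have "k x \<in> geo K" unfolding k_def
        by (rule geo_combination[OF K])
           (use ex bd f(2) h(2) fh[OF ex] False cube_norm_le_1[OF J x] in \<open>auto simp: Un_commute\<close>)
      then show ?thesis using False by (simp add: g_def)
    qed
  qed
  moreover have "g x = f x" if "x \<in> cube_bd J" for x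
  proof -
    have "?N x = 1" by (rule cube_norm_bd[OF J that])
    then show ?thesis by (simp add: g_def k_def e_def)
  qed
  ultimately show ?thesis by blast
qed

lemma simplicial_complex_on_link:
  assumes "simplicial_complex_on V K" "F \<in> K"
  shows "simplicial_complex_on (V - F) (link K F)"
  unfolding simplicial_complex_on_def
proof (intro conjI ballI allI impI)
  fix G H assume "G \<in> link K F" "H \<subseteq> G"
  then show "H \<in> link K F"
    using simplicial_complex_onD(4)[OF assms(1), of "F \<union> G" "F \<union> H"] by (auto simp: link_def)
qed (use simplicial_complex_onD[OF assms(1)] assms(2) in \<open>auto simp: link_def\<close>)

lemma simplicial_complex_on_deletion:
  assumes "simplicial_complex_on V K"
  shows "simplicial_complex_on (V - {v}) (deletion K v)"
  unfolding simplicial_complex_on_def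
proof (intro conjI ballI allI impI)
  fix F G assume "F \<in> deletion K v" "G \<subseteq> F"
  then show "G \<in> deletion K v"
    using simplicial_complex_onD(4)[OF assms, of F G] by (auto simp: deletion_def)
qed (use simplicial_complex_onD[OF assms] in \<open>auto simp: deletion_def\<close>)

lemma geo_mono: "K \<subseteq> L \<Longrightarrow> geo K \<subseteq> geo L"
  by (auto simp: geo_def)

lemma link_subset_deletion: "simplicial_complex_on V K \<Longrightarrow> link K {v} \<subseteq> deletion K v"
  by (auto simp: link_def deletion_def dest: simplicial_complex_onD(4))

text \<open>Junk values where \<open>y v = 1\<close>.\<close>

definition radial :: "'v \<Rightarrow> ('v \<Rightarrow> real) \<Rightarrow> 'v \<Rightarrow> real" where
  "radial v y = (\<lambda>u. if u = v then 0 else y u / (1 - y v))"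

lemma continuous_on_radial:
  assumes "continuous_on S g" "\<And>x. x \<in> S \<Longrightarrow> g x v \<noteq> 1"
  shows "continuous_on S (\<lambda>x. radial v (g x))"
proof (rule continuous_on_coordinatewise_then_product)
  fix u
  have "continuous_on S (\<lambda>x. g x u / (1 - g x v))"
    using assms(2) by (intro continuous_intros continuous_on_product_then_coordinatewise[OF assms(1)]) auto
  then show "continuous_on S (\<lambda>x. radial v (g x) u)" by (cases "u = v") (auto simp: radial_def)
qed

lemma radial_support: "y v \<noteq> 1 \<Longrightarrow> {u. radial v y u \<noteq> 0} = {u. y u \<noteq> 0} - {v}"
  by (auto simp: radial_def)

text \<open>Projection away from the vertex \<open>v\<close>. A point of the open star of
  \<open>v\<close> other than \<open>v\<close> itself is sent to the opposite face, which belongs to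
  the link.\<close>

lemma radial_geo:
  assumes K: "simplicial_complex_on V K" and y: "y \<in> geo K" "y v < 1"
  shows "radial v y \<in> geo (deletion K v)" "0 < y v \<Longrightarrow> radial v y \<in> geo (link K {v})"
proof -
  have V: "finite V" using simplicial_complex_onD(1)[OF K] .
  have supp: "{u. radial v y u \<noteq> 0} = {u. y u \<noteq> 0} - {v}" using y(2) by (intro radial_support) simp
  have yK: "{u. y u \<noteq> 0} \<in> K" "\<And>v. 0 \<le> y v" "sum y V = 1" using y by (auto simp: geo_iff[OF K])
  have "sum y (V - {v}) = 1 - y v"
  proof (cases "v \<in> V")
    case True
    then show ?thesis using yK(3) V by (simp add: sum_diff1)
  next
    case False
    then have "y v = 0" using yK(1) simplicial_complex_onD(2)[OF K] by auto
    then show ?thesis using False yK(3) by simp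
  qed
  moreover have "sum (radial v y) (V - {v}) = sum y (V - {v}) / (1 - y v)"
    by (auto simp: radial_def sum_divide_distrib intro: sum.cong)
  ultimately have s: "sum (radial v y) (V - {v}) = 1" using y(2) by simp
  have nn: "0 \<le> radial v y u" for u using yK(2) y(2) by (simp add: radial_def)
  have "{u. y u \<noteq> 0} - {v} \<in> deletion K v" using yK(1) simplicial_complex_onD(4)[OF K]
    by (auto simp: deletion_def)
  then show "radial v y \<in> geo (deletion K v)"
    using s nn supp by (simp add: geo_iff[OF simplicial_complex_on_deletion[OF K]])
  assume "0 < y v"
  then have "insert v ({u. y u \<noteq> 0} - {v}) = {u. y u \<noteq> 0}" by auto
  then have l: "{u. y u \<noteq> 0} - {v} \<in> link K {v}" and "{v} \<in> K"
    using yK(1) simplicial_complex_onD(4)[OF K, of _ "{v}"] \<open>0 < y v\<close> by (auto simp: link_def)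
  then show "radial v y \<in> geo (link K {v})"
    using s nn supp by (simp add: geo_iff[OF simplicial_complex_on_link[OF K]])
qed

text \<open>Extend in \<open>K\<close>. Where the weight \<open>T\<close> of \<open>v\<close> is at
  most 1/2, project away from \<open>v\<close>. On the level set \<open>T = 1/2\<close> the
  projection takes values in the link, and it is continued inside the link over the region
  \<open>T \<ge> 1/2\<close>. On \<open>C\<close> the weight is 0, so nothing changes there.\<close>

theorem conn_deletion:
  assumes K: "simplicial_complex_on V K" and "conn m (geo K)" "conn m (geo (link K {v}))"
  shows "conn m (geo (deletion K v))"
  unfolding conn_def extensor_def
proof clarify
  fix J :: "nat set" and C and f :: "(nat \<Rightarrow> real) \<Rightarrow> 'a \<Rightarrow> real"
  assume J: "finite J" "card J < m"
    and C: "closed C" "C \<subseteq> cube J" and f: "continuous_on C f" "f ` C \<subseteq> geo (deletion K v)"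
  have KJ: "extensor (cube J) (geo K)" and LJ: "extensor (cube J) (geo (link K {v}))"
    using assms J by (auto simp: conn_def)
  have "geo (deletion K v) \<subseteq> geo K" by (rule geo_mono) (auto simp: deletion_def)
  then obtain g where g: "continuous_on (cube J) g" "g ` cube J \<subseteq> geo K" "\<And>x. x \<in> C \<Longrightarrow> g x = f x"
    using extensorD[OF KJ C f(1)] f(2) by (metis subset_trans)
  define T where "T = (\<lambda>x. g x v)"
  have Tc: "continuous_on (cube J) T" unfolding T_def by (rule continuous_on_product_then_coordinatewise[OF g(1)])
  have rc: "continuous_on S (\<lambda>x. radial v (g x))" if "S \<subseteq> {x \<in> cube J. T x \<le> 1/2}" for S
    using that by (intro continuous_on_radial continuous_on_subset[OF g(1)]) (auto simp: T_def)
  define C1 where "C1 = {x \<in> cube J. T x = 1/2}"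
  have C1: "closed C1" "C1 \<subseteq> cube J"
    unfolding C1_def by (rule continuous_closed_preimage_constant[OF Tc closed_cube], auto)
  have "(\<lambda>x. radial v (g x)) ` C1 \<subseteq> geo (link K {v})"
    using g(2) by (auto simp: C1_def T_def intro!: radial_geo(2)[OF K])
  moreover have "continuous_on C1 (\<lambda>x. radial v (g x))" by (rule rc) (auto simp: C1_def)
  ultimately obtain k where k: "continuous_on (cube J) k" "k ` cube J \<subseteq> geo (link K {v})"
    "\<And>x. x \<in> C1 \<Longrightarrow> k x = radial v (g x)"
    using extensorD[OF LJ C1] by metis
  define h where "h = (\<lambda>x. if T x \<le> 1/2 then radial v (g x) else k x)"
  have "continuous_on (cube J) h" unfolding h_def
  proof (rule continuous_on_cases_le)
    show "continuous_on {x \<in> cube J. 1/2 \<le> T x} k"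
      by (rule continuous_on_subset[OF k(1)]) auto
    show "radial v (g x) = k x" if "x \<in> cube J" "T x = 1/2" for x using k(3) that by (simp add: C1_def)
    show "continuous_on {x \<in> cube J. T x \<le> 1/2} (\<lambda>x. radial v (g x))" by (rule rc) auto
  qed (rule Tc)
  moreover have "h ` cube J \<subseteq> geo (deletion K v)"
  proof clarify
    fix x assume x: "x \<in> cube J"
    have "radial v (g x) \<in> geo (deletion K v)" if "T x \<le> 1/2"
      using x g(2) that by (intro radial_geo(1)[OF K]) (auto simp: T_def)
    moreover have "k x \<in> geo (deletion K v)"
      using x k(2) geo_mono[OF link_subset_deletion[OF K]] by blast
    ultimately show "h x \<in> geo (deletion K v)" by (simp add: h_def)
  qed
  moreover have "h x = f x" if "x \<in> C" for x
  proof -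
    have fx: "f x \<in> geo (deletion K v)" using f(2) that by auto
    then have "f x v = 0" by (auto simp: geo_def deletion_def)
    then show ?thesis using g(3)[OF that] by (auto simp: h_def T_def radial_def)
  qed
  ultimately show "\<exists>g. continuous_on (cube J) g \<and> g ` cube J \<subseteq> geo (deletion K v) \<and> (\<forall>x\<in>C. g x = f x)"
    by blast
qed

lemma vertex_geo: "{v} \<in> K \<Longrightarrow> (\<lambda>u. if u = v then 1 else 0) \<in> geo K"
  by (simp add: geo_def)

text \<open>A sphere in \<open>K\<close> is deformed into the deletion of \<open>v\<close> and
  filled there. The part near \<open>v\<close> is replaced by a map into the link defined on the
  boundary of the cube only. The deformation is not a single straight line: it passes through an
  intermediate map \<open>p\<close> that is contiguous to both the old and the new map.\<close>

theorem conn_add_vertex: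
  assumes K: "simplicial_complex_on V K" and v: "{v} \<in> K"
    and del: "conn m (geo (deletion K v))" and lk: "conn (m - 1) (geo (link K {v}))"
  shows "conn m (geo K)"
proof (rule connI[OF K])
  show "geo K \<noteq> {}" using vertex_geo[OF v] by auto
  fix J :: "nat set" assume J: "finite J" "J \<noteq> {}" "card J < m"
  have dK: "geo (deletion K v) \<subseteq> geo K" by (rule geo_mono) (auto simp: deletion_def)
  have ldel: "geo (link K {v}) \<subseteq> geo (deletion K v)" by (rule geo_mono[OF link_subset_deletion[OF K]])
  \<comment> \<open>The faces of the boundary have one coordinate less, which is why the link needs
    only \<open>m - 1\<close>.\<close>
  have bdL: "extensor (cube_bd J) (geo (link K {v}))"
  proof (rule extensor_cube_bd[OF J(1)])
    fix j assume "j \<in> J"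
    then have "card (J - {j}) < m - 1" using J by (metis card_Diff_singleton card_gt_0_iff diff_less_mono Suc_leI One_nat_def)
    then show "extensor (cube (J - {j})) (geo (link K {v}))" using lk J by (simp add: conn_def)
  qed
  have cubeD: "extensor (cube J) (geo (deletion K v))" using del J by (simp add: conn_def)
  show "fills J (geo K)" unfolding fills_def
  proof clarify
    fix f :: "(nat \<Rightarrow> real) \<Rightarrow> 'a \<Rightarrow> real"
    assume f: "continuous_on (cube_bd J) f" "f ` cube_bd J \<subseteq> geo K"
    define T where "T = (\<lambda>x. f x v)"
    have Tc: "continuous_on (cube_bd J) T"
      unfolding T_def by (rule continuous_on_product_then_coordinatewise[OF f(1)])
    have rc: "continuous_on S (\<lambda>x. radial v (f x))" if "S \<subseteq> {x \<in> cube_bd J. T x \<le> 3/4}" for S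
      using that by (intro continuous_on_radial continuous_on_subset[OF f(1)]) (auto simp: T_def)
    \<comment> \<open>Two thresholds are needed: between 1/2 and 3/4 the new map \<open>h\<close>
      still equals the projection of \<open>f\<close>, which leaves room for \<open>p\<close> to
      move from \<open>h\<close> to \<open>v\<close>. Beyond 3/4 the values of \<open>h\<close> and
      \<open>f\<close> are unrelated.\<close>
    define C where "C = {x \<in> cube_bd J. 1/2 \<le> T x \<and> T x \<le> 3/4}"
    have "closed (cube_bd J \<inter> T -` {1/2..3/4})"
      by (rule continuous_closed_preimage[OF Tc closed_cube_bd[OF J(1)]]) simp
    moreover have "cube_bd J \<inter> T -` {1/2..3/4} = C" by (auto simp: C_def)
    ultimately have C: "closed C" "C \<subseteq> cube_bd J" by (auto simp: C_def)
    have "(\<lambda>x. radial v (f x)) ` C \<subseteq> geo (link K {v})"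
      using f(2) by (auto simp: C_def T_def intro!: radial_geo(2)[OF K])
    moreover have "continuous_on C (\<lambda>x. radial v (f x))" by (rule rc) (auto simp: C_def)
    ultimately obtain k where k: "continuous_on (cube_bd J) k" "k ` cube_bd J \<subseteq> geo (link K {v})"
      "\<And>x. x \<in> C \<Longrightarrow> k x = radial v (f x)"
      using extensorD[OF bdL C] by metis
    define h where "h = (\<lambda>x. if T x \<le> 1/2 then radial v (f x) else k x)"
    have hc: "continuous_on (cube_bd J) h" unfolding h_def
    proof (rule continuous_on_cases_le)
      show "continuous_on {x \<in> cube_bd J. 1/2 \<le> T x} k"
        by (rule continuous_on_subset[OF k(1)]) auto
      show "radial v (f x) = k x" if "x \<in> cube_bd J" "T x = 1/2" for x
        using k(3) that by (simp add: C_def)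
      show "continuous_on {x \<in> cube_bd J. T x \<le> 1/2} (\<lambda>x. radial v (f x))" by (rule rc) auto
    qed (rule Tc)
    have hd: "h ` cube_bd J \<subseteq> geo (deletion K v)"
    proof clarify
      fix x assume x: "x \<in> cube_bd J"
      have "radial v (f x) \<in> geo (deletion K v)" if "T x \<le> 1/2"
        using x f(2) that by (intro radial_geo(1)[OF K]) (auto simp: T_def)
      moreover have "k x \<in> geo (deletion K v)" using x k(2) ldel by blast
      ultimately show "h x \<in> geo (deletion K v)" by (simp add: h_def)
    qed
    obtain h' where h': "continuous_on (cube J) h'" "h' ` cube J \<subseteq> geo (deletion K v)"
      "\<And>x. x \<in> cube_bd J \<Longrightarrow> h' x = h x"
      using extensorD[OF cubeD closed_cube_bd[OF J(1)] cube_bd_subset hc hd] by metis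
    define e where "e = (\<lambda>u. if u = v then 1 else 0 :: real)"
    define s where "s = (\<lambda>x. max 0 (min 1 (4 * T x - 2)))"
    \<comment> \<open>For \<open>T \<le> 1/2\<close> this is \<open>h\<close>, for
      \<open>T \<ge> 3/4\<close> it is the vertex \<open>v\<close>. In every case its support lies
      in that of \<open>f\<close>, and together with the support of \<open>h\<close> it spans a
      face.\<close>
    define p where "p = (\<lambda>x u. (1 - s x) * h x u + s x * e u)"
    have sc: "continuous_on (cube_bd J) s" unfolding s_def by (intro continuous_intros Tc)
    have pc: "continuous_on (cube_bd J) p" unfolding p_def
      by (intro continuous_on_combination hc sc continuous_on_const)
    have s01: "0 \<le> s x" "s x \<le> 1" for x by (auto simp: s_def)
    have small: "s x = 0" if "T x \<le> 1/2" for x using that by (simp add: s_def)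
    have big: "s x = 1" if "3/4 \<le> T x" for x using that by (simp add: s_def)
    have psupp: "{u. p x u \<noteq> 0} \<subseteq> {u. h x u \<noteq> 0} \<union> {v}" for x by (auto simp: p_def e_def)
    have hp: "{u. p x u \<noteq> 0} \<union> {u. h x u \<noteq> 0} \<in> K" if x: "x \<in> cube_bd J" for x
    proof (cases "T x \<le> 1/2")
      case True
      then have "p x = h x" by (auto simp: p_def small)
      moreover have "h x \<in> geo K" using hd dK x by blast
      ultimately show ?thesis by (simp add: geo_def)
    next
      case False
      then have "h x \<in> geo (link K {v})" using k(2) x by (auto simp: h_def)
      then have "insert v {u. h x u \<noteq> 0} \<in> K" by (simp add: geo_def link_def)
      moreover have "{u. p x u \<noteq> 0} \<union> {u. h x u \<noteq> 0} \<subseteq> insert v {u. h x u \<noteq> 0}"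
        using psupp[of x] by auto
      ultimately show ?thesis using simplicial_complex_onD(4)[OF K] by blast
    qed
    have fp: "{u. f x u \<noteq> 0} \<union> {u. p x u \<noteq> 0} \<in> K" if x: "x \<in> cube_bd J" for x
    proof -
      have fK: "{u. f x u \<noteq> 0} \<in> K" using f(2) x by (auto simp: geo_def)
      have "{u. p x u \<noteq> 0} \<subseteq> {u. f x u \<noteq> 0}"
      proof (cases "3/4 < T x")
        case True
        then have "p x = e" by (auto simp: p_def big)
        then show ?thesis using True by (auto simp: e_def T_def)
      next
        case F: False
        then have hr: "h x = radial v (f x)" using k(3)[of x] x by (auto simp: h_def C_def)
        have "{u. h x u \<noteq> 0} = {u. f x u \<noteq> 0} - {v}" unfolding hr using F by (intro radial_support) (auto simp: T_def)
        moreover have "{u. p x u \<noteq> 0} \<subseteq> {u. h x u \<noteq> 0}" if "f x v = 0"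
          using small[of x] that by (auto simp: p_def T_def)
        ultimately show ?thesis using psupp[of x] by (cases "f x v = 0") auto
      qed
      then show ?thesis using fK by (simp add: Un_absorb2)
    qed
    have pK: "p ` cube_bd J \<subseteq> geo K"
    proof clarify
      fix x assume x: "x \<in> cube_bd J"
      have hK: "h x \<in> geo K" using hd dK x by blast
      show "p x \<in> geo K"
      proof (cases "T x \<le> 1/2")
        case True
        then have "p x = h x" by (auto simp: p_def small)
        then show ?thesis using hK by simp
      next
        case False
        then have "h x \<in> geo (link K {v})" using k(2) x by (auto simp: h_def)
        then have "insert v {u. h x u \<noteq> 0} \<in> K" by (simp add: geo_def link_def)
        then show ?thesis unfolding p_def using hK vertex_geo[OF v] s01
          by (intro geo_combination[OF K]) (auto simp: e_def)
      qed
    qed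
    have "\<exists>p'. continuous_on (cube J) p' \<and> p' ` cube J \<subseteq> geo K \<and> (\<forall>x\<in>cube_bd J. p' x = p x)"
      by (rule fill_contiguous[OF K J(1,2) pc pK h'(1)]) (use h' dK hp in auto)
    then obtain p' where p': "continuous_on (cube J) p'" "p' ` cube J \<subseteq> geo K" "\<forall>x\<in>cube_bd J. p' x = p x"
      by blast
    show "\<exists>g. continuous_on (cube J) g \<and> g ` cube J \<subseteq> geo K \<and> (\<forall>x\<in>cube_bd J. g x = f x)"
      by (rule fill_contiguous[OF K J(1,2) f p'(1,2)]) (use p' fp in auto)
  qed
qed

text \<open>Every map into a cone is contiguous to the constant map at the apex.\<close>

theorem conn_cone:
  assumes K: "simplicial_complex_on V K" and v: "\<And>F. F \<in> K \<Longrightarrow> insert v F \<in> K"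
  shows "conn m (geo K)"
proof (rule connI[OF K])
  have vK: "{v} \<in> K" using v simplicial_complex_onD(3)[OF K] by blast
  note e = vertex_geo[OF vK]
  show "geo K \<noteq> {}" using e by auto
  fix J :: "nat set" assume J: "finite J" "J \<noteq> {}"
  show "fills J (geo K)" unfolding fills_def
  proof clarify
    fix f :: "(nat \<Rightarrow> real) \<Rightarrow> 'a \<Rightarrow> real"
    assume f: "continuous_on (cube_bd J) f" "f ` cube_bd J \<subseteq> geo K"
    have "{u. f x u \<noteq> 0} \<in> K" if "x \<in> cube_bd J" for x using f(2) that by (auto simp: geo_def)
    then show "\<exists>g. continuous_on (cube J) g \<and> g ` cube J \<subseteq> geo K \<and> (\<forall>x\<in>cube_bd J. g x = f x)"
      using v e by (intro fill_contiguous[OF K J f, of "\<lambda>_ u. if u = v then 1 else 0"]) auto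
  qed
qed

section \<open>Invariance of connectivity under relabelling of vertices\<close>

lemma conn_retract:
  assumes Y: "conn m Y" and i: "continuous_on X i" "i ` X \<subseteq> Y" and p: "continuous_on Y p" "p ` Y \<subseteq> X"
    and pi: "\<And>x. x \<in> X \<Longrightarrow> p (i x) = x"
  shows "conn m X"
  unfolding conn_def extensor_def
proof clarify
  fix J :: "nat set" and C and f :: "(nat \<Rightarrow> real) \<Rightarrow> 'b"
  assume J: "finite J" "card J < m"
    and C: "closed C" "C \<subseteq> cube J" and f: "continuous_on C f" "f ` C \<subseteq> X"
  have YJ: "extensor (cube J) Y" using Y J by (simp add: conn_def)
  have "continuous_on C (\<lambda>x. i (f x))" by (rule continuous_on_compose2[OF i(1) f])
  moreover have "(\<lambda>x. i (f x)) ` C \<subseteq> Y" using i(2) f(2) by auto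
  ultimately obtain g where g: "continuous_on (cube J) g" "g ` cube J \<subseteq> Y" "\<And>x. x \<in> C \<Longrightarrow> g x = i (f x)"
    using extensorD[OF YJ C] by metis
  have "continuous_on (cube J) (\<lambda>x. p (g x))" by (rule continuous_on_compose2[OF p(1) g(1,2)])
  moreover have "(\<lambda>x. p (g x)) ` cube J \<subseteq> X" using p(2) g(2) by auto
  moreover have "p (g x) = f x" if "x \<in> C" for x
  proof -
    have "f x \<in> X" using f(2) that by auto
    then show ?thesis using g(3)[OF that] pi by simp
  qed
  ultimately show "\<exists>g. continuous_on (cube J) g \<and> g ` cube J \<subseteq> X \<and> (\<forall>x\<in>C. g x = f x)"
    by (intro exI[of _ "\<lambda>x. p (g x)"]) auto
qed

lemma simplicial_complex_on_image:
  assumes "simplicial_complex_on V K"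
  shows "simplicial_complex_on (\<phi> ` V) ((`) \<phi> ` K)"
  unfolding simplicial_complex_on_def
proof (intro conjI ballI allI impI)
  fix F G assume "F \<in> (`) \<phi> ` K" "G \<subseteq> F"
  then obtain F' where F': "F' \<in> K" "F = \<phi> ` F'" by auto
  then obtain G' where "G' \<subseteq> F'" "G = \<phi> ` G'" using \<open>G \<subseteq> F\<close> by (metis subset_imageE)
  then show "G \<in> (`) \<phi> ` K" using simplicial_complex_onD(4)[OF assms F'(1)] by blast
qed (use simplicial_complex_onD[OF assms] in auto)

lemma conn_image:
  assumes K: "simplicial_complex_on V K" and inj: "inj_on \<phi> V" and c: "conn m (geo K)"
  shows "conn m (geo ((`) \<phi> ` K))"
proof -
  let ?L = "(`) \<phi> ` K"
  have L: "simplicial_complex_on (\<phi> ` V) ?L" by (rule simplicial_complex_on_image[OF K])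
  define i where "i = (\<lambda>(x :: 'b \<Rightarrow> real) v. if v \<in> V then x (\<phi> v) else 0)"
  define p where "p = (\<lambda>(y :: 'a \<Rightarrow> real) w. if w \<in> \<phi> ` V then y (inv_into V \<phi> w) else 0)"
  show ?thesis
  proof (rule conn_retract[OF c, of _ i p])
    show "continuous_on (geo ?L) i"
    proof (rule continuous_on_coordinatewise_then_product)
      show "continuous_on (geo ?L) (\<lambda>x. i x v)" for v
        by (cases "v \<in> V") (auto simp: i_def intro: continuous_on_coordinate)
    qed
    show "continuous_on (geo K) p"
    proof (rule continuous_on_coordinatewise_then_product)
      show "continuous_on (geo K) (\<lambda>x. p x v)" for v
        by (cases "v \<in> \<phi> ` V") (auto simp: p_def intro: continuous_on_coordinate)
    qed
    show "i ` geo ?L \<subseteq> geo K"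
    proof clarify
      fix x assume x: "x \<in> geo ?L"
      then have x': "\<And>v. 0 \<le> x v" "{v. x v \<noteq> 0} \<in> ?L" "sum x (\<phi> ` V) = 1" by (auto simp: geo_iff[OF L])
      then obtain F where F: "F \<in> K" "{v. x v \<noteq> 0} = \<phi> ` F" by auto
      have FV: "F \<subseteq> V" by (rule simplicial_complex_onD(2)[OF K F(1)])
      have "{v. i x v \<noteq> 0} = F"
      proof -
        have "x w \<noteq> 0 \<longleftrightarrow> w \<in> \<phi> ` F" for w using F(2) by blast
        then have "v \<in> V \<and> x (\<phi> v) \<noteq> 0 \<longleftrightarrow> v \<in> F" for v
          using FV inj_on_image_mem_iff[OF inj _ FV] by blast
        then show ?thesis by (auto simp: i_def)
      qed
      moreover have "sum (i x) V = 1"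
        using x'(3) by (simp add: sum.reindex[OF inj] i_def)
      ultimately show "i x \<in> geo K" using x'(1) F by (auto simp: geo_iff[OF K] i_def)
    qed
    show "p ` geo K \<subseteq> geo ?L"
    proof clarify
      fix y assume "y \<in> geo K"
      then have y: "\<And>v. 0 \<le> y v" "{v. y v \<noteq> 0} \<in> K" "sum y V = 1" by (auto simp: geo_iff[OF K])
      have "{v. y v \<noteq> 0} \<subseteq> V" by (rule simplicial_complex_onD(2)[OF K y(2)])
      then have "\<phi> ` {v. y v \<noteq> 0} = \<phi> ` {v \<in> V. y v \<noteq> 0}" by blast
      also have "\<dots> = {w. p y w \<noteq> 0}"
        using inj by (auto simp: p_def split: if_splits) (metis inj_onD)
      finally have "{w. p y w \<noteq> 0} = \<phi> ` {v. y v \<noteq> 0}" by simp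
      moreover have "sum (p y) (\<phi> ` V) = 1"
        using y(3) inj by (simp add: sum.reindex[OF inj] p_def)
      ultimately show "p y \<in> geo ?L" using y by (auto simp: geo_iff[OF L] p_def)
    qed
    show "p (i x) = x" if "x \<in> geo ?L" for x
    proof
      fix w
      have "{v. x v \<noteq> 0} \<subseteq> \<phi> ` V" using that simplicial_complex_onD(2)[OF L] by (auto simp: geo_def)
      then show "p (i x) w = x w" using inj by (auto simp: p_def i_def)
    qed
  qed
qed

section \<open>Barycentric subdivision\<close>

text \<open>The clique complex of \<open>r\<close>. The diagonal is excluded, so \<open>r\<close>
  need not be reflexive.\<close>

definition flag :: "('a \<Rightarrow> 'a \<Rightarrow> bool) \<Rightarrow> 'a set \<Rightarrow> 'a set set" where
  "flag r A = {C. C \<subseteq> A \<and> finite C \<and> (\<forall>x\<in>C. \<forall>y\<in>C. x \<noteq> y \<longrightarrow> r x y)}"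

lemma flagD:
  assumes "C \<in> flag r A"
  shows "C \<subseteq> A" "finite C" "x \<in> C \<Longrightarrow> y \<in> C \<Longrightarrow> x \<noteq> y \<Longrightarrow> r x y"
  using assms by (simp_all add: flag_def)

lemma flagI:
  "C \<subseteq> A \<Longrightarrow> finite C \<Longrightarrow> (\<And>x y. x \<in> C \<Longrightarrow> y \<in> C \<Longrightarrow> x \<noteq> y \<Longrightarrow> r x y) \<Longrightarrow> C \<in> flag r A"
  by (simp add: flag_def)

lemma simplicial_complex_on_flag: "finite A \<Longrightarrow> simplicial_complex_on A (flag r A)"
  unfolding simplicial_complex_on_def flag_def
proof (intro conjI ballI allI impI, goal_cases)
  case (4 F G)
  then show ?case by (auto intro: finite_subset dest: subsetD)
qed auto

abbreviation comparable :: "('a \<Rightarrow> 'a \<Rightarrow> bool) \<Rightarrow> 'a \<Rightarrow> 'a \<Rightarrow> bool" where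
  "comparable le x y \<equiv> le x y \<or> le y x"

text \<open>No homeomorphism is constructed. It suffices to have continuous maps \<open>h\<close>
  from the subdivision to \<open>K\<close> and \<open>g\<close> back such that
  \<open>g (h y)\<close> is contiguous to \<open>y\<close>: a sphere is pushed by \<open>h\<close>,
  filled in \<open>K\<close>, pulled back by \<open>g\<close> and corrected in a collar.\<close>

theorem conn_subdivision:
  assumes K: "simplicial_complex_on V K" and c: "conn m (geo K)"
  shows "conn m (geo (flag (comparable (\<subseteq>)) (K - {{}})))"
proof -
  let ?A = "K - {{}}" and ?L = "flag (comparable (\<subseteq>)) (K - {{}})"
  note KD = simplicial_complex_onD[OF K]
  have V: "finite V" and A: "finite ?A" using KD(1,5) by auto
  have L: "simplicial_complex_on ?A ?L" using A by (rule simplicial_complex_on_flag)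
  \<comment> \<open>The usual affine map, sending the vertex \<open>F\<close> of the subdivision to
    its barycentre.\<close>
  define h where "h = (\<lambda>(y :: 'a set \<Rightarrow> real) v. \<Sum>F\<in>?A. y F * (if v \<in> F then 1 / real (card F) else 0))"
  \<comment> \<open>Positive only if all coordinates on \<open>F\<close> exceed 0 and all
    coordinates outside \<open>F\<close>. Such superlevel sets of \<open>x\<close> form a chain.
    After normalisation by \<open>s\<close> the gaps are the coordinates of \<open>g x\<close>; this
    is not the inverse of \<open>h\<close>, but it has the right supports.\<close>
  define gap where "gap = (\<lambda>(x :: 'a \<Rightarrow> real) F. max 0 (Min (x ` F) - Max (insert 0 (x ` (V - F)))))"
  define s where "s = (\<lambda>x. \<Sum>F\<in>?A. gap x F)"
  define g where "g = (\<lambda>x F. if F \<in> ?A then gap x F / s x else 0)"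
  have gap_level: "x b < x a" if "0 < gap x F" "F \<in> ?A" "a \<in> F" "b \<in> V - F" for x F a b
  proof -
    have F: "finite F" "F \<noteq> {}" using that(2) KD(6) by auto
    have "Max (insert 0 (x ` (V - F))) < Min (x ` F)" using that(1) by (simp add: gap_def)
    moreover have "x b \<le> Max (insert 0 (x ` (V - F)))" 
      using V that(4) by (auto intro!: Max_ge)
    moreover have "Min (x ` F) \<le> x a" using F that(3) by (intro Min_le) auto
    ultimately show "x b < x a" by linarith
  qed
  have gap0: "0 \<le> gap x F" for x F by (simp add: gap_def)
  have spos: "0 < s x" if "x \<in> geo K" for x
  proof -
    have x: "\<And>v. 0 \<le> x v" "{v. x v \<noteq> 0} \<in> K" "sum x V = 1" using that by (auto simp: geo_iff[OF K])
    have "V \<noteq> {}" using x(3) by auto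
    define M where "M = Max (x ` V)"
    define F where "F = {v \<in> V. x v = M}"
    have "M \<in> x ` V" unfolding M_def using V \<open>V \<noteq> {}\<close> by (intro Max_in) auto
    then have "F \<noteq> {}" by (auto simp: F_def)
    have le: "x v \<le> M" if "v \<in> V" for v unfolding M_def using V that by (intro Max_ge) auto
    have "0 < M"
    proof (rule ccontr)
      assume "\<not> 0 < M"
      then have "x v = 0" if "v \<in> V" for v using le[OF that] x(1)[of v] by linarith
      then show False using x(3) by simp
    qed
    then have "F \<subseteq> {v. x v \<noteq> 0}" by (auto simp: F_def)
    then have FA: "F \<in> ?A" using KD(4) x(2) \<open>F \<noteq> {}\<close> by blast
    have "x ` F = {M}" using \<open>F \<noteq> {}\<close> by (auto simp: F_def)
    then have "Min (x ` F) = M" by simp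
    moreover have "Max (insert 0 (x ` (V - F))) < M"
      using V \<open>0 < M\<close> le by (subst Max_less_iff) (auto simp: F_def order.order_iff_strict)
    ultimately have "0 < gap x F" by (simp add: gap_def)
    also have "\<dots> \<le> s x" unfolding s_def using A FA gap0 by (intro member_le_sum) auto
    finally show ?thesis .
  qed
  have gsupp: "0 < gap x F \<and> F \<in> ?A" if "g x F \<noteq> 0" for x F
    using that gap0[of x F] by (auto simp: g_def less_eq_real_def split: if_splits)
  have gL: "g ` geo K \<subseteq> geo ?L"
  proof clarify
    fix x assume x: "x \<in> geo K"
    have "{F. g x F \<noteq> 0} \<in> ?L"
    proof (rule flagI)
      show "{F. g x F \<noteq> 0} \<subseteq> ?A" using gsupp by blast
      then show "finite {F. g x F \<noteq> 0}" using A finite_subset by blast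
      fix F G assume "F \<in> {F. g x F \<noteq> 0}" "G \<in> {F. g x F \<noteq> 0}"
      then have F: "0 < gap x F" "F \<in> ?A" and G: "0 < gap x G" "G \<in> ?A" using gsupp by auto
      show "F \<subseteq> G \<or> G \<subseteq> F"
      proof (rule ccontr)
        assume "\<not> (F \<subseteq> G \<or> G \<subseteq> F)"
        then obtain a b where "a \<in> F" "a \<notin> G" "b \<in> G" "b \<notin> F" by auto
        moreover have "a \<in> V" "b \<in> V" using KD(2) F G \<open>a \<in> F\<close> \<open>b \<in> G\<close> by blast+
        ultimately show False using gap_level[OF F, of a b] gap_level[OF G, of b a] by auto
      qed
    qed
    moreover have "sum (g x) ?A = 1"
    proof -
      have "sum (g x) ?A = (\<Sum>F\<in>?A. gap x F / s x)" by (rule sum.cong) (auto simp: g_def)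
      then show ?thesis using spos[OF x] by (simp add: s_def flip: sum_divide_distrib)
    qed
    ultimately show "g x \<in> geo ?L" using spos[OF x] gap0 by (auto simp: geo_iff[OF L] g_def)
  qed
  have gc: "continuous_on (geo K) g"
  proof (rule continuous_on_coordinatewise_then_product)
    fix F
    have gapc: "continuous_on (geo K) (\<lambda>x. gap x F)" if "F \<in> ?A" for F
    proof -
      have F: "finite F" "F \<noteq> {}" using that KD(6) by auto
      have "Max (insert 0 (x ` (V - F))) = Max ((\<lambda>w. case w of None \<Rightarrow> 0 | Some v \<Rightarrow> x v) ` insert None (Some ` (V - F)))"
        for x :: "'a \<Rightarrow> real"
        by (simp add: image_image)
      moreover have "continuous_on (geo K) (\<lambda>x. Max ((\<lambda>w. case w of None \<Rightarrow> 0 | Some v \<Rightarrow> x v) ` insert None (Some ` (V - F))))"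
        using V by (intro continuous_on_Max) (auto intro: continuous_on_coordinate)
      ultimately show ?thesis
        unfolding gap_def using F
        by (intro continuous_intros continuous_on_Min) auto
    qed
    have "continuous_on (geo K) s" unfolding s_def by (intro continuous_intros gapc)
    then have "continuous_on (geo K) (\<lambda>x. gap x F / s x)" if "F \<in> ?A"
      using spos gapc[OF that] by (intro continuous_intros) force+
    then show "continuous_on (geo K) (\<lambda>x. g x F)" by (cases "F \<in> ?A") (auto simp: g_def)
  qed
  have hsupp: "h y v \<noteq> 0 \<longleftrightarrow> (\<exists>F. y F \<noteq> 0 \<and> v \<in> F)" if y: "y \<in> geo ?L" for y v
  proof -
    have nn: "\<And>F. 0 \<le> y F" using y by (simp add: geo_def)
    have sub: "{F. y F \<noteq> 0} \<subseteq> ?A" using y by (auto simp: geo_def flag_def)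
    have "h y v = 0 \<longleftrightarrow> (\<forall>F\<in>?A. y F * (if v \<in> F then 1 / real (card F) else 0) = 0)"
      unfolding h_def using A nn by (intro sum_nonneg_eq_0_iff) auto
    also have "\<dots> \<longleftrightarrow> (\<forall>F\<in>?A. y F \<noteq> 0 \<longrightarrow> v \<notin> F)"
      using KD(6) by (intro ball_cong) auto
    also have "\<dots> \<longleftrightarrow> (\<forall>F. y F \<noteq> 0 \<longrightarrow> v \<notin> F)" using sub by blast
    finally show ?thesis by blast
  qed
  have hK: "h ` geo ?L \<subseteq> geo K"
  proof clarify
    fix y assume y: "y \<in> geo ?L"
    have y': "\<And>F. 0 \<le> y F" "{F. y F \<noteq> 0} \<in> ?L" "sum y ?A = 1" using y by (auto simp: geo_iff[OF L])
    let ?c = "{F. y F \<noteq> 0}"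
    have c: "finite ?c" "?c \<subseteq> ?A" "\<And>F G. F \<in> ?c \<Longrightarrow> G \<in> ?c \<Longrightarrow> F \<subseteq> G \<or> G \<subseteq> F"
      using flagD[OF y'(2)] by auto
    have "?c \<noteq> {}"
    proof
      assume "?c = {}"
      then have "sum y ?A = 0" by (intro sum.neutral) auto
      then show False using y'(3) by simp
    qed
    then obtain T where T: "T \<in> ?c" "\<And>F. F \<in> ?c \<Longrightarrow> F \<subseteq> T"
      using finite_has_maximal[OF c(1)] c(3) by (metis subset_antisym order_refl)
    have "{v. h y v \<noteq> 0} = T" using hsupp[OF y] T by blast
    then have "{v. h y v \<noteq> 0} \<in> K" using T(1) c(2) by blast
    moreover have "sum (h y) V = 1"
    proof -
      have "sum (h y) V = (\<Sum>F\<in>?A. \<Sum>v\<in>V. y F * (if v \<in> F then 1 / real (card F) else 0))"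
        unfolding h_def by (rule sum.swap)
      also have "\<dots> = (\<Sum>F\<in>?A. y F)"
      proof (rule sum.cong)
        fix F assume F: "F \<in> ?A"
        then have "F \<subseteq> V" "card F \<noteq> 0" using KD(2,6) by auto
        have "(\<Sum>v\<in>V. y F * (if v \<in> F then 1 / real (card F) else 0)) = (\<Sum>v\<in>F. y F * (1 / real (card F)))"
          using V \<open>F \<subseteq> V\<close> by (intro sum.mono_neutral_cong_right) auto
        then show "(\<Sum>v\<in>V. y F * (if v \<in> F then 1 / real (card F) else 0)) = y F"
          using \<open>card F \<noteq> 0\<close> by simp
      qed simp
      finally show ?thesis using y'(3) by simp
    qed
    moreover have "0 \<le> h y v" for v unfolding h_def using y'(1) by (intro sum_nonneg) auto
    ultimately show "h y \<in> geo K" by (auto simp: geo_iff[OF K])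
  qed
  have hc: "continuous_on S h" for S unfolding h_def
    by (rule continuous_on_coordinatewise_then_product) (intro continuous_intros)
  \<comment> \<open>A superlevel set of \<open>h y\<close> is comparable with every member
    \<open>G\<close> of the chain carrying \<open>y\<close>: a member of that chain which contains a
    point outside \<open>G\<close> contains all of \<open>G\<close>, so \<open>h y\<close> is at
    least as large on \<open>G\<close> as outside it.\<close>
  have contig: "{F. y F \<noteq> 0} \<union> {F. g (h y) F \<noteq> 0} \<in> ?L" if y: "y \<in> geo ?L" for y
  proof -
    have c: "{F. y F \<noteq> 0} \<in> ?L" using y by (simp add: geo_def)
    have "g (h y) \<in> geo ?L" using y hK gL by blast
    then have d: "{F. g (h y) F \<noteq> 0} \<in> ?L" by (simp add: geo_def)
    have cross: "F \<subseteq> G \<or> G \<subseteq> F" if "g (h y) F \<noteq> 0" and G: "y G \<noteq> 0" for F G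
    proof (rule ccontr)
      have F: "0 < gap (h y) F" "F \<in> ?A" using gsupp that(1) by auto
      assume "\<not> (F \<subseteq> G \<or> G \<subseteq> F)"
      then obtain a b where ab: "a \<in> F" "a \<notin> G" "b \<in> G" "b \<notin> F" by auto
      have GA: "G \<in> ?A" using c G by (auto simp: flag_def)
      then have "b \<in> V" using KD(2) \<open>b \<in> G\<close> by blast
      then have "h y b < h y a" using gap_level[OF F] ab by auto
      moreover have "h y a \<le> h y b" unfolding h_def
      proof (rule sum_mono)
        fix H assume "H \<in> ?A"
        have "a \<in> H \<longrightarrow> b \<in> H" if "y H \<noteq> 0"
          using flagD(3)[OF c, of G H] that G ab by blast
        then show "y H * (if a \<in> H then 1 / real (card H) else 0) \<le> y H * (if b \<in> H then 1 / real (card H) else 0)"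
          using y by (cases "y H = 0") (auto simp: geo_def)
      qed
      ultimately show False by simp
    qed
    show ?thesis
    proof (rule flagI)
      fix F G assume "F \<in> {F. y F \<noteq> 0} \<union> {F. g (h y) F \<noteq> 0}" "G \<in> {F. y F \<noteq> 0} \<union> {F. g (h y) F \<noteq> 0}" "F \<noteq> G"
      then show "F \<subseteq> G \<or> G \<subseteq> F"
        using flagD(3)[OF c, of F G] flagD(3)[OF d, of F G] cross[of F G] cross[of G F]
        by (elim UnE; simp; blast)
    qed (use flagD(1,2)[OF c] flagD(1,2)[OF d] in auto)
  qed
  show ?thesis
  proof (rule connI[OF L])
    assume "m > 0"
    then have "extensor (cube {}) (geo K)" using c by (simp add: conn_def)
    then show "geo ?L \<noteq> {}" using extensor_nonempty gL by fastforce
  next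
    fix J :: "nat set" assume J: "finite J" "J \<noteq> {}" "card J < m"
    have KJ: "extensor (cube J) (geo K)" using c J by (simp add: conn_def)
    show "fills J (geo ?L)" unfolding fills_def
    proof clarify
      fix f :: "(nat \<Rightarrow> real) \<Rightarrow> 'a set \<Rightarrow> real"
      assume f: "continuous_on (cube_bd J) f" "f ` cube_bd J \<subseteq> geo ?L"
      have "continuous_on (cube_bd J) (\<lambda>x. h (f x))" by (rule continuous_on_compose2[OF hc f])
      moreover have "(\<lambda>x. h (f x)) ` cube_bd J \<subseteq> geo K" using f(2) hK by blast
      ultimately obtain k where k: "continuous_on (cube J) k" "k ` cube J \<subseteq> geo K"
        "\<And>x. x \<in> cube_bd J \<Longrightarrow> k x = h (f x)"
        using extensorD[OF KJ closed_cube_bd[OF J(1)] cube_bd_subset] by metis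
      show "\<exists>g. continuous_on (cube J) g \<and> g ` cube J \<subseteq> geo ?L \<and> (\<forall>x\<in>cube_bd J. g x = f x)"
      proof (rule fill_contiguous[OF L J(1,2) f, of "\<lambda>x. g (k x)"])
        show "continuous_on (cube J) (\<lambda>x. g (k x))" by (rule continuous_on_compose2[OF gc k(1,2)])
        show "(\<lambda>x. g (k x)) ` cube J \<subseteq> geo ?L" using k(2) gL by blast
        show "{v. f x v \<noteq> 0} \<union> {v. g (k x) v \<noteq> 0} \<in> ?L" if "x \<in> cube_bd J" for x
        proof -
          have "f x \<in> geo ?L" using f(2) that by blast
          then show ?thesis using contig k(3)[OF that] by simp
        qed
      qed
    qed
  qed
qed

section \<open>Homotopy Cohen-Macaulay complexes are pure\<close>

text \<open>Dimension minus one, shifted by two, is the number of vertices of a largest face, so the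
  offsets cancel.\<close>

lemma homotopy_CM_iff:
  assumes K: "simplicial_complex_on V K"
  shows "homotopy_CM K \<longleftrightarrow> (\<forall>F\<in>K. conn (Max (card ` link K F)) (geo (link K F)))"
proof -
  have "k_connected (complex_dim (link K F) - 1) (realization (link K F)) \<longleftrightarrow>
     conn (Max (card ` link K F)) (geo (link K F))" if "F \<in> K" for F
    by (simp add: k_connected_iff_conn[OF simplicial_complex_on_link[OF K that]] complex_dim_def)
  then show ?thesis by (auto simp: homotopy_CM_def)
qed

lemma link_link: "G \<in> link K F \<Longrightarrow> link (link K F) G = link K (F \<union> G)"
  by (auto simp: link_def Un_assoc)

lemma homotopy_CM_link: "homotopy_CM K \<Longrightarrow> F \<in> K \<Longrightarrow> homotopy_CM (link K F)"
  unfolding homotopy_CM_def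
proof
  fix G assume K: "\<forall>F\<in>K. k_connected (complex_dim (link K F) - 1) (realization (link K F))"
    and G: "G \<in> link K F"
  then have "F \<union> G \<in> K" by (simp add: link_def)
  then show "k_connected (complex_dim (link (link K F) G) - 1) (realization (link (link K F) G))"
    using K by (simp add: link_link[OF G])
qed

lemma link_empty: "link K {} = K"
  by (simp add: link_def)

lemma Max_card:
  assumes "simplicial_complex_on V K"
  shows card_le_Max_card: "F \<in> K \<Longrightarrow> card F \<le> Max (card ` K)"
    and Max_card_attained: "\<exists>F\<in>K. card F = Max (card ` K)"
proof -
  have "finite (card ` K)" "card ` K \<noteq> {}" using simplicial_complex_onD(3,5)[OF assms] by auto
  then show "F \<in> K \<Longrightarrow> card F \<le> Max (card ` K)" "\<exists>F\<in>K. card F = Max (card ` K)"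
    by (auto dest: Max_in) (metis Max_in \<open>finite (card ` K)\<close> \<open>card ` K \<noteq> {}\<close> imageE)
qed

text \<open>\<open>conn 2\<close> provides a path from \<open>v\<close> to \<open>w\<close>. Along
  it the total weight on \<open>A\<close> is continuous and, since no face straddles
  \<open>A\<close>, takes only the values 0 and 1.\<close>

lemma conn_2_vertices:
  assumes K: "simplicial_complex_on V K" and c: "conn 2 (geo K)"
    and A: "\<And>F. F \<in> K \<Longrightarrow> F \<subseteq> A \<or> F \<inter> A = {}" and v: "{v} \<in> K" "v \<in> A" and w: "{w} \<in> K"
  shows "w \<in> A"
proof (rule ccontr)
  assume "w \<notin> A"
  let ?e = "\<lambda>v u. if u = v then 1 else 0 :: real"
  let ?p = "\<lambda>t :: real. \<lambda>j :: nat. if j = 0 then t else 0"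
  let ?f = "\<lambda>x :: nat \<Rightarrow> real. if x 0 \<le> 0 then ?e v else ?e w"
  have ext: "extensor (cube {0}) (geo K)" using c by (simp add: conn_def)
  have bd: "cube_bd {0} = {?p 1, ?p (-1)}"
    by (auto simp: cube_bd_def cube_def fun_eq_iff abs_if split: if_splits)
  have fin: "finite (cube_bd {0})" by (simp add: bd)
  obtain g where g: "continuous_on (cube {0}) g" "g ` cube {0} \<subseteq> geo K"
    "\<And>x. x \<in> cube_bd {0} \<Longrightarrow> g x = ?f x"
  proof (rule extensorD[OF ext closed_cube_bd cube_bd_subset, of ?f])
    show "continuous_on (cube_bd {0}) ?f" using fin by (rule continuous_on_finite)
    show "?f ` cube_bd {0} \<subseteq> geo K" using vertex_geo[OF v(1)] vertex_geo[OF w] by auto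
  qed (use that in auto)
  define \<phi> where "\<phi> = (\<lambda>t. \<Sum>u\<in>V \<inter> A. g (?p t) u)"
  have p: "?p t \<in> cube {0}" if "t \<in> {-1..1}" for t using that by (auto simp: cube_def)
  have "continuous_on {-1..1} ?p"
  proof (rule continuous_on_coordinatewise_then_product)
    show "continuous_on {-1..1} (\<lambda>t. ?p t i)" for i by (cases "i = 0") auto
  qed
  then have "continuous_on {-1..1} (\<lambda>t. g (?p t))"
    by (rule continuous_on_compose2[OF g(1)]) (use p in auto)
  then have \<phi>c: "continuous_on {-1..1} \<phi>" unfolding \<phi>_def
    by (rule continuous_on_sum[OF continuous_on_product_then_coordinatewise])
  have V: "finite V" "v \<in> V" using simplicial_complex_onD(1,2)[OF K] v(1) by auto
  have "\<phi> (-1) = 1" "\<phi> 1 = 0"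
    using g(3)[of "?p (-1)"] g(3)[of "?p 1"] V v(2) \<open>w \<notin> A\<close> by (auto simp: \<phi>_def bd)
  then obtain t where t: "t \<in> {-1..1}" "\<phi> t = 1/2"
    using IVT2'[of \<phi> 1 "1/2" "-1"] \<phi>c by auto
  have gt: "g (?p t) \<in> geo K" using g(2) p[OF t(1)] by blast
  let ?y = "g (?p t)"
  have y: "{u. ?y u \<noteq> 0} \<in> K" "sum ?y V = 1" using gt by (auto simp: geo_iff[OF K])
  show False
  proof (cases "{u. ?y u \<noteq> 0} \<subseteq> A")
    case True
    have "\<phi> t = sum ?y V" unfolding \<phi>_def using V True by (intro sum.mono_neutral_left) auto
    then show False using y t by simp
  next
    case False
    then have "{u. ?y u \<noteq> 0} \<inter> A = {}" using A[OF y(1)] by auto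
    then have "\<phi> t = 0" unfolding \<phi>_def by (intro sum.neutral) auto
    then show False using t by simp
  qed
qed

text \<open>Induction applied to vertex links shows that the facets through a vertex
  \<open>v\<close> have a common size \<open>D v\<close>. This number is constant on every face,
  hence on all vertices because the complex is connected.\<close>

theorem homotopy_CM_pure:
  assumes "simplicial_complex_on V K" "homotopy_CM K" "F \<in> K"
  shows "\<exists>G\<in>K. F \<subseteq> G \<and> card G = Max (card ` K)"
  using assms
proof (induction "Max (card ` K)" arbitrary: V K F rule: less_induct)
  case less
  note K = less.prems(1) and CM = less.prems(2)
  let ?D = "Max (card ` K)"
  note KD = simplicial_complex_onD[OF K]
  define D where "D = (\<lambda>v. Suc (Max (card ` link K {v})))"
  have lk: "simplicial_complex_on (V - {v}) (link K {v})" if "{v} \<in> K" for v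
    using simplicial_complex_on_link[OF K that] .
  have card_ins: "card (insert v G) = Suc (card G)" if "G \<in> link K {v}" for v G
    using that KD(6)[of "insert v G"] by (simp add: link_def)
  have D_le: "D v \<le> ?D" if v: "{v} \<in> K" for v
  proof -
    obtain G where G: "G \<in> link K {v}" "card G = Max (card ` link K {v})"
      using Max_card_attained[OF lk[OF v]] by blast
    then have "insert v G \<in> K" by (simp add: link_def)
    then show ?thesis using card_le_Max_card[OF K, of "insert v G"] card_ins[OF G(1)] G(2) by (simp add: D_def)
  qed
  have ext: "\<exists>G\<in>K. F \<subseteq> G \<and> card G = D v" if F: "F \<in> K" "v \<in> F" for F v
  proof -
    have v: "{v} \<in> K" using KD(4) F by blast
    have "F - {v} \<in> link K {v}" using F by (auto simp: link_def insert_absorb)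
    moreover have "Max (card ` link K {v}) < ?D" using D_le[OF v] by (simp add: D_def)
    ultimately obtain G where G: "G \<in> link K {v}" "F - {v} \<subseteq> G" "card G = Max (card ` link K {v})"
      using less.hyps[OF _ lk[OF v] homotopy_CM_link[OF CM v]] by blast
    then show ?thesis using card_ins[OF G(1)] F(2)
      by (intro bexI[of _ "insert v G"]) (auto simp: D_def link_def)
  qed
  have D_ge: "card G \<le> D v" if "G \<in> K" "v \<in> G" for G v
  proof -
    have v: "{v} \<in> K" using KD(4) that by blast
    have "G - {v} \<in> link K {v}" using that by (auto simp: link_def insert_absorb)
    then have "card (G - {v}) \<le> Max (card ` link K {v})" using card_le_Max_card[OF lk[OF v]] by blast
    then show ?thesis using that KD(6) by (simp add: D_def card_Diff_singleton)
  qed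
  have same: "D u = D v" if "F \<in> K" "u \<in> F" "v \<in> F" for F u v
  proof -
    have "D u \<le> D v" if uv: "u \<in> F" "v \<in> F" for u v
    proof -
      obtain G where G: "G \<in> K" "F \<subseteq> G" "card G = D u" using ext[OF \<open>F \<in> K\<close> uv(1)] by blast
      then have "card G \<le> D v" using D_ge[of G v] uv by blast
      then show ?thesis using G by simp
    qed
    then show ?thesis using that by (meson antisym)
  qed
  obtain T where T: "T \<in> K" "card T = ?D" using Max_card_attained[OF K] by blast
  show ?case
  proof (cases "F = {}")
    case True
    then show ?thesis using T by auto
  next
    case False
    then obtain w where w: "w \<in> F" by auto
    have wK: "{w} \<in> K" using KD(4) \<open>F \<in> K\<close> w by blast
    have "D w = ?D"
    \<comment> \<open>Connectedness is available only if facets have at least two vertices;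
      otherwise \<open>D w \<ge> 1\<close> already settles the claim.\<close>
    proof (cases "?D \<ge> 2")
      case True
      then obtain v where v: "v \<in> T" using T by fastforce
      have vK: "{v} \<in> K" using KD(4) T v by blast
      have "D v = ?D" using D_le[OF vK] D_ge[OF T(1) v] T(2) by simp
      have "conn ?D (geo K)" using CM KD(3) by (auto simp: homotopy_CM_iff[OF K] link_empty dest: bspec[of _ _ "{}"])
      then have c2: "conn 2 (geo K)" using True by (rule conn_mono)
      have "w \<in> {u. D u = ?D}"
      proof (rule conn_2_vertices[OF K c2 _ vK _ wK])
        show "v \<in> {u. D u = ?D}" using \<open>D v = ?D\<close> by simp
        show "F \<subseteq> {u. D u = ?D} \<or> F \<inter> {u. D u = ?D} = {}" if "F \<in> K" for F
        proof (cases "\<exists>u\<in>F. D u = ?D")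
          case True
          then obtain u where "u \<in> F" "D u = ?D" by blast
          then have "\<forall>u'\<in>F. D u' = ?D" using same[OF that] by metis
          then show ?thesis by blast
        qed blast
      qed
      then show ?thesis by simp
    next
      case False
      then show ?thesis using D_le[OF wK] by (simp add: D_def)
    qed
    then show ?thesis using ext[OF \<open>F \<in> K\<close> w] by simp
  qed
qed

section \<open>Flag complexes built from cones\<close>

lemma deletion_flag: "deletion (flag r A) v = flag r (A - {v})"
  by (auto simp: deletion_def flag_def)

lemma link_flag:
  assumes "symp r" "v \<in> A"
  shows "link (flag r A) {v} = flag r {x \<in> A. x \<noteq> v \<and> r v x}"
proof (rule set_eqI)
  show "C \<in> link (flag r A) {v} \<longleftrightarrow> C \<in> flag r {x \<in> A. x \<noteq> v \<and> r v x}" for C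
    using assms by (auto simp: link_def flag_def dest: sympD)
qed

lemma flag_image:
  assumes "inj_on \<phi> A" "\<And>x y. x \<in> A \<Longrightarrow> y \<in> A \<Longrightarrow> r' (\<phi> x) (\<phi> y) \<longleftrightarrow> r x y"
  shows "flag r' (\<phi> ` A) = (`) \<phi> ` flag r A"
proof
  show "flag r' (\<phi> ` A) \<subseteq> (`) \<phi> ` flag r A"
  proof
    fix C assume C: "C \<in> flag r' (\<phi> ` A)"
    then obtain B where B: "B \<subseteq> A" "C = \<phi> ` B" using flagD(1)[OF C] by (metis subset_imageE)
    have injB: "inj_on \<phi> B" using assms(1) B(1) by (rule inj_on_subset)
    have "B \<in> flag r A"
    proof (rule flagI[OF B(1)])
      show "finite B" using flagD(2)[OF C] B(2) injB by (simp add: finite_image_iff)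
      fix x y assume "x \<in> B" "y \<in> B" "x \<noteq> y"
      moreover from this have "\<phi> x \<noteq> \<phi> y" using injB by (auto dest: inj_onD)
      ultimately show "r x y" using flagD(3)[OF C, of "\<phi> x" "\<phi> y"] B assms(2)[of x y] by auto
    qed
    then show "C \<in> (`) \<phi> ` flag r A" using B(2) by blast
  qed
  show "(`) \<phi> ` flag r A \<subseteq> flag r' (\<phi> ` A)"
    using assms(2) by (fastforce simp: flag_def)
qed

lemma conn_flag_image:
  assumes "finite A" "inj_on \<phi> A" "\<And>x y. x \<in> A \<Longrightarrow> y \<in> A \<Longrightarrow> r' (\<phi> x) (\<phi> y) \<longleftrightarrow> r x y"
    "conn m (geo (flag r A))"
  shows "conn m (geo (flag r' (\<phi> ` A)))"
proof -
  have "flag r' (\<phi> ` A) = (`) \<phi> ` flag r A" using assms(2,3) by (rule flag_image)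
  then show ?thesis using conn_image[OF simplicial_complex_on_flag[OF assms(1)] assms(2,4)] by simp
qed

lemma conn_flag_cone:
  assumes "finite A" "v \<in> A" "symp r" "\<And>x. x \<in> A \<Longrightarrow> x \<noteq> v \<Longrightarrow> r v x"
  shows "conn m (geo (flag r A))"
proof (rule conn_cone[OF simplicial_complex_on_flag[OF assms(1)]])
  fix F assume "F \<in> flag r A"
  then show "insert v F \<in> flag r A" using assms(2,4) sympD[OF assms(3)] by (auto simp: flag_def)
qed

lemma conn_flag_add:
  assumes "finite A" "v \<in> A" "symp r" "conn m (geo (flag r (A - {v})))"
    "conn (m - 1) (geo (flag r {x \<in> A. x \<noteq> v \<and> r v x}))"
  shows "conn m (geo (flag r A))"
proof (rule conn_add_vertex[OF simplicial_complex_on_flag[OF assms(1)], of v])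
  show "{v} \<in> flag r A" using assms(2) by (simp add: flag_def)
qed (simp_all only: deletion_flag link_flag[OF assms(3,2)] assms(4,5))

lemma conn_flag_remove:
  assumes "finite A" "v \<in> A" "symp r" "conn m (geo (flag r A))"
    "conn m (geo (flag r {x \<in> A. x \<noteq> v \<and> r v x}))"
  shows "conn m (geo (flag r (A - {v})))"
  using conn_deletion[OF simplicial_complex_on_flag[OF assms(1)] assms(4), of v] assms
  by (simp add: deletion_flag link_flag)

text \<open>A combinatorial certificate that the clique complex of \<open>r\<close> on
  \<open>A\<close> is highly connected (\<open>conn a\<close>): start from a cone, or from nothing
  when \<open>a = 0\<close>, and add vertices whose neighbourhoods are certified one step lower.
  Being inductive, it supports proofs about joins that bare connectivity does not.\<close>

inductive built :: "('v \<Rightarrow> 'v \<Rightarrow> bool) \<Rightarrow> nat \<Rightarrow> 'v set \<Rightarrow> bool" for r where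
  built_0: "finite A \<Longrightarrow> built r 0 A"
| built_cone: "finite A \<Longrightarrow> v \<in> A \<Longrightarrow> (\<And>x. x \<in> A \<Longrightarrow> x \<noteq> v \<Longrightarrow> r v x) \<Longrightarrow> built r a A"
| built_Suc: "v \<in> A \<Longrightarrow> built r (Suc a) (A - {v}) \<Longrightarrow> built r a {x \<in> A. x \<noteq> v \<and> r v x} \<Longrightarrow> built r (Suc a) A"

lemma built_finite: "built r a A \<Longrightarrow> finite A"
  by (induction rule: built.induct) auto

lemma built_mono: "built r a A \<Longrightarrow> b \<le> a \<Longrightarrow> built r b A"
proof (induction arbitrary: b rule: built.induct)
  case (built_Suc v A a)
  then have "finite A" using built_finite by fastforce
  then show ?case using built_Suc by (cases b) (auto intro: built.intros)
qed (auto intro: built.intros)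

lemma built_add:
  assumes "v \<in> A" "built r a (A - {v})" "built r (a - 1) {x \<in> A. x \<noteq> v \<and> r v x}"
  shows "built r a A"
proof (cases a)
  case 0
  then show ?thesis using built_finite[OF assms(2)] by (auto intro: built_0)
next
  case (Suc b)
  then show ?thesis using assms by (auto intro: built_Suc)
qed

lemma built_image:
  assumes "built r a A" "inj_on \<phi> A" "\<And>x y. x \<in> A \<Longrightarrow> y \<in> A \<Longrightarrow> r' (\<phi> x) (\<phi> y) \<longleftrightarrow> r x y"
  shows "built r' a (\<phi> ` A)"
  using assms
proof (induction rule: built.induct)
  case (built_0 A)
  then show ?case by (auto intro: built.built_0)
next
  case (built_cone A v a)
  then show ?case by (intro built.built_cone[of _ "\<phi> v"]) auto
next
  case (built_Suc v A a)
  have inj: "inj_on \<phi> (A - {v})" "inj_on \<phi> {x \<in> A. x \<noteq> v \<and> r v x}"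
    using built_Suc.prems(1) by (auto intro: inj_on_subset)
  have 1: "\<phi> ` (A - {v}) = \<phi> ` A - {\<phi> v}"
    using built_Suc.prems(1) built_Suc.hyps(1) by (auto dest: inj_onD)
  have 2: "\<phi> ` {x \<in> A. x \<noteq> v \<and> r v x} = {y \<in> \<phi> ` A. y \<noteq> \<phi> v \<and> r' (\<phi> v) y}"
    using built_Suc.prems built_Suc.hyps(1) by (auto dest: inj_onD)
  have "built r' (Suc a) (\<phi> ` (A - {v}))" using inj built_Suc.prems by (intro built_Suc.IH(1)) auto
  then have 3: "built r' (Suc a) (\<phi> ` A - {\<phi> v})" by (simp only: 1)
  have "built r' a (\<phi> ` {x \<in> A. x \<noteq> v \<and> r v x})" using inj built_Suc.prems by (intro built_Suc.IH(2)) auto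
  then have "built r' a {y \<in> \<phi> ` A. y \<noteq> \<phi> v \<and> r' (\<phi> v) y}" by (simp only: 2)
  then show ?case by (rule built.built_Suc[OF imageI[OF built_Suc.hyps(1)] 3])
qed

text \<open>The vertices of \<open>A\<close> are added one at a time; the link of each is again a
  join with \<open>B\<close>. This is the base case \<open>a = 0\<close> of
  \<open>conn_join\<close>.\<close>

lemma conn_join_any:
  assumes "finite A" "finite B" "symp r" "A \<inter> B = {}" "\<And>x y. x \<in> A \<Longrightarrow> y \<in> B \<Longrightarrow> r x y"
    "conn b (geo (flag r B))"
  shows "conn b (geo (flag r (A \<union> B)))"
  using assms(1,4,5)
proof (induction A rule: finite_psubset_induct)
  case (psubset A)
  show ?case
  proof (cases "A = {}")
    case True
    then show ?thesis using assms(6) by simp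
  next
    case False
    then obtain v where v: "v \<in> A" by auto
    have nb: "{x \<in> A \<union> B. x \<noteq> v \<and> r v x} = {x \<in> A. x \<noteq> v \<and> r v x} \<union> B" "A \<union> B - {v} = (A - {v}) \<union> B"
      using v psubset.prems by auto
    show ?thesis
    proof (rule conn_flag_add[of _ v])
      show "conn b (geo (flag r (A \<union> B - {v})))" unfolding nb
        using v psubset.prems by (intro psubset.IH) auto
      have "conn b (geo (flag r {x \<in> A \<union> B. x \<noteq> v \<and> r v x}))" unfolding nb
        using v psubset.prems by (intro psubset.IH) auto
      then show "conn (b - 1) (geo (flag r {x \<in> A \<union> B. x \<noteq> v \<and> r v x}))" by (rule conn_mono) simp
    qed (use v psubset.hyps assms in auto)
  qed
qed

text \<open>Induction along the certificate of \<open>A\<close>: in the join, the link of a new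
  vertex is its old neighbourhood joined with \<open>B\<close>. Nothing beyond \<open>conn\<close>
  is asked of \<open>B\<close>.\<close>

theorem conn_join:
  assumes "built r a A" "finite B" "symp r" "A \<inter> B = {}" "\<And>x y. x \<in> A \<Longrightarrow> y \<in> B \<Longrightarrow> r x y"
    "conn b (geo (flag r B))"
  shows "conn (a + b) (geo (flag r (A \<union> B)))"
  using assms(1,4,5)
proof (induction rule: built.induct)
  case (built_0 A)
  then show ?case using conn_join_any[OF _ assms(2,3) _ _ assms(6)] by simp
next
  case (built_cone A v a)
  then show ?case using assms by (intro conn_flag_cone[of _ v]) auto
next
  case (built_Suc v A a)
  have nb: "{x \<in> A \<union> B. x \<noteq> v \<and> r v x} = {x \<in> A. x \<noteq> v \<and> r v x} \<union> B" "A \<union> B - {v} = (A - {v}) \<union> B"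
    using built_Suc.hyps(1) built_Suc.prems by auto
  have "finite A" using built_finite[OF built_Suc.hyps(2)] by simp
  show ?case
  proof (rule conn_flag_add[of _ v])
    show "conn (Suc a + b) (geo (flag r (A \<union> B - {v})))" unfolding nb
      using built_Suc.prems by (intro built_Suc.IH) auto
    have "conn (a + b) (geo (flag r {x \<in> A \<union> B. x \<noteq> v \<and> r v x}))" unfolding nb
      using built_Suc.prems by (intro built_Suc.IH) auto
    then show "conn (Suc a + b - 1) (geo (flag r {x \<in> A \<union> B. x \<noteq> v \<and> r v x}))" by simp
  qed (use built_Suc.hyps \<open>finite A\<close> assms in auto)
qed

lemma built_join_any:
  assumes "finite A" "built r b B" "A \<inter> B = {}" "\<And>x y. x \<in> A \<Longrightarrow> y \<in> B \<Longrightarrow> r x y"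
  shows "built r b (A \<union> B)"
  using assms(1,3,4)
proof (induction A rule: finite_psubset_induct)
  case (psubset A)
  show ?case
  proof (cases "A = {}")
    case True
    then show ?thesis using assms(2) by simp
  next
    case False
    then obtain v where v: "v \<in> A" by auto
    have nb: "{x \<in> A \<union> B. x \<noteq> v \<and> r v x} = {x \<in> A. x \<noteq> v \<and> r v x} \<union> B" "A \<union> B - {v} = (A - {v}) \<union> B"
      using v psubset.prems by auto
    show ?thesis
    proof (rule built_add[of v])
      show "built r b (A \<union> B - {v})" unfolding nb
        using v psubset.prems by (intro psubset.IH) auto
      have "built r b {x \<in> A \<union> B. x \<noteq> v \<and> r v x}" unfolding nb
        using v psubset.prems by (intro psubset.IH) auto
      then show "built r (b - 1) {x \<in> A \<union> B. x \<noteq> v \<and> r v x}" by (rule built_mono) simp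
    qed (use v in auto)
  qed
qed

lemma built_join:
  assumes "built r a A" "built r b B" "symp r" "A \<inter> B = {}" "\<And>x y. x \<in> A \<Longrightarrow> y \<in> B \<Longrightarrow> r x y"
  shows "built r (a + b) (A \<union> B)"
  using assms(1,4,5)
proof (induction rule: built.induct)
  case (built_0 A)
  then show ?case using built_join_any[OF _ assms(2)] by simp
next
  case (built_cone A v a)
  then show ?case using built_finite[OF assms(2)] by (intro built.built_cone[of _ v]) auto
next
  case (built_Suc v A a)
  have nb: "{x \<in> A \<union> B. x \<noteq> v \<and> r v x} = {x \<in> A. x \<noteq> v \<and> r v x} \<union> B" "A \<union> B - {v} = (A - {v}) \<union> B"
    using built_Suc.hyps(1) built_Suc.prems by auto
  have "built r (Suc (a + b)) (A \<union> B)"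
  proof (rule built.built_Suc[of v])
    have "built r (Suc a + b) ((A - {v}) \<union> B)"
      using built_Suc.prems by (intro built_Suc.IH) auto
    then show "built r (Suc (a + b)) (A \<union> B - {v})" unfolding nb by simp
    show "built r (a + b) {x \<in> A \<union> B. x \<noteq> v \<and> r v x}" unfolding nb
      using built_Suc.prems by (intro built_Suc.IH) auto
  qed (use built_Suc.hyps in auto)
  then show ?case by simp
qed

section \<open>Posets\<close>

definition poset_on :: "'a set \<Rightarrow> ('a \<Rightarrow> 'a \<Rightarrow> bool) \<Rightarrow> bool" where
  "poset_on A le \<longleftrightarrow> (\<forall>x\<in>A. le x x) \<and> (\<forall>x\<in>A. \<forall>y\<in>A. le x y \<longrightarrow> le y x \<longrightarrow> x = y) \<and>
     (\<forall>x\<in>A. \<forall>y\<in>A. \<forall>z\<in>A. le x y \<longrightarrow> le y z \<longrightarrow> le x z)"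

lemma poset_onD:
  assumes "poset_on A le"
  shows "x \<in> A \<Longrightarrow> le x x" "x \<in> A \<Longrightarrow> y \<in> A \<Longrightarrow> le x y \<Longrightarrow> le y x \<Longrightarrow> x = y"
    "x \<in> A \<Longrightarrow> y \<in> A \<Longrightarrow> z \<in> A \<Longrightarrow> le x y \<Longrightarrow> le y z \<Longrightarrow> le x z"
  using assms unfolding poset_on_def by blast+

lemma poset_on_subset: "poset_on A le \<Longrightarrow> B \<subseteq> A \<Longrightarrow> poset_on B le"
  unfolding poset_on_def by blast

lemma poset_on_subsets: "poset_on A (\<subseteq>)"
  by (auto simp: poset_on_def)

lemma symp_comparable: "symp (comparable le)"
  by (auto intro: sympI)

lemma poset_maximal:
  assumes "finite S" "S \<noteq> {}" "poset_on S le"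
  obtains v where "v \<in> S" "\<And>x. x \<in> S \<Longrightarrow> le v x \<Longrightarrow> x = v"
proof -
  have "\<exists>v\<in>S. \<forall>x\<in>S. le v x \<longrightarrow> x = v"
    using assms
  proof (induction S rule: finite_ne_induct)
    case (insert a S)
    obtain v where v: "v \<in> S" "\<forall>x\<in>S. le v x \<longrightarrow> x = v"
      using insert.IH poset_on_subset[OF insert.prems] by blast
    note po = poset_onD[OF insert.prems]
    show ?case
    proof (cases "le v a")
      case True
      have "x = a" if "x \<in> insert a S" "le a x" for x
      proof (rule ccontr)
        assume "x \<noteq> a"
        then have "x \<in> S" using that by auto
        moreover have "le v x" using po(3)[of v a x] True that v(1) by auto
        ultimately have "x = v" using v(2) by blast
        then show False using po(2)[of a v] that True v(1) \<open>x \<noteq> a\<close> by auto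
      qed
      then show ?thesis by blast
    next
      case False
      then show ?thesis using v by blast
    qed
  qed simp
  then show thesis using that by blast
qed

text \<open>Induction along a linear extension. Both halves are recorded, that nothing earlier lies
  above \<open>v\<close> and that everything below \<open>v\<close> is earlier, because
  neighbourhoods are computed from them.\<close>

lemma finite_poset_induct [consumes 2, case_names empty add]:
  assumes "finite S" "poset_on S le" "P {}"
    and add: "\<And>T v. T \<subseteq> S \<Longrightarrow> v \<in> S \<Longrightarrow> v \<notin> T \<Longrightarrow> (\<And>x. x \<in> T \<Longrightarrow> \<not> le v x) \<Longrightarrow>
        (\<And>x. x \<in> S \<Longrightarrow> le x v \<Longrightarrow> x \<noteq> v \<Longrightarrow> x \<in> T) \<Longrightarrow> P T \<Longrightarrow> P (insert v T)"
  shows "P S"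
proof -
  have "P D" if "finite D" "D \<subseteq> S" "\<And>x y. x \<in> D \<Longrightarrow> y \<in> S \<Longrightarrow> le y x \<Longrightarrow> y \<in> D" for D
    using that
  proof (induction D rule: finite_psubset_induct)
    case (psubset D)
    show ?case
    proof (cases "D = {}")
      case True
      then show ?thesis using assms(3) by simp
    next
      case False
      then obtain v where v: "v \<in> D" "\<And>x. x \<in> D \<Longrightarrow> le v x \<Longrightarrow> x = v"
        using poset_maximal[OF psubset.hyps(1) _ poset_on_subset[OF assms(2) psubset.prems(1)]] by blast
      have "P (D - {v})"
      proof (rule psubset.IH)
        fix x y assume xy: "x \<in> D - {v}" "y \<in> S" "le y x"
        then have "y \<in> D" using psubset.prems(2) by blast
        moreover have "y \<noteq> v" using xy v(2) by blast
        ultimately show "y \<in> D - {v}" by blast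
      qed (use v psubset.prems in auto)
      moreover have "x \<in> D - {v}" if "x \<in> S" "le x v" "x \<noteq> v" for x
        using that psubset.prems(2)[OF v(1)] by blast
      ultimately have "P (insert v (D - {v}))"
        using v psubset.prems(1) by (intro add) auto
      then show ?thesis using v(1) by (simp add: insert_absorb)
    qed
  qed
  then show ?thesis using assms(1) by blast
qed

text \<open>Conical contractibility in the sense of Quillen, \<open>x \<le> e x \<ge> p\<close>. The
  image of the closure operator \<open>e\<close> is a cone with apex \<open>e p\<close>. The other
  elements are added from below: the neighbours of \<open>v\<close> are then either below
  \<open>v\<close> or closed elements above it, and all are comparable with
  \<open>e v\<close>.\<close>

lemma built_conical:
  assumes A: "finite A" and po: "poset_on A le"
    and e: "\<And>x. x \<in> A \<Longrightarrow> e x \<in> A" "\<And>x. x \<in> A \<Longrightarrow> le x (e x)" "\<And>x. x \<in> A \<Longrightarrow> e (e x) = e x"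
      "\<And>x y. x \<in> A \<Longrightarrow> y \<in> A \<Longrightarrow> le x y \<Longrightarrow> le (e x) (e y)"
    and p: "p \<in> A" "\<And>x. x \<in> A \<Longrightarrow> le p (e x)"
  shows "built (comparable le) a A"
proof -
  note poD = poset_onD[OF po]
  have "built (comparable le) a (e ` A \<union> (A - e ` A))"
  proof (rule finite_poset_induct[of "A - e ` A" le])
    show "finite (A - e ` A)" "poset_on (A - e ` A) le"
      using A po by (auto intro: poset_on_subset)
    have "le (e p) (e x)" if "x \<in> A" for x
      using e(4)[OF p(1) e(1)[OF that] p(2)[OF that]] e(3)[OF that] by simp
    then show "built (comparable le) a (e ` A \<union> {})"
      using A p(1) by (intro built_cone[of _ "e p"]) auto
  next
    fix T v assume T: "T \<subseteq> A - e ` A" "v \<in> A - e ` A" "v \<notin> T" "\<And>x. x \<in> T \<Longrightarrow> \<not> le v x"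
      and IH: "built (comparable le) a (e ` A \<union> T)"
    let ?N = "{x \<in> e ` A \<union> insert v T. x \<noteq> v \<and> comparable le v x}"
    have v: "v \<in> A" using T by auto
    show "built (comparable le) a (e ` A \<union> insert v T)"
    proof (rule built_add[of v])
      have "e ` A \<union> insert v T - {v} = e ` A \<union> T" using T by auto
      then show "built (comparable le) a (e ` A \<union> insert v T - {v})" using IH by simp
      have "finite (e ` A \<union> insert v T)" using A T(1) by (auto intro: finite_subset)
      then show "built (comparable le) (a - 1) ?N"
      proof (intro built_cone[of _ "e v"])
        have "e v \<noteq> v" using v T(2) by (metis DiffD2 imageI)
        then show "e v \<in> ?N" using v e(2)[OF v] by auto
        fix x assume x: "x \<in> ?N" "x \<noteq> e v"
        show "comparable le (e v) x"
        proof (cases "le x v")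
          case True
          have "x \<in> A" using x T(1) v e(1) by auto
          then have "le x (e v)" using poD(3)[of x v "e v"] True v e(1,2) by blast
          then show ?thesis by simp
        next
          case False
          then have "le v x" "x \<in> e ` A" using x T(4) by auto
          then obtain u where "u \<in> A" "x = e u" by auto
          then have "le (e v) x" using e(4)[OF v _ \<open>le v x\<close>] e(1,3) by auto
          then show ?thesis by simp
        qed
      qed auto
    qed simp
  qed
  moreover have "e ` A \<union> (A - e ` A) = A" using e(1) by auto
  ultimately show ?thesis by simp
qed

text \<open>Without the coatom \<open>S - {x}\<close> the interval is conical through adjoining
  \<open>x\<close>. The elements comparable with the coatom form the interval below it, which is
  certified by induction.\<close>

lemma built_open_interval:
  assumes "finite S" "Z \<subseteq> S"
  shows "built (comparable (\<subseteq>)) (card (S - Z) - 1) {X. Z \<subset> X \<and> X \<subset> S}"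
  using assms
proof (induction S rule: finite_psubset_induct)
  case (psubset S)
  let ?A = "{X. Z \<subset> X \<and> X \<subset> S}"
  have fin: "finite ?A" using psubset.hyps(1) by (auto intro: finite_subset[of _ "Pow S"])
  show ?case
  proof (cases "card (S - Z) \<le> 1")
    case True
    then show ?thesis using fin by (auto intro: built_0)
  next
    case False
    then have "S - Z \<noteq> {}" by (metis card.empty zero_le)
    then obtain x where x: "x \<in> S" "x \<notin> Z" by blast
    have "S - Z \<noteq> {x}" using False by auto
    then obtain y where y: "y \<in> S" "y \<notin> Z" "y \<noteq> x" using x by blast
    let ?v = "S - {x}"
    have "built (comparable (\<subseteq>)) (card (?v - Z) - 1) {X. Z \<subset> X \<and> X \<subset> ?v}"
      using x psubset.prems by (intro psubset.IH) auto
    moreover have "card (?v - Z) - 1 = card (S - Z) - 1 - 1"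
    proof -
      have "?v - Z = (S - Z) - {x}" by auto
      then show ?thesis using x psubset.hyps(1) by (simp add: card_Diff_singleton)
    qed
    moreover have "{X \<in> ?A. X \<noteq> ?v \<and> comparable (\<subseteq>) ?v X} = {X. Z \<subset> X \<and> X \<subset> ?v}"
      using x psubset.prems by blast
    ultimately have 1: "built (comparable (\<subseteq>)) (card (S - Z) - 1 - 1) {X \<in> ?A. X \<noteq> ?v \<and> comparable (\<subseteq>) ?v X}"
      by simp
    have 2: "built (comparable (\<subseteq>)) (card (S - Z) - 1) (?A - {?v})"
    proof (rule built_conical[where e = "insert x" and p = "insert x Z"])
      show "finite (?A - {?v})" using fin by simp
      show "poset_on (?A - {?v}) (\<subseteq>)" by (rule poset_on_subsets)
      show "insert x X \<in> ?A - {?v}" if "X \<in> ?A - {?v}" for X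
        using that x by blast
      show "insert x Z \<in> ?A - {?v}" using x y psubset.prems by blast
    qed auto
    show ?thesis by (rule built_add[OF _ 2 1]) (use x y psubset.prems in blast)
  qed
qed

text \<open>The largest member \<open>Z\<close> of the chain splits the link into a join: the link
  of the remaining chain below \<open>Z\<close>, and the open interval from \<open>Z\<close> to
  \<open>S\<close>.\<close>

lemma built_chain_link:
  assumes "finite S" "finite c" "\<And>X. X \<in> c \<Longrightarrow> {} \<subset> X \<and> X \<subset> S"
    "\<And>X Y. X \<in> c \<Longrightarrow> Y \<in> c \<Longrightarrow> comparable (\<subseteq>) X Y"
  shows "built (comparable (\<subseteq>)) (card S - 1 - card c)
    {X. {} \<subset> X \<and> X \<subset> S \<and> X \<notin> c \<and> (\<forall>Y\<in>c. comparable (\<subseteq>) X Y)}"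
  using assms(2,1,3,4)
proof (induction c arbitrary: S rule: finite_psubset_induct)
  case (psubset c)
  show ?case
  proof (cases "c = {}")
    case True
    then show ?thesis using built_open_interval[OF psubset.prems(1), of "{}"] by simp
  next
    case False
    then obtain Z where Z: "Z \<in> c" "\<And>X. X \<in> c \<Longrightarrow> Z \<subseteq> X \<Longrightarrow> X = Z"
      using poset_maximal[OF psubset.hyps(1) _ poset_on_subsets] by metis
    have max: "X \<subseteq> Z" if "X \<in> c" for X using Z psubset.prems(3)[OF that Z(1)] that by blast
    have ZS: "{} \<subset> Z" "Z \<subset> S" using psubset.prems(2)[OF Z(1)] by auto
    have finZ: "finite Z" using ZS psubset.prems(1) finite_subset by blast
    let ?c = "c - {Z}"
    let ?L = "{X. {} \<subset> X \<and> X \<subset> Z \<and> X \<notin> ?c \<and> (\<forall>Y\<in>?c. comparable (\<subseteq>) X Y)}"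
    let ?U = "{X. Z \<subset> X \<and> X \<subset> S}"
    have L: "built (comparable (\<subseteq>)) (card Z - 1 - card ?c) ?L"
    proof (rule psubset.IH)
      show "?c \<subset> c" using Z(1) by auto
      show "finite Z" by (rule finZ)
      show "{} \<subset> X \<and> X \<subset> Z" if "X \<in> ?c" for X using that max psubset.prems(2) by blast
      show "comparable (\<subseteq>) X Y" if "X \<in> ?c" "Y \<in> ?c" for X Y using that psubset.prems(3) by blast
    qed
    have U: "built (comparable (\<subseteq>)) (card (S - Z) - 1) ?U"
      using ZS psubset.prems(1) by (intro built_open_interval) auto
    have joined: "built (comparable (\<subseteq>)) ((card Z - 1 - card ?c) + (card (S - Z) - 1)) (?L \<union> ?U)"
      by (rule built_join[OF L U symp_comparable]) auto
    have eq: "?L \<union> ?U = {X. {} \<subset> X \<and> X \<subset> S \<and> X \<notin> c \<and> (\<forall>Y\<in>c. comparable (\<subseteq>) X Y)}"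
    proof (rule set_eqI, rule iffI)
      fix X assume "X \<in> ?L \<union> ?U"
      then show "X \<in> {X. {} \<subset> X \<and> X \<subset> S \<and> X \<notin> c \<and> (\<forall>Y\<in>c. comparable (\<subseteq>) X Y)}"
      proof
        assume X: "X \<in> ?L"
        then have "comparable (\<subseteq>) X Y" if "Y \<in> c" for Y using that by (cases "Y = Z") auto
        moreover have "X \<notin> c" "{} \<subset> X" "X \<subset> S" using X ZS(2) by auto
        ultimately show ?thesis by blast
      next
        assume X: "X \<in> ?U"
        then have "Y \<subseteq> X" if "Y \<in> c" for Y using max[OF that] by auto
        moreover have "X \<notin> c" using X max[of X] by auto
        moreover have "{} \<subset> X" "X \<subset> S" using X ZS(1) by auto
        ultimately show ?thesis by blast
      qed
    next
      fix X assume X: "X \<in> {X. {} \<subset> X \<and> X \<subset> S \<and> X \<notin> c \<and> (\<forall>Y\<in>c. comparable (\<subseteq>) X Y)}"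
      then have "X \<subset> Z \<or> Z \<subset> X" using Z(1) by blast
      then show "X \<in> ?L \<union> ?U"
      proof
        assume "X \<subset> Z"
        then have "X \<in> ?L" using X by simp
        then show ?thesis by simp
      next
        assume "Z \<subset> X"
        then have "X \<in> ?U" using X by simp
        then show ?thesis by simp
      qed
    qed
    have "card S - 1 - card c \<le> (card Z - 1 - card ?c) + (card (S - Z) - 1)"
    proof -
      have "card (S - Z) = card S - card Z" using finZ ZS by (intro card_Diff_subset) auto
      moreover have "card ?c = card c - 1" using Z(1) by (simp add: card_Diff_singleton)
      moreover have "card c > 0" using psubset.hyps(1) False by auto
      moreover have "card Z > 0" using finZ ZS by auto
      moreover have "card Z < card S" using ZS psubset.prems(1) by (intro psubset_card_mono)
      ultimately show ?thesis by linarith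
    qed
    with joined show ?thesis unfolding eq by (rule built_mono)
  qed
qed

section \<open>A fiber theorem\<close>

text \<open>This is Quillen's fiber theorem. Adding the faces of \<open>L\<close> to \<open>U\<close> gives the mapping cylinder
  of \<open>f\<close>. It is as connected as \<open>L\<close>, since the link of each \<open>p\<close> in \<open>L\<close> and the smaller elements of
  \<open>U\<close> is a cone with apex \<open>f p\<close>. Then the faces are removed again, the small ones first.\<close>

theorem conn_fiber:
  fixes U :: "'p set" and L :: "'v set set"
  assumes U: "finite U" "poset_on U le" and L: "simplicial_complex_on V L"
    and f: "\<And>p. p \<in> U \<Longrightarrow> f p \<in> L" "\<And>p. p \<in> U \<Longrightarrow> f p \<noteq> {}"
      "\<And>p p'. p \<in> U \<Longrightarrow> p' \<in> U \<Longrightarrow> le p p' \<Longrightarrow> f p \<subseteq> f p'"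
    and base: "conn d (geo L)"
    and links: "\<And>q. q \<in> L \<Longrightarrow> q \<noteq> {} \<Longrightarrow> conn (d - card q) (geo (link L q))"
    and fibers: "\<And>q. q \<in> L \<Longrightarrow> q \<noteq> {} \<Longrightarrow> built (comparable le) (card q) {p \<in> U. f p \<subseteq> q}"
  shows "conn d (geo (flag (comparable le) U))"
proof -
  define A where "A = L - {{}}"
  \<comment> \<open>The mapping cylinder order: \<open>p\<close> in \<open>U\<close> lies below
    exactly the faces that contain \<open>f p\<close>, and no face lies below an element of
    \<open>U\<close>.\<close>
  define ler where "ler = (\<lambda>x y. case x of
      Inl p \<Rightarrow> (case y of Inl p' \<Rightarrow> le p p' | Inr q \<Rightarrow> f p \<subseteq> q)
    | Inr q \<Rightarrow> (case y of Inl p \<Rightarrow> False | Inr q' \<Rightarrow> q \<subseteq> (q' :: 'v set)))"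
  let ?R = "comparable ler"
  have ler [simp]: "ler (Inl p) (Inl p') = le p p'" "ler (Inl p) (Inr q) = (f p \<subseteq> q)"
    "ler (Inr q) (Inl p) = False" "ler (Inr q) (Inr q') = (q \<subseteq> q')" for p p' q q'
    by (simp_all add: ler_def)
  have A: "finite A" using simplicial_complex_onD(5)[OF L] by (simp add: A_def)
  have start: "conn d (geo (flag ?R (Inr ` A)))"
    using A conn_subdivision[OF L base] unfolding A_def
    by (intro conn_flag_image[where r = "comparable (\<subseteq>)"]) auto
  have cylinder: "conn d (geo (flag ?R (Inl ` U \<union> Inr ` A)))"
    using U
  proof (induction rule: finite_poset_induct)
    case empty
    then show ?case using start by simp
  next
    case (add T v)
    have "finite T" using add.hyps(1) U(1) finite_subset by blast
    let ?B = "Inl ` insert v T \<union> Inr ` A"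
    show ?case
    proof (rule conn_flag_add[of _ "Inl v"])
      have "?B - {Inl v} = Inl ` T \<union> Inr ` A" using add.hyps(3) by auto
      then show "conn d (geo (flag ?R (?B - {Inl v})))" using add.IH by simp
      show "conn (d - 1) (geo (flag ?R {x \<in> ?B. x \<noteq> Inl v \<and> ?R (Inl v) x}))"
      proof (rule conn_flag_cone[of _ "Inr (f v)"])
        show "Inr (f v) \<in> {x \<in> ?B. x \<noteq> Inl v \<and> ?R (Inl v) x}"
          using f add.hyps(2) by (auto simp: A_def)
        fix x assume x: "x \<in> {x \<in> ?B. x \<noteq> Inl v \<and> ?R (Inl v) x}"
        show "?R (Inr (f v)) x"
        proof (cases x)
          case (Inl p)
          then have "p \<in> T" "le p v" using x add.hyps(4) by auto
          then have "f p \<subseteq> f v" using f(3)[of p v] add.hyps(1,2) by auto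
          then show ?thesis using Inl by simp
        next
          case (Inr q)
          then show ?thesis using x by auto
        qed
      qed (use \<open>finite T\<close> A in \<open>auto intro: sympI\<close>)
    qed (use \<open>finite T\<close> A in \<open>auto intro: sympI\<close>)
  qed
  have "conn d (geo (flag ?R (Inl ` U \<union> Inr ` (A - A))))"
  proof (rule finite_poset_induct[of A "(\<subseteq>)" "\<lambda>T. conn d (geo (flag ?R (Inl ` U \<union> Inr ` (A - T))))"])
    show "conn d (geo (flag ?R (Inl ` U \<union> Inr ` (A - {}))))" using cylinder by simp
  next
    fix T v assume T: "T \<subseteq> A" "v \<in> A" "v \<notin> T" "\<And>x. x \<in> T \<Longrightarrow> \<not> v \<subseteq> x"
        "\<And>x. x \<in> A \<Longrightarrow> x \<subseteq> v \<Longrightarrow> x \<noteq> v \<Longrightarrow> x \<in> T"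
      and IH: "conn d (geo (flag ?R (Inl ` U \<union> Inr ` (A - T))))"
    let ?B = "Inl ` U \<union> Inr ` (A - T)"
    let ?P = "{p \<in> U. f p \<subseteq> v}" and ?Q = "{q \<in> A. v \<subset> q}"
    have v: "v \<in> L" "v \<noteq> {}" using T(2) by (auto simp: A_def)
    \<comment> \<open>All faces below \<open>v\<close> are gone when \<open>v\<close> is removed, so
      its neighbours are the fiber over \<open>v\<close> and the faces properly above it, joined to
      each other.\<close>
    have "{x \<in> ?B. x \<noteq> Inr v \<and> ?R (Inr v) x} = Inl ` ?P \<union> Inr ` ?Q"
    proof (rule set_eqI)
      fix x show "x \<in> {x \<in> ?B. x \<noteq> Inr v \<and> ?R (Inr v) x} \<longleftrightarrow> x \<in> Inl ` ?P \<union> Inr ` ?Q"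
      proof (cases x)
        case (Inl p)
        then show ?thesis by auto
      next
        case (Inr q)
        then show ?thesis using T(4)[of q] T(5)[of q] by auto
      qed
    qed
    moreover have "conn d (geo (flag ?R (Inl ` ?P \<union> Inr ` ?Q)))"
    proof -
      have "built ?R (card v) (Inl ` ?P)"
        using fibers[OF v] by (rule built_image) auto
      moreover have "conn (d - card v) (geo (flag ?R (Inr ` ?Q)))"
      proof -
        let ?L = "link L v"
        have Lk: "simplicial_complex_on (V - v) ?L" by (rule simplicial_complex_on_link[OF L v(1)])
        have *: "(\<lambda>G. Inr (v \<union> G)) ` (?L - {{}}) = (Inr ` ?Q :: ('p + 'v set) set)"
        proof (intro set_eqI iffI)
          fix x :: "'p + 'v set" assume "x \<in> Inr ` ?Q"
          then obtain q where q: "x = Inr q" "q \<in> L" "v \<subset> q" by (auto simp: A_def)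
          then have "q - v \<in> ?L - {{}}" "x = Inr (v \<union> (q - v))"
            by (auto simp: link_def Un_absorb1)
          then show "x \<in> (\<lambda>G. Inr (v \<union> G)) ` (?L - {{}})" by blast
        qed (use v in \<open>auto simp: link_def A_def\<close>)
        have "conn (d - card v) (geo (flag (comparable (\<subseteq>)) (?L - {{}})))"
          by (rule conn_subdivision[OF Lk links[OF v]])
        then have "conn (d - card v) (geo (flag ?R ((\<lambda>G. Inr (v \<union> G)) ` (?L - {{}}))))"
          using simplicial_complex_onD(5)[OF Lk]
          by (intro conn_flag_image[where r = "comparable (\<subseteq>)"]) (auto simp: inj_on_def link_def)
        then show ?thesis unfolding * .
      qed
      \<comment> \<open>The fiber has to be \<open>built\<close> here, since the links in
        \<open>L\<close> are only known to be connected. Subtraction is truncated, so the sum is at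
        least \<open>d\<close>.\<close>
      ultimately have "conn (card v + (d - card v)) (geo (flag ?R (Inl ` ?P \<union> Inr ` ?Q)))"
        using A by (intro conn_join) (auto intro: sympI)
      then show ?thesis by (rule conn_mono) simp
    qed
    ultimately have "conn d (geo (flag ?R (?B - {Inr v})))"
      using A U(1) T IH by (intro conn_flag_remove) (auto intro: sympI)
    moreover have "?B - {Inr v} = Inl ` U \<union> Inr ` (A - insert v T)" by auto
    ultimately show "conn d (geo (flag ?R (Inl ` U \<union> Inr ` (A - insert v T))))" by simp
  qed (use A poset_on_subsets in auto)
  then have "conn d (geo (flag ?R (Inl ` U)))" by simp
  then have "conn d (geo (flag (comparable le) (projl ` (Inl ` U :: ('p + 'v set) set))))"
    using U(1) by (intro conn_flag_image[where r = ?R]) (auto simp: inj_on_def)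
  then show ?thesis by (simp add: image_image)
qed

section \<open>Words and their traces\<close>

fun before :: "'a list \<Rightarrow> ('a \<times> 'a) set" where
  "before [] = {}"
| "before (x # xs) = {x} \<times> set xs \<union> before xs"

lemma before_append: "before (u @ v) = before u \<union> before v \<union> set u \<times> set v"
  by (induction u) auto

lemma before_subset: "before w \<subseteq> set w \<times> set w"
  by (induction w) auto

lemma before_filter: "before (filter Q w) = before w \<inter> {x. Q x} \<times> {x. Q x}"
  using before_subset by (induction w) auto

lemma before_total: "x \<in> set w \<Longrightarrow> y \<in> set w \<Longrightarrow> x \<noteq> y \<Longrightarrow> (x, y) \<in> before w \<or> (y, x) \<in> before w"
  by (induction w) auto

lemma before_asym: "distinct w \<Longrightarrow> (x, y) \<in> before w \<Longrightarrow> (y, x) \<notin> before w"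
  using before_subset by (induction w) fastforce+

lemma before_irrefl: "distinct w \<Longrightarrow> (x, y) \<in> before w \<Longrightarrow> x \<noteq> y"
  using before_asym by metis

text \<open>In a word without repetitions a subword is determined by its content, which is why the
  words below a given one form a Boolean lattice.\<close>

lemma subseq_eq_filter:
  assumes "distinct w" "subseq v w"
  shows "v = filter (\<lambda>x. x \<in> set v) w"
  using assms(2,1)
proof (induction rule: list_emb.induct)
  case (list_emb_Nil ys)
  then show ?case by simp
next
  case (list_emb_Cons xs ys y)
  have "set xs \<subseteq> set ys"
  proof
    fix x assume "x \<in> set xs"
    then show "x \<in> set ys" using list_emb_set[OF list_emb_Cons.hyps(1)] by metis
  qed
  then show ?case using list_emb_Cons by auto
next
  case (list_emb_Cons2 x y xs ys)
  then have "xs = filter (\<lambda>z. z \<in> set xs) ys" by simp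
  also have "\<dots> = filter (\<lambda>z. z \<in> set (x # xs)) ys"
    using list_emb_Cons2 by (intro filter_cong) auto
  finally show ?case using list_emb_Cons2 by simp
qed

lemma subseq_iff_filter: "distinct w \<Longrightarrow> subseq v w \<longleftrightarrow> v = filter (\<lambda>x. x \<in> set v) w"
  using subseq_eq_filter by (metis subseq_filter_left)

text \<open>The trace of a word without repetitions is its content together with an acyclic orientation
  of the graph induced on the content. Two words have the same trace iff they differ by
  commutations, and for the complete graph the trace determines the word.\<close>

definition word_trace :: "'a set set \<Rightarrow> 'a list \<Rightarrow> 'a set \<times> ('a \<times> 'a) set" where
  "word_trace E w = (set w, {(a, b) \<in> before w. {a, b} \<in> E})"

definition restr :: "'a set \<times> ('a \<times> 'a) set \<Rightarrow> 'a set \<Rightarrow> 'a set \<times> ('a \<times> 'a) set" where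
  "restr p X = (fst p \<inter> X, snd p \<inter> X \<times> X)"

text \<open>Formulated by restriction, so that \<open>X\<close> \<mapsto> \<open>restr q X\<close>
  is visibly an isomorphism from the subsets of \<open>fst q\<close> to the traces below
  \<open>q\<close>.\<close>

definition trace_le :: "'a set \<times> ('a \<times> 'a) set \<Rightarrow> 'a set \<times> ('a \<times> 'a) set \<Rightarrow> bool" where
  "trace_le p q \<longleftrightarrow> p = restr q (fst p)"

lemma fst_word_trace [simp]: "fst (word_trace E w) = set w"
  by (simp add: word_trace_def)

lemma fst_restr [simp]: "fst (restr p X) = fst p \<inter> X"
  by (simp add: restr_def)

lemma restr_restr: "restr (restr p X) Y = restr p (X \<inter> Y)"
  by (auto simp: restr_def)

lemma trace_filter: "word_trace E (filter (\<lambda>x. x \<in> X) w) = restr (word_trace E w) X"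
  by (auto simp: word_trace_def restr_def before_filter)

lemma restr_word_trace: "set w \<subseteq> X \<Longrightarrow> restr (word_trace E w) X = word_trace E w"
  using before_subset[of w] by (auto simp: word_trace_def restr_def)

lemma trace_le_fst: "trace_le p q \<Longrightarrow> fst p \<subseteq> fst q"
  unfolding trace_le_def by (metis fst_restr inf_le1)

lemma trace_le_restr:
  assumes "X \<subseteq> set w" "Y \<subseteq> set w"
  shows "trace_le (restr (word_trace E w) X) (restr (word_trace E w) Y) \<longleftrightarrow> X \<subseteq> Y"
proof
  assume "trace_le (restr (word_trace E w) X) (restr (word_trace E w) Y)"
  from trace_le_fst[OF this] show "X \<subseteq> Y" using assms by (simp add: Int_absorb1)
next
  assume "X \<subseteq> Y"
  then show "trace_le (restr (word_trace E w) X) (restr (word_trace E w) Y)"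
    using assms by (simp add: trace_le_def restr_restr Int_absorb1 Int_absorb2 Int_commute)
qed

lemma trace_le_refl: "trace_le (word_trace E u) (word_trace E u)"
  by (simp add: trace_le_def restr_word_trace)

lemma trace_le_antisym:
  assumes "trace_le (word_trace E u) (word_trace E v)" "trace_le (word_trace E v) (word_trace E u)"
  shows "word_trace E u = word_trace E v"
proof -
  have "set u = set v" using assms[THEN trace_le_fst] by simp
  then show ?thesis using assms(1) by (simp add: trace_le_def restr_word_trace)
qed

lemma trace_le_trans:
  assumes "trace_le p q" "trace_le q r"
  shows "trace_le p r"
proof -
  have "p = restr (restr r (fst q)) (fst p)" using assms by (simp add: trace_le_def)
  then show ?thesis using trace_le_fst[OF assms(1)]
    by (simp add: trace_le_def restr_restr Int_absorb1)
qed

lemma poset_on_traces: "poset_on (range (word_trace E)) trace_le"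
  unfolding poset_on_def
  by (auto simp: trace_le_refl intro: trace_le_antisym trace_le_trans)

definition compatible :: "'a rel \<Rightarrow> 'a list \<Rightarrow> bool" where
  "compatible P w \<longleftrightarrow> (\<forall>(a, b)\<in>before w. (b, a) \<notin> P)"

lemma compatible_filter: "compatible P w \<Longrightarrow> compatible P (filter Q w)"
  by (auto simp: compatible_def before_filter)

text \<open>Put \<open>y\<close> in front of the first letter \<open>z0\<close> that has to follow
  it. A later letter that has to precede \<open>y\<close> would have to precede \<open>z0\<close> by
  transitivity, which contradicts compatibility.\<close>

lemma word_insert:
  assumes "trans P" "antisym P" "distinct w" "compatible P w" "y \<notin> set w"
  obtains u v where "w = u @ v" "compatible P (u @ y # v)"
proof
  let ?u = "takeWhile (\<lambda>z. (y, z) \<notin> P) w" and ?v = "dropWhile (\<lambda>z. (y, z) \<notin> P) w"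
  show w: "w = ?u @ ?v" by simp
  have u: "(y, z) \<notin> P" if "z \<in> set ?u" for z using that by (auto dest: set_takeWhileD)
  have v: "(z, y) \<notin> P" if zv: "z \<in> set ?v" for z
  proof
    assume zy: "(z, y) \<in> P"
    obtain z0 s where z0: "?v = z0 # s" using zv by (cases ?v) auto
    then have y0: "(y, z0) \<in> P" using hd_dropWhile[of "\<lambda>z. (y, z) \<notin> P" w] by auto
    have "(z, z0) \<in> P" using assms(1) zy y0 by (rule transD)
    moreover have "z \<noteq> z0"
    proof
      assume "z = z0"
      then have "z0 = y" using antisymD[OF assms(2)] zy y0 by blast
      then show False using assms(5) z0 w by (metis in_set_conv_decomp set_dropWhileD)
    qed
    then have "(z0, z) \<in> before w" using that z0 by (subst w) (auto simp: before_append)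
    ultimately show False using assms(4) by (auto simp: compatible_def)
  qed
  have "before w = before ?u \<union> before ?v \<union> set ?u \<times> set ?v"
    using before_append[of ?u ?v] by simp
  then have "before (?u @ y # ?v) = before w \<union> set ?u \<times> {y} \<union> {y} \<times> set ?v"
    by (auto simp: before_append)
  then show "compatible P (?u @ y # ?v)" using assms(4) u v by (auto simp: compatible_def)
qed

text \<open>Repeated insertion. Through it, every trace on some letters of \<open>W\<close> becomes
  a restriction of a trace on all of \<open>W\<close>, that is, a face of a facet of the
  fiber.\<close>

lemma word_extend:
  assumes "trans P" "antisym P" "distinct w" "compatible P w" "finite W" "set w \<subseteq> W"
  shows "\<exists>w'. distinct w' \<and> set w' = W \<and> compatible P w' \<and> filter (\<lambda>x. x \<in> set w) w' = w"
proof -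
  have "\<exists>w'. distinct w' \<and> set w' = set w \<union> D \<and> compatible P w' \<and> filter (\<lambda>x. x \<in> set w) w' = w"
    if "finite D" "D \<inter> set w = {}" for D
    using that
  proof (induction D rule: finite_induct)
    case empty
    then show ?case using assms by (intro exI[of _ w]) auto
  next
    case (insert y D)
    then obtain w' where w': "distinct w'" "set w' = set w \<union> D" "compatible P w'" "filter (\<lambda>x. x \<in> set w) w' = w"
      by auto
    have "y \<notin> set w'" using insert w'(2) by auto
    then obtain u v where uv: "w' = u @ v" "compatible P (u @ y # v)"
      using word_insert[OF assms(1,2) w'(1,3)] by blast
    then show ?case using w' \<open>y \<notin> set w'\<close> insert.prems by (intro exI[of _ "u @ y # v"]) auto
  qed
  from this[of "W - set w"] show ?thesis using assms(5,6) by (simp add: Un_absorb1) (metis Diff_disjoint Int_commute)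
qed

section \<open>Lexicographic comparison of numbered words\<close>

lemma map_less_map:
  fixes num :: "'a \<Rightarrow> nat"
  shows "num y < num x \<Longrightarrow> map num (p @ y # s') < map num (p @ x # s)"
  by (induction p) auto

lemma map_less_mapD:
  fixes num :: "'a \<Rightarrow> nat"
  assumes "map num w' < map num w" "length w' = length w" "inj_on num (set w' \<union> set w)"
  obtains p x y s s' where "w = p @ x # s" "w' = p @ y # s'" "num y < num x"
proof -
  have "\<exists>p x y s s'. w = p @ x # s \<and> w' = p @ y # s' \<and> num y < num x"
    using assms
  proof (induction w' arbitrary: w)
    case Nil
    then show ?case by simp
  next
    case (Cons a w')
    then obtain b v where w: "w = b # v" by (cases w) auto
    show ?case
    proof (cases "num a < num b")
      case True
      then show ?thesis using w by (intro exI[of _ "[]"]) auto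
    next
      case False
      then have ab: "num a = num b" and less: "map num w' < map num v" using Cons.prems(1) w by auto
      have "a = b" using inj_onD[OF Cons.prems(3) ab] w by simp
      obtain p x y s s' where "v = p @ x # s" "w' = p @ y # s'" "num y < num x"
        using Cons.IH[OF less] Cons.prems(2,3) w by (auto intro: inj_on_subset)
      then show ?thesis using w \<open>a = b\<close> by (intro exI[of _ "b # p"]) auto
    qed
  qed
  then show thesis using that by blast
qed

section \<open>Shelling the traces on a fixed set of letters\<close>

lemma restr_eq_iff:
  "restr (word_trace E w) X = restr (word_trace E w') X \<longleftrightarrow> set w \<inter> X = set w' \<inter> X \<and>
     (\<forall>a\<in>X. \<forall>b\<in>X. {a, b} \<in> E \<longrightarrow> ((a, b) \<in> before w \<longleftrightarrow> (a, b) \<in> before w'))"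
  by (auto simp: restr_def word_trace_def set_eq_iff)

text \<open>The shelling condition for the lexicographic order, with respect to letters numbered by \<open>num\<close>
  along a linear extension of \<open>P\<close>. Let \<open>y\<close> be the letter of \<open>w'\<close> at the first difference of \<open>w\<close>
  and \<open>w'\<close>, and \<open>x\<close> the letter of \<open>w\<close>, so that \<open>w = p @ t @ y # s\<close> where \<open>t\<close> starts with \<open>x\<close>. If
  \<open>y\<close> is not in \<open>X\<close>, it can be moved in front of \<open>t\<close>. Otherwise the last letter \<open>z\<close> of \<open>t\<close> adjacent
  to \<open>y\<close> is not in \<open>X\<close>. If \<open>z\<close> is larger than \<open>y\<close>, exchange them; else the smallest letter of
  \<open>t\<close> outside \<open>X\<close> is smaller than \<open>x\<close> and can be moved in front of \<open>t\<close>.\<close>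

lemma trace_shelling:
  fixes num :: "'a \<Rightarrow> nat"
  assumes E: "(\<forall>a b. a \<noteq> b \<longrightarrow> {a, b} \<in> E) \<or> P \<subseteq> Id"
    and inj: "inj_on num W" and mono: "\<And>a b. a \<in> W \<Longrightarrow> b \<in> W \<Longrightarrow> (a, b) \<in> P \<Longrightarrow> a \<noteq> b \<Longrightarrow> num a < num b"
    and w: "distinct w" "set w = W" "compatible P w"
    and w': "distinct w'" "set w' = W" "compatible P w'" "map num w' < map num w"
    and X: "restr (word_trace E w') X = restr (word_trace E w) X"
    and new: "\<And>v. distinct v \<Longrightarrow> set v = W \<Longrightarrow> compatible P v \<Longrightarrow> map num v < map num w \<Longrightarrow> word_trace E v \<noteq> word_trace E w"
  shows "\<exists>a\<in>W - X. \<exists>v. distinct v \<and> set v = W \<and> compatible P v \<and> map num v < map num w \<and>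
    restr (word_trace E v) (W - {a}) = restr (word_trace E w) (W - {a})"
proof -
  have "length w' = length w" using w w' by (metis distinct_card)
  then obtain p x y s0 s' where d: "w = p @ x # s0" "w' = p @ y # s'" "num y < num x"
    using map_less_mapD[OF w'(4)] inj w w' by (metis Un_absorb)
  have "y \<in> set s0" using d w w' by auto
  then obtain s1 s where s0: "s0 = s1 @ y # s" by (meson split_list)
  define t where "t = x # s1"
  have wt: "w = p @ t @ y # s" using d s0 by (simp add: t_def)
  have dist: "distinct (p @ t @ y # s)" using w(1) wt by simp
  have tW: "set t \<subseteq> W" "y \<in> W" using w(2) wt by auto
  have yt: "(y, z) \<in> before w'" if "z \<in> set t" for z
  proof -
    have "z \<in> set w'" "z \<notin> set p" "z \<noteq> y" using that tW w' dist by auto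
    then have "z \<in> set s'" using d by auto
    then show ?thesis using d by (simp add: before_append)
  qed
  have tyP: "(z, y) \<notin> P" if "z \<in> set t" for z using yt[OF that] w'(3) by (auto simp: compatible_def)
  have bw: "before w = before p \<union> before t \<union> before s \<union> set p \<times> set t \<union> set p \<times> insert y (set s)
      \<union> set t \<times> insert y (set s) \<union> {y} \<times> set s"
    unfolding wt by (auto simp: before_append)
  let ?good = "\<lambda>v. distinct v \<and> set v = W \<and> compatible P v \<and> map num v < map num w"
  have front: "?good (p @ y # t @ s)"
  proof (intro conjI)
    show "distinct (p @ y # t @ s)" "set (p @ y # t @ s) = W" using dist w(2) wt by auto
    have "before (p @ y # t @ s) \<subseteq> before w \<union> {y} \<times> set t" unfolding bw by (auto simp: before_append)
    then show "compatible P (p @ y # t @ s)" using w(3) tyP by (fastforce simp: compatible_def)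
    show "map num (p @ y # t @ s) < map num w" unfolding wt t_def using map_less_map[of num, OF d(3), of p "(x # s1) @ s" "s1 @ y # s"] by simp
  qed
  show ?thesis
  proof (cases "y \<in> X")
    case False
    have "restr (word_trace E (p @ y # t @ s)) (W - {y}) = restr (word_trace E w) (W - {y})"
      unfolding restr_eq_iff bw wt by (auto simp: before_append)
    then show ?thesis using front False tW by blast
  next
    case True
    \<comment> \<open>Otherwise \<open>y\<close> commutes with all of \<open>t\<close>, and moving
      it to the front gives an earlier word with the same trace, against \<open>new\<close>.\<close>
    have "\<exists>z\<in>set t. {z, y} \<in> E"
    proof (rule ccontr)
      assume "\<not> ?thesis"
      then have "word_trace E (p @ y # t @ s) = word_trace E w"
        unfolding word_trace_def bw wt by (auto simp: before_append insert_commute)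
      then show False using new front by blast
    qed
    then obtain t1 z t2 where t: "t = t1 @ z # t2" "{z, y} \<in> E" "\<And>z'. z' \<in> set t2 \<Longrightarrow> {z', y} \<notin> E"
      using split_list_last_prop[of t "\<lambda>z. {z, y} \<in> E"] by blast
    \<comment> \<open>In \<open>w'\<close> the letter \<open>y\<close> precedes all of
      \<open>t\<close>, in \<open>w\<close> it follows. For a neighbour of \<open>y\<close> this
      difference is visible in the trace, so the neighbour cannot lie in \<open>X\<close>, where the
      traces agree.\<close>
    have notX: "z' \<notin> X" if "z' \<in> set t" "{z', y} \<in> E" for z'
    proof
      assume "z' \<in> X"
      have "(z', y) \<in> before w" using that(1) unfolding bw by auto
      then have "(z', y) \<in> before w'" using X \<open>z' \<in> X\<close> True that(2) unfolding restr_eq_iff by blast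
      then show False using before_asym[OF w'(1)] yt[OF that(1)] by blast
    qed
    have z: "z \<notin> X" "z \<in> set t" using notX t by auto
    show ?thesis
    proof (cases "num y < num z")
      case True
      let ?v = "p @ t1 @ y # z # t2 @ s"
      have sub: "before ?v \<subseteq> before w \<union> {y} \<times> set t" unfolding bw t(1) by (auto simp: before_append)
      have "?good ?v"
      proof (intro conjI)
        show "distinct ?v" "set ?v = W" using dist w(2) wt t(1) by auto
        show "compatible P ?v" using sub w(3) tyP by (fastforce simp: compatible_def)
        show "map num ?v < map num w" unfolding wt t(1) 
          using map_less_map[of num, OF True, of "p @ t1" "z # t2 @ s" "t2 @ y # s"] by simp
      qed
      moreover have "restr (word_trace E ?v) (W - {z}) = restr (word_trace E w) (W - {z})"
        unfolding restr_eq_iff bw wt t(1) using t(3) by (auto simp: before_append insert_commute)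
      ultimately show ?thesis using z tW by blast
    next
      case False
      have "z \<noteq> y" using z(2) dist by auto
      then have zy: "num z < num y" using False inj z(2) tW by (metis inj_onD linorder_neqE_nat subsetD)
      \<comment> \<open>Since \<open>z\<close> competes for the minimum,
        \<open>num a \<le> num z < num y < num x\<close>: moving \<open>a\<close> to the front
        lowers the word, and \<open>a\<close> is not the first letter of \<open>t\<close>.\<close>
      obtain a where a: "a \<in> set t - X" "\<And>b. b \<in> set t - X \<Longrightarrow> num a \<le> num b"
        using z arg_min_nat_lemma[of "\<lambda>b. b \<in> set t - X" z num] by blast
      have ax: "num a < num x" using a(2)[of z] z zy d(3) by simp
      obtain t3 t4 where t34: "t = t3 @ a # t4" using a(1) by (meson DiffD1 split_list)
      have "t3 \<noteq> []" using t34 ax by (auto simp: t_def)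
      then obtain t3' where t3: "t3 = x # t3'" using t34 by (cases t3) (auto simp: t_def)
      let ?v = "p @ a # t3 @ t4 @ y # s"
      \<comment> \<open>The one place where the alternative \<open>E\<close> is used. If the graph
        is complete, all of \<open>t\<close> is adjacent to \<open>y\<close> and thus outside
        \<open>X\<close>, so the minimality of \<open>num a\<close> rules out a letter that has to
        precede \<open>a\<close>.\<close>
      have aP: "(b, a) \<notin> P" if b: "b \<in> set t3" for b
      proof
        assume ba: "(b, a) \<in> P"
        have ab: "a \<noteq> b" using b dist t34 by auto
        show False
          using E
        proof
          assume "P \<subseteq> Id"
          then show False using ba ab by auto
        next
          assume "\<forall>a b. a \<noteq> b \<longrightarrow> {a, b} \<in> E"
          moreover have "b \<noteq> y" "b \<in> set t" using b dist t34 by auto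
          ultimately have "b \<in> set t - X" using notX by blast
          then have "num a \<le> num b" by (rule a(2))
          moreover have "num b < num a" using mono[of b a] ba ab tW b t34 by auto
          ultimately show False by simp
        qed
      qed
      have sub: "before ?v \<subseteq> before w \<union> {a} \<times> set t3" unfolding bw t34 by (auto simp: before_append)
      have "?good ?v"
      proof (intro conjI)
        show "distinct ?v" "set ?v = W" using dist w(2) wt t34 by auto
        show "compatible P ?v" using sub w(3) aP by (fastforce simp: compatible_def)
        show "map num ?v < map num w" unfolding wt t34 t3 
          using map_less_map[of num, OF ax, of p "(x # t3') @ t4 @ y # s" "t3' @ a # t4 @ y # s"] by simp
      qed
      moreover have "restr (word_trace E ?v) (W - {a}) = restr (word_trace E w) (W - {a})"
        unfolding restr_eq_iff bw wt t34 by (auto simp: before_append)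
      ultimately show ?thesis using a(1) tW by blast
    qed
  qed
qed

text \<open>The part of a new facet that is already present in a shelling step. It is a punctured
  Boolean interval if \<open>R\<close> is everything; otherwise adjoining a letter outside
  \<open>R\<close> contracts it.\<close>

lemma built_not_above:
  assumes "finite W" "C \<subseteq> W" "R \<subseteq> W - C" "R \<noteq> {}"
  shows "built (comparable (\<subseteq>)) (card (W - C) - 1) {X. C \<subset> X \<and> X \<subseteq> W \<and> \<not> R \<subseteq> X}"
proof (cases "R = W - C")
  case True
  then have "{X. C \<subset> X \<and> X \<subseteq> W \<and> \<not> R \<subseteq> X} = {X. C \<subset> X \<and> X \<subset> W}" using assms(2) by blast
  then show ?thesis using built_open_interval[OF assms(1,2)] by simp
next
  case False
  then obtain x where x: "x \<in> W" "x \<notin> C" "x \<notin> R" using assms(3) by blast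
  show ?thesis
  proof (rule built_conical[where e = "insert x" and p = "insert x C"])
    show "finite {X. C \<subset> X \<and> X \<subseteq> W \<and> \<not> R \<subseteq> X}"
      using assms(1) by (auto intro: finite_subset[of _ "Pow W"])
    show "insert x C \<in> {X. C \<subset> X \<and> X \<subseteq> W \<and> \<not> R \<subseteq> X}" using x assms by auto
    show "insert x X \<in> {X. C \<subset> X \<and> X \<subseteq> W \<and> \<not> R \<subseteq> X}"
      if "X \<in> {X. C \<subset> X \<and> X \<subseteq> W \<and> \<not> R \<subseteq> X}" for X using that x by auto
  qed (auto simp: poset_on_subsets)
qed

lemma ex_numbering:
  assumes "distinct w"
  shows "\<exists>num :: 'a \<Rightarrow> nat. inj_on num (set w) \<and> (\<forall>(a, b)\<in>before w. num a < num b)"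
  using assms
proof (induction w)
  case Nil
  then show ?case by simp
next
  case (Cons x w)
  then obtain num :: "'a \<Rightarrow> nat" where num: "inj_on num (set w)" "\<forall>(a, b)\<in>before w. num a < num b" by auto
  define num' where "num' = (\<lambda>z. if z = x then 0 else Suc (num z))"
  have "inj_on num' (set (x # w))" using num(1) Cons.prems by (auto simp: inj_on_def num'_def)
  moreover have "\<forall>(a, b)\<in>before (x # w). num' a < num' b"
    using num(2) Cons.prems before_subset[of w] by (auto simp: num'_def)
  ultimately show ?case by blast
qed

text \<open>The facets are the traces of full words on \<open>W\<close>. They are attached in
  lexicographic order, each with all its restrictions that properly contain the letters of
  \<open>c\<close>. A word whose trace has already occurred contributes nothing. For a new one the
  part present before is described by a single set \<open>R\<close> of letters, the analogue of the
  restriction set of a shelling.\<close>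

theorem built_traces:
  assumes P: "trans P" "antisym P" and E: "(\<forall>a b. a \<noteq> b \<longrightarrow> {a, b} \<in> E) \<or> P \<subseteq> Id"
    and W: "finite W" "set c \<subseteq> W" and c: "distinct c" "compatible P c"
  shows "built (comparable trace_le) (card (W - set c))
    {word_trace E w |w. distinct w \<and> compatible P w \<and> set c \<subset> set w \<and> set w \<subseteq> W \<and>
       restr (word_trace E w) (set c) = word_trace E c}" (is "built _ _ ?U")
proof (cases "set c = W")
  case True
  then have U: "?U = {}" by auto
  show ?thesis unfolding U using True by (simp add: built_0)
next
  case False
  let ?C = "set c"
  have CW: "?C \<subset> W" using W(2) False by auto
  obtain w0 where w0: "distinct w0" "set w0 = W" "compatible P w0"
    using word_extend[OF P, of "[]" W] W(1) by (auto simp: compatible_def)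
  obtain num :: "'a \<Rightarrow> nat" where num: "inj_on num W" "\<forall>(a, b)\<in>before w0. num a < num b"
    using ex_numbering[OF w0(1)] w0(2) by auto
  have mono: "num a < num b" if "a \<in> W" "b \<in> W" "(a, b) \<in> P" "a \<noteq> b" for a b
    using before_total[of a w0 b] that w0 num(2) by (auto simp: compatible_def)
  define Ws where "Ws = {w. distinct w \<and> set w = W \<and> compatible P w \<and> restr (word_trace E w) ?C = word_trace E c}"
  have WsD: "distinct w" "set w = W" "compatible P w" "restr (word_trace E w) ?C = word_trace E c" if "w \<in> Ws" for w
    using that by (auto simp: Ws_def)
  have "finite Ws" using finite_subset_distinct[OF W(1)] by (rule finite_subset[rotated]) (auto simp: Ws_def)
  \<comment> \<open>The subposet generated by the words in \<open>S\<close>, without the bottom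
    element, the trace of \<open>c\<close>.\<close>
  define below where "below = (\<lambda>S. {restr (word_trace E w) X |w X. w \<in> S \<and> ?C \<subset> X \<and> X \<subseteq> W})"
  have key_inj: "w = w'" if "w \<in> Ws" "w' \<in> Ws" "map num w = map num w'" for w w'
    using that WsD num(1) by (metis inj_on_map_eq_map sup.idem)
  have finite_below: "finite (below S)" if "finite S" for S
  proof -
    have "below S \<subseteq> (\<lambda>(w, X). restr (word_trace E w) X) ` (S \<times> Pow W)" by (auto simp: below_def)
    then show ?thesis using that W(1) by (meson finite_Pow_iff finite_SigmaI finite_imageI finite_subset)
  qed
  have "built (comparable trace_le) (card (W - ?C)) (below S)"
    if "finite S" "S \<subseteq> Ws" "\<And>w w'. w \<in> S \<Longrightarrow> w' \<in> Ws \<Longrightarrow> map num w' < map num w \<Longrightarrow> w' \<in> S" "S \<noteq> {}" for S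
    using that
  proof (induction S rule: finite_ranking_induct[where f = "map num"])
    case empty
    then show ?case by simp
  next
    case (insert w S)
    show ?case
    proof (cases "w \<in> S")
      case True
      then show ?thesis using insert by (simp add: insert_absorb)
    next
      case wS: False
      have wWs: "w \<in> Ws" and SWs: "S \<subseteq> Ws" using insert.prems by auto
      note w = WsD[OF wWs]
      have less: "map num w' < map num w" if "w' \<in> S" for w'
      proof -
        have "map num w' \<le> map num w" using insert.hyps(2) that by blast
        moreover have "w' \<noteq> w" using that wS by auto
        ultimately show ?thesis using key_inj that SWs wWs by (metis order_le_less subsetD)
      qed
      have down: "w'' \<in> S" if "w' \<in> S" "w'' \<in> Ws" "map num w'' < map num w'" for w' w''
        using insert.prems(2)[of w' w''] that less[OF that(1)] by auto
      have earlier: "w' \<in> S" if "w' \<in> Ws" "map num w' < map num w" for w'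
        using insert.prems(2)[of w w'] that by auto
      define \<rho> where "\<rho> = restr (word_trace E w)"
      have \<rho>_fst: "fst (\<rho> X) = X" if "X \<subseteq> W" for X using that w(2) by (auto simp: \<rho>_def)
      have \<rho>_inj: "inj_on \<rho> {X. X \<subseteq> W}" by (metis (mono_tags, lifting) \<rho>_fst inj_onI mem_Collect_eq)
      have \<rho>_le: "trace_le (\<rho> X) (\<rho> Y) \<longleftrightarrow> X \<subseteq> Y" if "X \<subseteq> W" "Y \<subseteq> W" for X Y
        unfolding \<rho>_def using that w(2) by (intro trace_le_restr) auto
      have below_insert: "below (insert w S) = below S \<union> \<rho> ` {X. ?C \<subset> X \<and> X \<subseteq> W}"
        by (auto simp: below_def \<rho>_def)
      show ?thesis
      proof (cases "S = {}")
        case True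
        have "\<rho> W \<in> below (insert w S)" unfolding below_insert using CW by blast
        moreover have "trace_le x (\<rho> W)" if x: "x \<in> below (insert w S)" for x
        proof -
          have "below S = {}" using True by (simp add: below_def)
          then obtain X where "X \<subseteq> W" "x = \<rho> X" using x below_insert by auto
          then show ?thesis using \<rho>_le[of X W] by simp
        qed
        ultimately show ?thesis using finite_below[of "insert w S"] insert.hyps(1)
          by (intro built_cone[of _ "\<rho> W"]) auto
      next
        case S: False
        then have IH: "built (comparable trace_le) (card (W - ?C)) (below S)"
          using insert.IH SWs down by blast
        show ?thesis
        proof (cases "\<exists>w'\<in>S. word_trace E w' = word_trace E w")
          case True
          then obtain w' where w': "w' \<in> S" "word_trace E w' = word_trace E w" by blast
          have "\<rho> X \<in> below S" if "?C \<subset> X" "X \<subseteq> W" for X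
            unfolding below_def \<rho>_def w'(2)[symmetric] using that w'(1) by blast
          then have "below (insert w S) = below S" using below_insert by blast
          then show ?thesis using IH by simp
        next
          case new: False
          define J where "J = {X. ?C \<subseteq> X \<and> X \<subseteq> W \<and> (\<exists>w'\<in>S. restr (word_trace E w') X = \<rho> X)}"
          define R where "R = {a \<in> W - ?C. W - {a} \<in> J}"
          have shell: "\<exists>a\<in>W - X. W - {a} \<in> J" if X: "X \<in> J" for X
          proof -
            obtain w' where w': "w' \<in> S" "restr (word_trace E w') X = restr (word_trace E w) X"
              and CX: "?C \<subseteq> X" using X by (auto simp: J_def \<rho>_def)
            note w'D = WsD[OF subsetD[OF SWs w'(1)]]
            have CWs: "restr (word_trace E v) ?C = word_trace E c"
              if "restr (word_trace E v) Y = restr (word_trace E w) Y" "?C \<subseteq> Y" for v Y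
            proof -
              have "restr (restr (word_trace E v) Y) ?C = restr (restr (word_trace E w) Y) ?C" using that by simp
              then show ?thesis using that(2) w(4) by (simp add: restr_restr Int_absorb1)
            qed
            have "\<exists>a\<in>W - X. \<exists>v. distinct v \<and> set v = W \<and> compatible P v \<and> map num v < map num w \<and>
                restr (word_trace E v) (W - {a}) = restr (word_trace E w) (W - {a})"
            proof (rule trace_shelling[OF E num(1) mono w(1-3) w'D(1-3) less[OF w'(1)] w'(2)])
              fix v assume v: "distinct v" "set v = W" "compatible P v" "map num v < map num w"
              show "word_trace E v \<noteq> word_trace E w"
              proof
                assume eq: "word_trace E v = word_trace E w"
                then have "v \<in> Ws" using v w(4) by (simp add: Ws_def)
                then show False using earlier v(4) new eq by blast
              qed
            qed
            then obtain a v where av: "a \<in> W - X" "distinct v" "set v = W" "compatible P v" "map num v < map num w"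
                "restr (word_trace E v) (W - {a}) = restr (word_trace E w) (W - {a})" by blast
            have Ca: "?C \<subseteq> W - {a}" using av(1) CX W(2) by auto
            then have "v \<in> Ws" using av CWs[OF av(6)] by (simp add: Ws_def)
            then have "v \<in> S" using earlier av(5) by blast
            then have "W - {a} \<in> J" using av(6) Ca by (auto simp: J_def \<rho>_def)
            then show ?thesis using av(1) by blast
          qed
          have J_down: "Y \<in> J" if asm: "X \<in> J" "Y \<subseteq> X" "?C \<subseteq> Y" for X Y
          proof -
            obtain w' where w': "w' \<in> S" "restr (word_trace E w') X = restr (word_trace E w) X" "X \<subseteq> W"
              using asm(1) by (auto simp: J_def \<rho>_def)
            then have "restr (restr (word_trace E w') X) Y = restr (restr (word_trace E w) X) Y" by simp
            then have "restr (word_trace E w') Y = \<rho> Y" using asm(2) by (simp add: restr_restr Int_absorb1 \<rho>_def)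
            then show ?thesis using w' asm by (auto simp: J_def)
          qed
          \<comment> \<open>The shelling condition enlarges any member of \<open>J\<close> to one of
            the form \<open>W - {a}\<close>, and \<open>J\<close> is closed under passing to smaller
            sets above \<open>?C\<close>. So \<open>J\<close> is generated by these coatoms.\<close>
          have J_iff: "X \<in> J \<longleftrightarrow> \<not> R \<subseteq> X" if "?C \<subseteq> X" "X \<subseteq> W" for X
          proof
            assume "X \<in> J"
            then obtain a where "a \<in> W - X" "W - {a} \<in> J" using shell by blast
            then show "\<not> R \<subseteq> X" using that by (auto simp: R_def)
          next
            assume "\<not> R \<subseteq> X"
            then obtain a where "a \<in> R" "a \<notin> X" by blast
            then show "X \<in> J" using J_down[of "W - {a}" X] that by (auto simp: R_def)
          qed
          have CJ: "?C \<in> J" using S W(2) WsD(4) SWs w(4) by (auto simp: J_def \<rho>_def)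
          have RW: "R \<subseteq> W - ?C" by (auto simp: R_def)
          have R0: "R \<noteq> {}" using J_iff[of ?C] CJ W(2) by auto
          have old: "\<rho> X \<in> below S \<longleftrightarrow> X \<in> J" if "?C \<subset> X" "X \<subseteq> W" for X
          proof
            assume "\<rho> X \<in> below S"
            then obtain w' Y where Y: "w' \<in> S" "\<rho> X = restr (word_trace E w') Y" "Y \<subseteq> W" by (auto simp: below_def)
            have "Y = X" using \<rho>_fst[OF that(2)] Y WsD(2)[of w'] SWs by auto
            then show "X \<in> J" using Y that by (auto simp: J_def)
          next
            assume "X \<in> J"
            then obtain w' where "w' \<in> S" "restr (word_trace E w') X = \<rho> X" by (auto simp: J_def)
            then show "\<rho> X \<in> below S" using that unfolding below_def by (metis (mono_tags, lifting) mem_Collect_eq)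
          qed
          \<comment> \<open>A new trace is never below an old one, so its old neighbours are all
            below it.\<close>
          have above: "X \<in> J" if asm: "u \<in> below S" "trace_le (\<rho> X) u" "?C \<subset> X" "X \<subseteq> W" for X u
          proof -
            obtain w' Y where Y: "w' \<in> S" "u = restr (word_trace E w') Y" using asm(1) by (auto simp: below_def)
            have XY: "X \<subseteq> Y" using trace_le_fst[OF asm(2)] \<rho>_fst[OF asm(4)] Y by auto
            have "\<rho> X = restr u X" using asm(2) \<rho>_fst[OF asm(4)] by (simp add: trace_le_def)
            then have "\<rho> X = restr (word_trace E w') X" using Y XY by (simp add: restr_restr Int_absorb1)
            then show ?thesis using Y(1) asm by (auto simp: J_def)
          qed
          have WJ: "W \<notin> J" using J_iff[of W] W(2) RW by auto
          define N where "N = {X. ?C \<subset> X \<and> X \<subseteq> W \<and> R \<subseteq> X}"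
          have "finite N" using W(1) by (auto simp: N_def intro: finite_subset[of _ "Pow W"])
          \<comment> \<open>The top of the new facet comes before the other new elements. Its
            neighbourhood at that moment is exactly the old part of the facet, certified one step
            lower by \<open>built_not_above\<close>.\<close>
          have top: "built (comparable trace_le) (card (W - ?C)) (insert (\<rho> W) (below S))"
          proof (rule built_add[of "\<rho> W"])
            have "\<rho> W \<notin> below S" using old[of W] CW WJ by blast
            then show "built (comparable trace_le) (card (W - ?C)) (insert (\<rho> W) (below S) - {\<rho> W})"
              using IH by simp
            have "{x \<in> insert (\<rho> W) (below S). x \<noteq> \<rho> W \<and> comparable trace_le (\<rho> W) x}
                = \<rho> ` {X. ?C \<subset> X \<and> X \<subseteq> W \<and> \<not> R \<subseteq> X}" (is "?L = ?M")
            proof (intro set_eqI iffI)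
              fix u assume u: "u \<in> ?L"
              then have uS: "u \<in> below S" by auto
              have "\<not> trace_le (\<rho> W) u" using above[OF uS] CW WJ by blast
              then have le: "trace_le u (\<rho> W)" using u by auto
              obtain w' Y where Y: "w' \<in> S" "u = restr (word_trace E w') Y" "?C \<subset> Y" "Y \<subseteq> W"
                using uS by (auto simp: below_def)
              have fu: "fst u = Y" using Y WsD(2)[of w'] SWs by auto
              have "u = \<rho> Y" using le Y(4) unfolding trace_le_def fu by (simp add: \<rho>_def restr_restr Int_absorb1)
              then show "u \<in> ?M" using uS old[OF Y(3,4)] J_iff[of Y] Y(3,4) by auto
            next
              fix u assume "u \<in> ?M"
              then obtain X where X: "u = \<rho> X" "?C \<subset> X" "X \<subseteq> W" "\<not> R \<subseteq> X" by auto
              have XJ: "X \<in> J" using J_iff[of X] X by auto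
              then have "u \<in> below S" using old[OF X(2,3)] X(1) by simp
              moreover have "u \<noteq> \<rho> W" using XJ WJ X \<rho>_fst by (metis order_refl)
              moreover have "trace_le u (\<rho> W)" using \<rho>_le[of X W] X by simp
              ultimately show "u \<in> ?L" by simp
            qed
            moreover have "built (comparable trace_le) (card (W - ?C) - 1) ?M"
            proof (rule built_image[OF built_not_above[OF W RW R0]])
              show "inj_on \<rho> {X. ?C \<subset> X \<and> X \<subseteq> W \<and> \<not> R \<subseteq> X}"
                using \<rho>_inj by (rule inj_on_subset) auto
            qed (simp add: \<rho>_le)
            ultimately show "built (comparable trace_le) (card (W - ?C) - 1)
              {x \<in> insert (\<rho> W) (below S). x \<noteq> \<rho> W \<and> comparable trace_le (\<rho> W) x}" by simp
          qed simp
          \<comment> \<open>All neighbours of a further new element lie below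
            \<open>\<rho> W\<close>: old ones are below the element itself, and the others are
            restrictions of \<open>w\<close>. So each addition is along a cone with apex
            \<open>\<rho> W\<close>.\<close>
          have rest: "built (comparable trace_le) (card (W - ?C)) (insert (\<rho> W) (below S) \<union> \<rho> ` T)"
            if "finite T" "T \<subseteq> N" for T
            using that
          proof (induction T rule: finite_induct)
            case empty
            then show ?case using top by simp
          next
            case (insert X T)
            let ?A = "insert (\<rho> W) (below S) \<union> \<rho> ` T"
            have IH': "built (comparable trace_le) (card (W - ?C)) ?A" using insert by simp
            have X: "?C \<subset> X" "X \<subseteq> W" "X \<notin> J" using insert.prems J_iff[of X] by (auto simp: N_def)
            have eq: "insert (\<rho> W) (below S) \<union> \<rho> ` insert X T = insert (\<rho> X) ?A" by auto
            show ?case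
            proof (cases "\<rho> X \<in> ?A")
              case True
              then show ?thesis using IH' unfolding eq by (simp only: insert_absorb)
            next
              case notin: False
              let ?Nb = "{u \<in> insert (\<rho> X) ?A. u \<noteq> \<rho> X \<and> comparable trace_le (\<rho> X) u}"
              have "trace_le (\<rho> X) (\<rho> W)" using \<rho>_le[of X W] X by simp
              then have apex: "\<rho> W \<in> ?Nb" using notin by auto
              have Nb: "built (comparable trace_le) (card (W - ?C) - 1) ?Nb"
              proof (rule built_cone[OF _ apex])
                show "finite ?Nb" using built_finite[OF IH'] by simp
                fix u assume u: "u \<in> ?Nb"
                have "trace_le u (\<rho> W)"
                proof (cases "u \<in> below S")
                  case True
                  then have "\<not> trace_le (\<rho> X) u" using above X by blast
                  then have "trace_le u (\<rho> X)" using u by auto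
                  then show ?thesis using \<open>trace_le (\<rho> X) (\<rho> W)\<close> by (rule trace_le_trans)
                next
                  case False
                  then have "u = \<rho> W \<or> u \<in> \<rho> ` T" using u by blast
                  moreover have "\<And>Y. Y \<in> T \<Longrightarrow> Y \<subseteq> W" using insert.prems unfolding N_def by blast
                  ultimately obtain Y where "Y \<subseteq> W" "u = \<rho> Y" by blast
                  then show ?thesis using \<rho>_le[of Y W] by simp
                qed
                then show "comparable trace_le (\<rho> W) u" by simp
              qed
              have "insert (\<rho> X) ?A - {\<rho> X} = ?A" using notin by (rule Diff_insert_absorb)
              then have "built (comparable trace_le) (card (W - ?C)) (insert (\<rho> X) ?A - {\<rho> X})"
                using IH' by (simp only:)
              then show ?thesis unfolding eq using Nb by (rule built_add[OF insertI1])
            qed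
          qed
          have "below (insert w S) = insert (\<rho> W) (below S) \<union> \<rho> ` N"
          proof -
            have "\<rho> X \<in> below S" if "?C \<subset> X" "X \<subseteq> W" "\<not> R \<subseteq> X" for X
              using old[OF that(1,2)] J_iff[of X] that by auto
            then have "\<rho> ` {X. ?C \<subset> X \<and> X \<subseteq> W} \<subseteq> below S \<union> \<rho> ` N" unfolding N_def by blast
            moreover have "\<rho> ` N \<subseteq> \<rho> ` {X. ?C \<subset> X \<and> X \<subseteq> W}" unfolding N_def by blast
            moreover have "W \<in> N" using CW RW unfolding N_def by blast
            ultimately show ?thesis unfolding below_insert by blast
          qed
          then show ?thesis using rest[OF \<open>finite N\<close>] by simp
        qed
      qed
    qed
  qed
  moreover have "Ws \<noteq> {}"
  proof -
    obtain w where w: "distinct w" "set w = W" "compatible P w" "filter (\<lambda>x. x \<in> ?C) w = c"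
      using word_extend[OF P c W] by blast
    then have "restr (word_trace E w) ?C = word_trace E c" using trace_filter[of E ?C w] by simp
    then show ?thesis using w by (auto simp: Ws_def)
  qed
  ultimately have "built (comparable trace_le) (card (W - ?C)) (below Ws)"
    using \<open>finite Ws\<close> by blast
  moreover have "below Ws = ?U"
  proof (intro set_eqI iffI)
    fix u assume "u \<in> below Ws"
    then obtain w X where w: "u = restr (word_trace E w) X" "w \<in> Ws" "?C \<subset> X" "X \<subseteq> W" by (auto simp: below_def)
    let ?v = "filter (\<lambda>x. x \<in> X) w"
    have v: "u = word_trace E ?v" using w(1) by (simp add: trace_filter)
    have sv: "set ?v = X" using w WsD(2)[OF w(2)] by auto
    have "restr u ?C = restr (word_trace E w) ?C" using w by (simp add: restr_restr Int_absorb1 less_imp_le)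
    then have "restr (word_trace E ?v) ?C = word_trace E c" using WsD(4)[OF w(2)] v by simp
    then have "distinct ?v \<and> compatible P ?v \<and> ?C \<subset> set ?v \<and> set ?v \<subseteq> W \<and> restr (word_trace E ?v) ?C = word_trace E c"
      using w sv WsD[OF w(2)] compatible_filter[of P w] by simp
    then show "u \<in> ?U" using v by blast
  next
    fix u assume "u \<in> ?U"
    then obtain v where v: "u = word_trace E v" "distinct v" "compatible P v" "?C \<subset> set v" "set v \<subseteq> W"
      "restr (word_trace E v) ?C = word_trace E c" by blast
    obtain w where w: "distinct w" "set w = W" "compatible P w" "filter (\<lambda>x. x \<in> set v) w = v"
      using word_extend[OF P v(2,3) W(1) v(5)] by blast
    have uw: "u = restr (word_trace E w) (set v)" using trace_filter[of E "set v" w] w(4) v(1) by simp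
    then have "restr (word_trace E w) ?C = restr u ?C" using v(4) by (simp add: restr_restr Int_absorb1 less_imp_le)
    then have "w \<in> Ws" using w v by (simp add: Ws_def)
    then show "u \<in> below Ws" using uw v unfolding below_def by blast
  qed
  ultimately show ?thesis by simp
qed

section \<open>The complex of traces is homotopy Cohen-Macaulay\<close>

definition words :: "'a set set \<Rightarrow> 'a rel \<Rightarrow> 'a list set" where
  "words \<Delta> P = {w. distinct w \<and> set w \<in> \<Delta> \<and> compatible P w}"

definition traces :: "'a set set \<Rightarrow> 'a set set \<Rightarrow> 'a rel \<Rightarrow> ('a set \<times> ('a \<times> 'a) set) set" where
  "traces E \<Delta> P = word_trace E ` words \<Delta> P"

lemma finite_traces:
  assumes "simplicial_complex_on V \<Delta>"
  shows "finite (traces E \<Delta> P)"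
proof -
  have "words \<Delta> P \<subseteq> {xs. set xs \<subseteq> V \<and> distinct xs}"
    using simplicial_complex_onD(2)[OF assms] by (auto simp: words_def)
  then show ?thesis unfolding traces_def
    using finite_subset_distinct[OF simplicial_complex_onD(1)[OF assms]] finite_subset by blast
qed

lemma poset_on_traces_subset: "A \<subseteq> traces E \<Delta> P \<Longrightarrow> poset_on A trace_le"
  using poset_on_subset[OF poset_on_traces[of E], of A] unfolding traces_def by blast

lemma words_filter:
  assumes "simplicial_complex_on V \<Delta>" "w \<in> words \<Delta> P"
  shows "filter Q w \<in> words \<Delta> P"
  using assms(2) simplicial_complex_onD(4)[OF assms(1), of "set w" "set (filter Q w)"]
  by (auto simp: words_def compatible_filter)

lemma Nil_words: "simplicial_complex_on V \<Delta> \<Longrightarrow> [] \<in> words \<Delta> P"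
  by (auto simp: words_def compatible_def dest: simplicial_complex_onD(3))

lemma trace_Nil: "word_trace E [] = ({}, {})"
  by (simp add: word_trace_def)

lemma trace_Nil_le: "trace_le (word_trace E []) p"
  by (simp add: trace_le_def trace_Nil restr_def)

lemma trace_le_NilD: "trace_le p (word_trace E []) \<Longrightarrow> p = word_trace E []"
  by (simp add: trace_le_def trace_Nil restr_def)

text \<open>Purity supplies a face of maximal size containing \<open>F\<close>. The formula provides
  the exponent \<open>d - card q\<close> that the fiber theorem asks of links.\<close>

lemma Max_card_link:
  assumes D: "simplicial_complex_on V \<Delta>" "homotopy_CM \<Delta>" and F: "F \<in> \<Delta>"
  shows "Max (card ` link \<Delta> F) = Max (card ` \<Delta>) - card F"
proof (rule Max_eqI)
  note L = simplicial_complex_on_link[OF D(1) F]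
  show "finite (card ` link \<Delta> F)" using simplicial_complex_onD(5)[OF L] by simp
  have card_Un: "card (F \<union> G) = card F + card G" if "G \<in> link \<Delta> F" for G
    using that simplicial_complex_onD(6)[OF D(1)] F simplicial_complex_onD(6)[OF L that]
    by (intro card_Un_disjoint) (auto simp: link_def)
  show "k \<le> Max (card ` \<Delta>) - card F" if "k \<in> card ` link \<Delta> F" for k
  proof -
    obtain G where G: "G \<in> link \<Delta> F" "k = card G" using \<open>k \<in> card ` link \<Delta> F\<close> by auto
    then have "card (F \<union> G) \<le> Max (card ` \<Delta>)"
      by (intro card_le_Max_card[OF D(1)]) (simp add: link_def)
    then show ?thesis using card_Un[OF G(1)] G(2) by simp
  qed
  obtain G where G: "G \<in> \<Delta>" "F \<subseteq> G" "card G = Max (card ` \<Delta>)"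
    using homotopy_CM_pure[OF D F] by blast
  then have "G - F \<in> link \<Delta> F" by (auto simp: link_def Un_absorb1)
  moreover have "card (G - F) = Max (card ` \<Delta>) - card F"
    using G simplicial_complex_onD(6)[OF D(1) F] by (simp add: card_Diff_subset)
  ultimately show "Max (card ` \<Delta>) - card F \<in> card ` link \<Delta> F" by (metis imageI)
qed

text \<open>The fiber theorem for the map that sends a trace above \<open>c\<close> to its
  additional letters, a face of the link of \<open>set c\<close>. The fiber over \<open>q\<close>
  consists of the traces above \<open>c\<close> on the letters \<open>set c \<union> q\<close>,
  which \<open>built_traces\<close> handles.\<close>

lemma conn_traces_above:
  assumes D: "simplicial_complex_on V \<Delta>" "homotopy_CM \<Delta>"
    and P: "trans P" "antisym P" "(\<forall>a b. a \<noteq> b \<longrightarrow> {a, b} \<in> E) \<or> P \<subseteq> Id"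
    and c: "c \<in> words \<Delta> P"
  shows "conn (Max (card ` \<Delta>) - card (set c))
    (geo (flag (comparable trace_le) {p \<in> traces E \<Delta> P. trace_le (word_trace E c) p \<and> p \<noteq> word_trace E c}))"
    (is "conn ?d (geo (flag _ ?U))")
proof (rule conn_fiber)
  let ?C = "set c"
  have C: "?C \<in> \<Delta>" "distinct c" "compatible P c" using c by (auto simp: words_def)
  show L: "simplicial_complex_on (V - ?C) (link \<Delta> ?C)" by (rule simplicial_complex_on_link[OF D(1) C(1)])
  show "finite ?U" using finite_traces[OF D(1)] by simp
  show "poset_on ?U trace_le" by (rule poset_on_traces_subset) auto
  have CM: "conn (Max (card ` link \<Delta> F)) (geo (link \<Delta> F))" if "F \<in> \<Delta>" for F
    using D(2) that by (simp add: homotopy_CM_iff[OF D(1)])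
  show "conn ?d (geo (link \<Delta> ?C))" using CM[OF C(1)] by (simp add: Max_card_link[OF D C(1)])
  show "fst p - ?C \<in> link \<Delta> ?C" if "p \<in> ?U" for p
  proof -
    have "?C \<subseteq> fst p" using that trace_le_fst[of "word_trace E c" p] by simp
    moreover have "fst p \<in> \<Delta>" using that by (auto simp: traces_def words_def)
    ultimately show ?thesis by (auto simp: link_def Un_absorb1)
  qed
  show "fst p - ?C \<noteq> {}" if asm: "p \<in> ?U" for p
  proof
    assume "fst p - ?C = {}"
    moreover obtain w where w: "p = word_trace E w" using asm by (auto simp: traces_def)
    ultimately have "restr p ?C = p" by (simp add: restr_word_trace)
    moreover have "word_trace E c = restr p ?C" "p \<noteq> word_trace E c" using asm by (auto simp: trace_le_def)
    ultimately show False by metis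
  qed
  show "fst p - ?C \<subseteq> fst p' - ?C" if "trace_le p p'" for p p' using trace_le_fst[OF that] by auto
  fix q assume q: "q \<in> link \<Delta> ?C" "q \<noteq> {}"
  then have Cq: "?C \<union> q \<in> \<Delta>" "?C \<inter> q = {}" by (auto simp: link_def)
  have fin: "finite (?C \<union> q)" using simplicial_complex_onD(6)[OF D(1) Cq(1)] .
  then have "card (?C \<union> q) = card ?C + card q" using Cq(2) by (intro card_Un_disjoint) auto
  then show "conn (?d - card q) (geo (link (link \<Delta> ?C) q))"
    using CM[OF Cq(1)] by (simp add: link_link[OF q(1)] Max_card_link[OF D Cq(1)])
  have "{p \<in> ?U. fst p - ?C \<subseteq> q} = {word_trace E w |w. distinct w \<and> compatible P w \<and> ?C \<subset> set w \<and>
      set w \<subseteq> ?C \<union> q \<and> restr (word_trace E w) ?C = word_trace E c}" (is "?L = ?R")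
  proof (intro set_eqI iffI)
    fix p assume p: "p \<in> ?L"
    then obtain w where w: "p = word_trace E w" "w \<in> words \<Delta> P" by (auto simp: traces_def)
    have le: "restr p ?C = word_trace E c" using p by (simp add: trace_le_def)
    have "?C \<subseteq> set w" using p w trace_le_fst[of "word_trace E c" p] by simp
    moreover have "?C \<noteq> set w"
    proof
      assume "?C = set w"
      then have "restr p ?C = p" using w by (simp add: restr_word_trace)
      then show False using p le by simp
    qed
    moreover have "set w \<subseteq> ?C \<union> q" using p w by auto
    ultimately show "p \<in> ?R" using w le by (auto simp: words_def)
  next
    fix p assume "p \<in> ?R"
    then obtain w where w: "p = word_trace E w" "distinct w" "compatible P w" "?C \<subset> set w" "set w \<subseteq> ?C \<union> q"
      "restr (word_trace E w) ?C = word_trace E c" by blast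
    have "set w \<in> \<Delta>" using simplicial_complex_onD(4)[OF D(1) Cq(1) w(5)] .
    then have "p \<in> traces E \<Delta> P" using w by (auto simp: traces_def words_def)
    moreover have "p \<noteq> word_trace E c"
    proof
      assume "p = word_trace E c"
      then have "fst p = ?C" by simp
      then show False using w(1,4) by simp
    qed
    moreover have "trace_le (word_trace E c) p" using w(1,6) by (simp add: trace_le_def)
    ultimately show "p \<in> ?L" using w(1,5) by auto
  qed
  moreover have "?C \<union> q - ?C = q" using Cq(2) by auto
  ultimately show "built (comparable trace_le) (card q) {p \<in> ?U. fst p - ?C \<subseteq> q}"
    using built_traces[OF P fin _ C(2,3)] by simp
qed

lemma link_flag_face:
  assumes "symp r" "F \<in> flag r A"
  shows "link (flag r A) F = flag r {x \<in> A. x \<notin> F \<and> (\<forall>y\<in>F. r x y)}"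
proof (intro set_eqI iffI)
  fix G assume "G \<in> link (flag r A) F"
  then have G: "F \<union> G \<in> flag r A" "F \<inter> G = {}" by (auto simp: link_def)
  have "r x y" if "x \<in> G" "y \<in> F" for x y using flagD(3)[OF G(1), of x y] that G(2) by auto
  then show "G \<in> flag r {x \<in> A. x \<notin> F \<and> (\<forall>y\<in>F. r x y)}"
    using flagD[OF G(1)] G(2) by (intro flagI) auto
next
  fix G assume G: "G \<in> flag r {x \<in> A. x \<notin> F \<and> (\<forall>y\<in>F. r x y)}"
  have "F \<union> G \<in> flag r A"
  proof (rule flagI)
    fix x y assume "x \<in> F \<union> G" "y \<in> F \<union> G" "x \<noteq> y"
    then show "r x y"
      using flagD(1)[OF G] flagD(3)[OF G, of x y] flagD(3)[OF assms(2), of x y] sympD[OF assms(1), of y x]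
      by (elim UnE) auto
  qed (use flagD(1,2)[OF assms(2)] flagD(1,2)[OF G] in auto)
  then show "G \<in> link (flag r A) F" using flagD(1)[OF G] by (auto simp: link_def)
qed

text \<open>The contents of the members of a chain strictly increase, so chains have at most as many
  elements as a facet of \<Delta>. Hence the link of a chain \<open>F\<close> is small enough for
  connectivity in degree \<open>?D - card F\<close> to suffice. The maximum itself is attained along
  the prefixes of a word on a largest face.\<close>

theorem homotopy_CM_traces:
  assumes D: "simplicial_complex_on V \<Delta>" "homotopy_CM \<Delta>"
    and P: "trans P" "antisym P" "(\<forall>a b. a \<noteq> b \<longrightarrow> {a, b} \<in> E) \<or> P \<subseteq> Id"
  defines "A \<equiv> traces E \<Delta> P - {word_trace E []}"
  shows "homotopy_CM (flag (comparable trace_le) A)"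
    and "Max (card ` flag (comparable trace_le) A) = Max (card ` \<Delta>)"
proof -
  let ?r = "comparable trace_le" and ?D = "Max (card ` \<Delta>)"
  let ?K = "flag ?r A"
  have A: "finite A" using finite_traces[OF D(1)] by (simp add: A_def)
  note K = simplicial_complex_on_flag[OF A, of ?r]
  have AD: "\<exists>w. p = word_trace E w \<and> w \<in> words \<Delta> P \<and> w \<noteq> []" if "p \<in> A" for p
    using that by (auto simp: A_def traces_def)
  have antisym: "p = q" if "trace_le p q" "trace_le q p" "p \<in> traces E \<Delta> P" "q \<in> traces E \<Delta> P" for p q
    using that trace_le_antisym by (auto simp: traces_def)
  have fst_less: "card (fst p) < card (fst q)" if asm: "trace_le p q" "p \<noteq> q" "q \<in> A" for p q
  proof -
    obtain w where w: "q = word_trace E w" using AD[OF asm(3)] by blast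
    have "fst p \<noteq> fst q"
    proof
      assume "fst p = fst q"
      then have "p = q" using asm(1) w by (simp add: trace_le_def restr_word_trace)
      then show False using asm(2) by simp
    qed
    then have "fst p \<subset> fst q" using trace_le_fst[OF asm(1)] by auto
    then show ?thesis using w by (intro psubset_card_mono) auto
  qed
  have chain_card: "card H \<le> ?D" if H: "H \<in> ?K" for H
  proof -
    have "inj_on (\<lambda>p. card (fst p)) H"
    proof (rule inj_onI, rule ccontr)
      fix p q assume pq: "p \<in> H" "q \<in> H" "card (fst p) = card (fst q)" "p \<noteq> q"
      then have "?r p q" using flagD(3)[OF H] by blast
      then show False using fst_less[of p q] fst_less[of q p] pq flagD(1)[OF H] by auto
    qed
    moreover have "(\<lambda>p. card (fst p)) ` H \<subseteq> {1..?D}"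
    proof clarify
      fix p assume "p \<in> H"
      then obtain w where w: "p = word_trace E w" "w \<in> words \<Delta> P" "w \<noteq> []" using AD flagD(1)[OF H] by blast
      then have "card (set w) \<le> ?D" by (intro card_le_Max_card[OF D(1)]) (simp add: words_def)
      moreover have "card (set w) > 0" using w(3) by (simp add: card_gt_0_iff)
      ultimately show "card (fst p) \<in> {1..?D}" using w(1) by simp
    qed
    ultimately have "card H \<le> card {1..?D}" by (intro card_inj_on_le) auto
    then show ?thesis by simp
  qed
  show "homotopy_CM ?K"
    unfolding homotopy_CM_iff[OF K]
  proof
    fix F assume F: "F \<in> ?K"
    define N where "N = {x \<in> A. x \<notin> F \<and> (\<forall>y\<in>F. ?r x y)}"
    have lk: "link ?K F = flag ?r N" unfolding N_def by (rule link_flag_face[OF symp_comparable F])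
    have finF: "finite F" using flagD(2)[OF F] .
    have bound: "Max (card ` link ?K F) \<le> ?D - card F"
    proof -
      obtain G where G: "G \<in> link ?K F" "card G = Max (card ` link ?K F)"
        using Max_card_attained[OF simplicial_complex_on_link[OF K F]] by blast
      then have FG: "F \<union> G \<in> ?K" "F \<inter> G = {}" by (auto simp: link_def)
      then have "card (F \<union> G) = card F + card G" using flagD(2)[OF FG(1)] by (intro card_Un_disjoint) auto
      then show ?thesis using chain_card[OF FG(1)] G(2) by simp
    qed
    have "conn (?D - card F) (geo (flag ?r N))"
    proof (cases "F = {}")
      case True
      have "conn ?D (geo (flag ?r {p \<in> traces E \<Delta> P. trace_le (word_trace E []) p \<and> p \<noteq> word_trace E []}))"
        using conn_traces_above[OF D P Nil_words[OF D(1)]] by simp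
      moreover have "N = {p \<in> traces E \<Delta> P. trace_le (word_trace E []) p \<and> p \<noteq> word_trace E []}"
        using True by (auto simp: N_def A_def trace_Nil_le)
      ultimately show ?thesis using True by simp
    next
      case False
      have FA: "F \<subseteq> A" using flagD(1)[OF F] .
      then have "poset_on F trace_le" by (intro poset_on_traces_subset) (auto simp: A_def)
      \<comment> \<open>The top of the chain, where the link splits into traces below and
        above.\<close>
      then obtain p where p: "p \<in> F" "\<And>x. x \<in> F \<Longrightarrow> trace_le p x \<Longrightarrow> x = p"
        using poset_maximal[OF finF False] by blast
      obtain w where w: "p = word_trace E w" "w \<in> words \<Delta> P" "w \<noteq> []" using AD FA p(1) by blast
      have below_p: "trace_le x p" if "x \<in> F" for x
        using flagD(3)[OF F that p(1)] p(2)[OF that] w(1) trace_le_refl by blast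
      define S where "S = set w"
      have S: "finite S" "S \<noteq> {}" "S \<in> \<Delta>" "fst p = S" using w by (auto simp: S_def words_def)
      define \<rho> where "\<rho> = restr p"
      have \<rho>_fst: "fst (\<rho> X) = X" if "X \<subseteq> S" for X using that by (auto simp: \<rho>_def S(4))
      have \<rho>_le: "trace_le (\<rho> X) (\<rho> Y) \<longleftrightarrow> X \<subseteq> Y" if "X \<subseteq> S" "Y \<subseteq> S" for X Y
        unfolding \<rho>_def w(1) using that by (intro trace_le_restr) (auto simp: S_def)
      have \<rho>S: "\<rho> S = p" by (simp add: \<rho>_def w(1) S_def restr_word_trace)
      have \<rho>_inj: "inj_on \<rho> {X. X \<subseteq> S}" by (metis (mono_tags, lifting) \<rho>_fst inj_onI mem_Collect_eq)
      have \<rho>_below: "x = \<rho> (fst x)" "fst x \<subseteq> S" if "trace_le x p" for x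
        using that trace_le_fst[OF that] by (auto simp: \<rho>_def trace_le_def S(4))
      \<comment> \<open>Below \<open>p\<close> traces correspond to subsets of \<open>S\<close> via
        \<open>\<rho>\<close>. The set \<open>c\<close> is the image of the rest of the chain, to
        which \<open>built_chain_link\<close> applies.\<close>
      define c where "c = fst ` (F - {p})"
      let ?B = "{X. {} \<subset> X \<and> X \<subset> S \<and> X \<notin> c \<and> (\<forall>Y\<in>c. comparable (\<subseteq>) X Y)}"
      let ?U = "{x \<in> traces E \<Delta> P. trace_le p x \<and> x \<noteq> p}"
      have FA_ne: "fst x \<noteq> {}" if "x \<in> A" for x using AD[OF that] by auto
      have psub: "fst x \<subset> S" if "trace_le x p" "x \<noteq> p" for x
      proof -
        have "fst x \<noteq> S" using \<rho>_below(1)[OF that(1)] \<rho>S that(2) by metis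
        then show ?thesis using \<rho>_below(2)[OF that(1)] by auto
      qed
      have c1: "{} \<subset> X \<and> X \<subset> S" if asm: "X \<in> c" for X
      proof -
        obtain x where "x \<in> F" "x \<noteq> p" "X = fst x" using asm by (auto simp: c_def)
        then show ?thesis using psub[OF below_p] FA_ne FA by blast
      qed
      have c2: "comparable (\<subseteq>) X Y" if asm: "X \<in> c" "Y \<in> c" for X Y
      proof -
        obtain x y where "x \<in> F" "X = fst x" "y \<in> F" "Y = fst y" using asm by (auto simp: c_def)
        then show ?thesis using flagD(3)[OF F, of x y] trace_le_fst[of x y] trace_le_fst[of y x]
          by (cases "x = y") auto
      qed
      have "built (comparable (\<subseteq>)) (card S - 1 - card c) ?B"
        using finF by (intro built_chain_link[OF S(1) _ c1 c2]) (auto simp: c_def)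
      then have L: "built ?r (card S - 1 - card c) (\<rho> ` ?B)"
      proof (rule built_image)
        show "inj_on \<rho> ?B" using \<rho>_inj by (rule inj_on_subset) auto
      qed (simp add: \<rho>_le less_imp_le)
      have U: "conn (?D - card S) (geo (flag ?r ?U))"
        using conn_traces_above[OF D P w(2)] by (simp add: w(1) S_def)
      have lower: "trace_le x p" if "x \<in> \<rho> ` ?B" for x using that \<rho>_le[of _ S] \<rho>S by auto
      have joined: "conn ((card S - 1 - card c) + (?D - card S)) (geo (flag ?r (\<rho> ` ?B \<union> ?U)))"
      proof (rule conn_join[OF L _ symp_comparable _ _ U])
        show "finite ?U" using finite_traces[OF D(1)] by simp
        show "\<rho> ` ?B \<inter> ?U = {}"
        proof (rule ccontr)
          assume "\<rho> ` ?B \<inter> ?U \<noteq> {}"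
          then obtain x where x: "x \<in> \<rho> ` ?B" "x \<in> ?U" by blast
          then have "trace_le x p" "trace_le p x" "x \<noteq> p" "x \<in> traces E \<Delta> P" using lower by auto
          then show False using antisym[of x p] w by (auto simp: traces_def)
        qed
        show "?r x y" if "x \<in> \<rho> ` ?B" "y \<in> ?U" for x y
          using trace_le_trans[OF lower[OF that(1)]] that(2) by auto
      qed
      have N_eq: "\<rho> ` ?B \<union> ?U = N"
      proof (intro set_eqI iffI)
        fix x assume "x \<in> \<rho> ` ?B \<union> ?U"
        then show "x \<in> N"
        proof
          assume "x \<in> \<rho> ` ?B"
          then obtain X where X: "x = \<rho> X" "X \<in> ?B" by blast
          then have XS: "X \<subset> S" "X \<noteq> {}" "X \<notin> c" "\<And>Y. Y \<in> c \<Longrightarrow> comparable (\<subseteq>) X Y" by auto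
          have fx: "fst x = X" using X(1) \<rho>_fst XS(1) by auto
          have "x = word_trace E (filter (\<lambda>z. z \<in> X) w)" using X(1) w(1) by (simp add: \<rho>_def trace_filter)
          then have "x \<in> traces E \<Delta> P" using words_filter[OF D(1) w(2)] by (auto simp: traces_def)
          moreover have "x \<noteq> word_trace E []" using fx XS(2) by auto
          moreover have "x \<notin> F"
          proof
            assume "x \<in> F"
            moreover have "x \<noteq> p" using fx S(4) XS(1) by auto
            ultimately have "X \<in> c" using fx by (auto simp: c_def)
            then show False using XS(3) by simp
          qed
          moreover have "?r x y" if "y \<in> F" for y
          proof (cases "y = p")
            case True
            then show ?thesis using lower \<open>x \<in> \<rho> ` ?B\<close> by simp
          next
            case False
            then have "fst y \<in> c" using that by (auto simp: c_def)
            then have "comparable (\<subseteq>) X (fst y)" by (rule XS(4))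
            moreover have "y = \<rho> (fst y)" "fst y \<subseteq> S" using \<rho>_below[OF below_p[OF that]] by auto
            ultimately show ?thesis using \<rho>_le[of X "fst y"] \<rho>_le[of "fst y" X] X(1) XS(1) by auto
          qed
          ultimately show ?thesis by (simp add: N_def A_def)
        next
          assume x: "x \<in> ?U"
          then have le: "trace_le p x" "x \<noteq> p" "x \<in> traces E \<Delta> P" by auto
          have "S \<subseteq> fst x" using trace_le_fst[OF le(1)] S(4) by simp
          then have "x \<noteq> word_trace E []" using S(2) by auto
          moreover have "p \<in> traces E \<Delta> P" using p(1) FA by (auto simp: A_def)
          then have "x \<notin> F" using below_p[of x] antisym[OF _ le(1)] le(2,3) by blast
          moreover have "?r x y" if "y \<in> F" for y using trace_le_trans[OF below_p[OF that] le(1)] by simp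
          ultimately show ?thesis using le(3) by (simp add: N_def A_def)
        qed
      next
        fix x assume "x \<in> N"
        then have x: "x \<in> A" "x \<notin> F" "\<And>y. y \<in> F \<Longrightarrow> ?r x y" by (auto simp: N_def)
        have xp: "x \<noteq> p" using x(2) p(1) by auto
        show "x \<in> \<rho> ` ?B \<union> ?U"
        proof (cases "trace_le p x")
          case True
          then show ?thesis using x(1) xp by (simp add: A_def)
        next
          case False
          then have le: "trace_le x p" using x(3)[OF p(1)] by simp
          have "fst x \<notin> c"
          proof
            assume "fst x \<in> c"
            then obtain y where y: "y \<in> F" "fst y = fst x" by (auto simp: c_def)
            then have "y = x" using \<rho>_below(1)[OF le] \<rho>_below(1)[OF below_p[OF y(1)]] by simp
            then show False using x(2) y(1) by simp
          qed
          moreover have "comparable (\<subseteq>) (fst x) Y" if asm: "Y \<in> c" for Y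
          proof -
            obtain y where "y \<in> F" "Y = fst y" using asm by (auto simp: c_def)
            then show ?thesis using x(3)[of y] trace_le_fst[of x y] trace_le_fst[of y x] by auto
          qed
          ultimately have "fst x \<in> ?B" using psub[OF le xp] FA_ne[OF x(1)] by blast
          then show ?thesis using \<rho>_below(1)[OF le] by blast
        qed
      qed
      have "card c = card F - 1"
      proof -
        have "inj_on fst (F - {p})" using \<rho>_below(1)[OF below_p] by (intro inj_onI) (metis DiffD1)
        then show ?thesis using finF p(1) by (simp add: c_def card_image card_Diff_singleton)
      qed
      moreover have "card F > 0" using finF False by auto
      moreover have "card S \<le> ?D" using card_le_Max_card[OF D(1) S(3)] .
      moreover have "card S > 0" using S by auto
      \<comment> \<open>With \<open>card c = card F - 1\<close> the lower part contributes
        \<open>card S - card F\<close> and the upper part \<open>?D - card S\<close>.\<close>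
      ultimately have "?D - card F \<le> (card S - 1 - card c) + (?D - card S)" by linarith
      with joined show ?thesis unfolding N_eq by (rule conn_mono)
    qed
    then show "conn (Max (card ` link ?K F)) (geo (link ?K F))"
      unfolding lk[symmetric] using bound by (rule conn_mono)
  qed
  show "Max (card ` ?K) = ?D"
  proof (rule Max_eqI)
    show "finite (card ` ?K)" using simplicial_complex_onD(5)[OF K] by simp
    show "k \<le> ?D" if "k \<in> card ` ?K" for k using that chain_card by auto
    obtain T where T: "T \<in> \<Delta>" "card T = ?D" using Max_card_attained[OF D(1)] by blast
    have "finite T" using simplicial_complex_onD(6)[OF D(1) T(1)] .
    then obtain w where w: "distinct w" "set w = T" "compatible P w"
      using word_extend[OF P(1,2), of "[]" T] by (auto simp: compatible_def)
    have len: "length w = ?D" using w(1,2) T(2) distinct_card by force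
    \<comment> \<open>The prefixes of one word on a largest face, without the empty one, form a
      chain of length \<open>?D\<close>.\<close>
    define \<rho> where "\<rho> = (\<lambda>i. restr (word_trace E w) (set (take i w)))"
    have card_\<rho>: "card (fst (\<rho> i)) = i" if "i \<le> ?D" for i
    proof -
      have "fst (\<rho> i) = set (take i w)" using set_take_subset[of i w] by (auto simp: \<rho>_def)
      then show ?thesis using distinct_card[of "take i w"] w(1) that len by simp
    qed
    have chain: "\<rho> ` {1..?D} \<in> ?K"
    proof (rule flagI)
      show "\<rho> ` {1..?D} \<subseteq> A"
      proof (rule image_subsetI)
        fix i assume i: "i \<in> {1..?D}"
        have "\<rho> i = word_trace E (filter (\<lambda>z. z \<in> set (take i w)) w)" by (simp add: \<rho>_def trace_filter)
        moreover have "w \<in> words \<Delta> P" using w T by (simp add: words_def)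
        ultimately have "\<rho> i \<in> traces E \<Delta> P" using words_filter[OF D(1)] by (auto simp: traces_def)
        moreover have "\<rho> i \<noteq> word_trace E []" using card_\<rho>[of i] i by auto
        ultimately show "\<rho> i \<in> A" by (simp add: A_def)
      qed
      fix x y assume "x \<in> \<rho> ` {1..?D}" "y \<in> \<rho> ` {1..?D}"
      then obtain i j where ij: "x = \<rho> i" "y = \<rho> j" by blast
      have "trace_le (\<rho> i) (\<rho> j)" if "i \<le> j" for i j
        unfolding \<rho>_def using that by (subst trace_le_restr) (auto dest: in_set_takeD set_take_subset_set_take[THEN subsetD])
      then show "?r x y" using ij by (meson nat_le_linear)
    qed simp
    have "inj_on \<rho> {1..?D}" using card_\<rho> by (intro inj_onI) (metis atLeastAtMost_iff)
    then have "card (\<rho> ` {1..?D}) = ?D" by (simp add: card_image)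
    then show "?D \<in> card ` ?K" using imageI[OF chain, of card] by simp
  qed
qed

section \<open>Transfer to words and commutation classes\<close>

lemma homotopy_CM_image:
  assumes K: "simplicial_complex_on V K" and inj: "inj_on \<phi> V" and CM: "homotopy_CM K"
  shows "homotopy_CM ((`) \<phi> ` K)"
  unfolding homotopy_CM_iff[OF simplicial_complex_on_image[OF K]]
proof clarify
  fix F assume F: "F \<in> K"
  let ?L = "link K F"
  have L: "simplicial_complex_on (V - F) ?L" by (rule simplicial_complex_on_link[OF K F])
  have inj_Pow: "inj_on ((`) \<phi>) (Pow V)" using inj by (rule inj_on_image_Pow)
  have FV: "F \<subseteq> V" using simplicial_complex_onD(2)[OF K F] .
  have "link ((`) \<phi> ` K) (\<phi> ` F) = (`) \<phi> ` ?L"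
  proof (intro set_eqI iffI)
    fix G assume "G \<in> link ((`) \<phi> ` K) (\<phi> ` F)"
    then obtain H where H: "H \<in> K" "\<phi> ` F \<union> G = \<phi> ` H" "\<phi> ` F \<inter> G = {}" by (auto simp: link_def)
    have HV: "H \<subseteq> V" using simplicial_complex_onD(2)[OF K H(1)] .
    obtain G' where G': "G' \<subseteq> H" "G = \<phi> ` G'" using H(2) by (metis Un_upper2 subset_imageE)
    have "\<phi> ` (F \<union> G') = \<phi> ` H" using H(2) G'(2) by (simp add: image_Un)
    then have "F \<union> G' = H" using inj_onD[OF inj_Pow] FV HV G'(1) by auto
    moreover have "F \<inter> G' = {}" using H(3) G'(2) by auto
    ultimately show "G \<in> (`) \<phi> ` ?L" using H(1) G'(2) by (auto simp: link_def)
  next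
    fix G assume "G \<in> (`) \<phi> ` ?L"
    then obtain G' where G': "G = \<phi> ` G'" "F \<union> G' \<in> K" "F \<inter> G' = {}" by (auto simp: link_def)
    have "G' \<subseteq> V" using simplicial_complex_onD(2)[OF K G'(2)] by simp
    then have "\<phi> ` F \<inter> \<phi> ` G' = {}" using inj_on_image_Int[OF inj FV] G'(3) by auto
    then show "G \<in> link ((`) \<phi> ` K) (\<phi> ` F)" using G' by (auto simp: link_def image_Un[symmetric])
  qed
  moreover have "card ` (`) \<phi> ` ?L = card ` ?L"
  proof -
    have "card (\<phi> ` G) = card G" if "G \<in> ?L" for G
      using simplicial_complex_onD(2)[OF L that] inj by (intro card_image) (auto intro: inj_on_subset)
    then show ?thesis by (simp add: image_image cong: image_cong)
  qed
  moreover have "conn (Max (card ` ?L)) (geo ((`) \<phi> ` ?L))"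
  proof (rule conn_image[OF L])
    show "inj_on \<phi> (V - F)" using inj by (rule inj_on_subset) auto
    show "conn (Max (card ` ?L)) (geo ?L)" using CM F by (simp add: homotopy_CM_iff[OF K])
  qed
  ultimately show "conn (Max (card ` link ((`) \<phi> ` K) (\<phi> ` F))) (geo (link ((`) \<phi> ` K) (\<phi> ` F)))"
    by simp
qed

lemma order_complex_eq_flag:
  assumes "\<And>x. x \<in> B \<Longrightarrow> le x x"
  shows "order_complex B le = flag (comparable le) B"
proof (intro set_eqI iffI)
  fix C assume C: "C \<in> flag (comparable le) B"
  have "comparable le x y" if "x \<in> C" "y \<in> C" for x y
    using flagD(1)[OF C] flagD(3)[OF C that] assms[of x] that by (cases "x = y") auto
  then show "C \<in> order_complex B le" using flagD(1,2)[OF C] by (simp add: order_complex_def)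
qed (simp add: order_complex_def flag_def)

text \<open>Identifies the cells that contain a given vertex with the traces that use the
  corresponding letter.\<close>

lemma trace_singleton_le:
  assumes "distinct w"
  shows "trace_le (word_trace E [a]) (word_trace E w) \<longleftrightarrow> a \<in> set w"
proof -
  have "(a, a) \<notin> before w" using before_irrefl[OF assms] by blast
  then show ?thesis by (auto simp: trace_le_def word_trace_def restr_def)
qed

text \<open>The empty trace is below all traces and is the only such trace, so the nonempty cells
  are the others. Inverting \<open>\<tau>\<close> there relabels the order complex of traces. The
  dimension depends on neither \<open>E\<close> nor \<open>P\<close>, which makes comparison with a
  deletion immediate.\<close>

lemma cells_of_traces:
  fixes \<tau> :: "'c \<Rightarrow> 'a set \<times> ('a \<times> 'a) set"
  assumes D: "simplicial_complex_on V \<Delta>" "homotopy_CM \<Delta>"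
    and P: "trans P" "antisym P" "(\<forall>a b. a \<noteq> b \<longrightarrow> {a, b} \<in> E) \<or> P \<subseteq> Id"
    and \<tau>: "inj_on \<tau> A" "\<tau> ` A = traces E \<Delta> P"
    and le: "\<And>x y. x \<in> A \<Longrightarrow> y \<in> A \<Longrightarrow> le x y \<longleftrightarrow> trace_le (\<tau> x) (\<tau> y)"
  shows "nonempty_cells A le = {x \<in> A. \<tau> x \<noteq> word_trace E []}"
    and "cell_homotopy_CM A le" and "cell_dim A le = complex_dim \<Delta>"
proof -
  have "word_trace E [] \<in> \<tau> ` A" unfolding \<tau>(2) traces_def using Nil_words[OF D(1)] by blast
  then obtain x0 where x0: "x0 \<in> A" "\<tau> x0 = word_trace E []" by auto
  show ne: "nonempty_cells A le = {x \<in> A. \<tau> x \<noteq> word_trace E []}"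
    unfolding nonempty_cells_def
  proof (intro Collect_cong conj_cong refl iffI)
    fix x assume x: "x \<in> A"
    show "\<tau> x \<noteq> word_trace E []" if "\<not> (\<forall>y\<in>A. le x y)"
      using that le[OF x] trace_Nil_le by metis
    show "\<not> (\<forall>y\<in>A. le x y)" if "\<tau> x \<noteq> word_trace E []"
      using that le[OF x x0(1)] x0 trace_le_NilD by metis
  qed
  define B where "B = {x \<in> A. \<tau> x \<noteq> word_trace E []}"
  define T where "T = traces E \<Delta> P - {word_trace E []}"
  define \<phi> where "\<phi> = inv_into A \<tau>"
  have TB: "T = \<tau> ` B"
  proof (intro set_eqI iffI)
    fix p assume "p \<in> T"
    then have "p \<in> \<tau> ` A" and p: "p \<noteq> word_trace E []" unfolding T_def \<tau>(2) by simp_all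
    then obtain x where x: "x \<in> A" "p = \<tau> x" by (elim imageE)
    then have "x \<in> B" using p by (simp add: B_def)
    then show "p \<in> \<tau> ` B" using x(2) by simp
  next
    fix p assume "p \<in> \<tau> ` B"
    then obtain x where "x \<in> A" "p = \<tau> x" "\<tau> x \<noteq> word_trace E []" unfolding B_def by blast
    then show "p \<in> T" unfolding T_def \<tau>(2)[symmetric] by simp
  qed
  have \<phi>: "\<phi> (\<tau> x) = x" if "x \<in> A" for x using that \<tau>(1) by (simp add: \<phi>_def)
  have \<phi>T: "\<phi> ` T = B" unfolding TB image_image using \<phi> by (force simp: B_def)
  have "T \<subseteq> \<tau> ` A" unfolding T_def \<tau>(2) by (rule Diff_subset)
  then have inj: "inj_on \<phi> T" unfolding \<phi>_def by (rule inj_on_inv_into)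
  have refl: "le x x" if "x \<in> A" for x
  proof -
    have "\<tau> x \<in> traces E \<Delta> P" using that \<tau>(2) by blast
    then obtain w where "\<tau> x = word_trace E w" unfolding traces_def by (elim imageE)
    then show ?thesis using le[OF that that] by (simp add: trace_le_refl)
  qed
  have finT: "finite T" using finite_traces[OF D(1)] by (simp add: T_def)
  have "cell_order_complex A le = order_complex B le" unfolding cell_order_complex_def ne B_def ..
  also have "\<dots> = flag (comparable le) B"
    by (rule order_complex_eq_flag) (simp add: B_def refl)
  also have "\<dots> = flag (comparable le) (\<phi> ` T)" by (simp add: \<phi>T)
  also have "\<dots> = (`) \<phi> ` flag (comparable trace_le) T"
  proof (rule flag_image[OF inj])
    fix x y assume "x \<in> T" "y \<in> T"
    then obtain x' y' where "x = \<tau> x'" "y = \<tau> y'" "x' \<in> A" "y' \<in> A" unfolding TB B_def by blast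
    then show "comparable le (\<phi> x) (\<phi> y) \<longleftrightarrow> comparable trace_le x y" using \<phi> le by simp
  qed
  finally have eq: "cell_order_complex A le = (`) \<phi> ` flag (comparable trace_le) T" .
  note K = simplicial_complex_on_flag[OF finT, of "comparable trace_le"]
  show "cell_homotopy_CM A le"
    unfolding cell_homotopy_CM_def eq T_def
    using K inj homotopy_CM_traces(1)[OF D P] unfolding T_def by (rule homotopy_CM_image)
  have "card (\<phi> ` G) = card G" if "G \<in> flag (comparable trace_le) T" for G
    using flagD(1)[OF that] inj by (intro card_image) (auto intro: inj_on_subset)
  then have "card ` (`) \<phi> ` flag (comparable trace_le) T = card ` flag (comparable trace_le) T"
    by (simp add: image_image cong: image_cong)
  then show "cell_dim A le = complex_dim \<Delta>"
    using homotopy_CM_traces(2)[OF D P]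
    unfolding cell_dim_def complex_dim_def eq T_def by simp
qed

text \<open>Every nonempty trace lies above a one-letter trace, so vertices of the cell complex are
  single letters \<open>a\<close> with \<open>{a}\<close> in \<Delta>. Deleting such a vertex leaves
  the traces over the deletion of \<open>a\<close> from \<Delta>, and \<open>cells_of_traces\<close>
  applies to both complexes.\<close>

theorem doubly_homotopy_CM_of_traces:
  fixes \<tau> :: "'c \<Rightarrow> 'a set \<times> ('a \<times> 'a) set"
  assumes D: "simplicial_complex_on V \<Delta>" "doubly_homotopy_CM \<Delta>"
    and P: "trans P" "antisym P" "(\<forall>a b. a \<noteq> b \<longrightarrow> {a, b} \<in> E) \<or> P \<subseteq> Id"
    and \<tau>: "inj_on \<tau> A" "\<tau> ` A = traces E \<Delta> P"
    and le: "\<And>x y. x \<in> A \<Longrightarrow> y \<in> A \<Longrightarrow> le x y \<longleftrightarrow> trace_le (\<tau> x) (\<tau> y)"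
  shows "cell_doubly_homotopy_CM A le"
  unfolding cell_doubly_homotopy_CM_def
proof (intro conjI ballI)
  have CM: "homotopy_CM \<Delta>" using D(2) by (simp add: doubly_homotopy_CM_def)
  note cells = cells_of_traces[where le = le and \<tau> = \<tau> and A = A, OF D(1) CM P \<tau> le]
  show "cell_homotopy_CM A le" by (rule cells(2))
  have ne: "nonempty_cells A le = {x \<in> A. \<tau> x \<noteq> word_trace E []}" by (rule cells(1))
  fix v assume v: "v \<in> cell_vertices A le"
  have vA: "v \<in> A" "\<tau> v \<noteq> word_trace E []"
    and min: "\<And>u. u \<in> A \<Longrightarrow> \<tau> u \<noteq> word_trace E [] \<Longrightarrow> le u v \<Longrightarrow> u = v"
    using v by (auto simp: cell_vertices_def ne)
  have "\<tau> v \<in> traces E \<Delta> P" using vA(1) \<tau>(2) by blast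
  then obtain w where w: "\<tau> v = word_trace E w" "w \<in> words \<Delta> P" by (auto simp: traces_def)
  then obtain a where a: "a \<in> set w" using vA(2) by (cases w) auto
  have "{a} \<in> \<Delta>" using w(2) a simplicial_complex_onD(4)[OF D(1), of "set w" "{a}"] by (simp add: words_def)
  then have "[a] \<in> words \<Delta> P" by (simp add: words_def compatible_def)
  then obtain u where u: "u \<in> A" "\<tau> u = word_trace E [a]" using \<tau>(2) unfolding traces_def by (metis imageE imageI)
  have "le u v" using le[OF u(1) vA(1)] u(2) w a by (simp add: trace_singleton_le words_def)
  moreover have "\<tau> u \<noteq> word_trace E []" using u(2) by (simp add: word_trace_def)
  ultimately have "u = v" using min u(1) by blast
  then have \<tau>v: "\<tau> v = word_trace E [a]" using u(2) by simp
  let ?A = "cell_deletion A le v" and ?D = "deletion \<Delta> a"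
  have del: "homotopy_CM ?D" "complex_dim ?D = complex_dim \<Delta>"
    using D(2) \<open>{a} \<in> \<Delta>\<close> by (auto simp: doubly_homotopy_CM_def)
  have sub: "?A \<subseteq> A" by (auto simp: cell_deletion_def)
  have image: "\<tau> ` ?A = traces E ?D P"
  proof (intro set_eqI iffI)
    fix p assume "p \<in> \<tau> ` ?A"
    then obtain x where x: "x \<in> A" "p = \<tau> x" "\<not> le v x" by (auto simp: cell_deletion_def)
    then have "p \<in> traces E \<Delta> P" using \<tau>(2) by blast
    then obtain w' where w': "p = word_trace E w'" "w' \<in> words \<Delta> P" by (auto simp: traces_def)
    have "\<not> trace_le (word_trace E [a]) (word_trace E w')"
      using x(2,3) w'(1) le[OF vA(1) x(1)] \<tau>v by metis
    then have "a \<notin> set w'" using w'(2) by (simp add: trace_singleton_le words_def)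
    then show "p \<in> traces E ?D P" using w' by (auto simp: traces_def words_def deletion_def)
  next
    fix p assume "p \<in> traces E ?D P"
    then obtain w' where w': "p = word_trace E w'" "w' \<in> words \<Delta> P" "a \<notin> set w'"
      by (auto simp: traces_def words_def deletion_def)
    then obtain x where x: "x \<in> A" "p = \<tau> x" using \<tau>(2) unfolding traces_def by (metis imageE imageI)
    have "\<not> trace_le (word_trace E [a]) (word_trace E w')"
      using w'(2,3) by (simp add: trace_singleton_le words_def)
    then have "\<not> le v x" using x(2) w'(1) le[OF vA(1) x(1)] \<tau>v by metis
    then show "p \<in> \<tau> ` ?A" using x by (auto simp: cell_deletion_def)
  qed
  have le': "le x y \<longleftrightarrow> trace_le (\<tau> x) (\<tau> y)" if "x \<in> ?A" "y \<in> ?A" for x y using that sub le by blast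
  note cells' = cells_of_traces[where le = le and \<tau> = \<tau> and A = ?A, OF simplicial_complex_on_deletion[OF D(1)] del(1) P
      inj_on_subset[OF \<tau>(1) sub] image le']
  show "cell_homotopy_CM ?A le" by (rule cells'(2))
  show "cell_dim ?A le = cell_dim A le" using cells'(3) cells(3) del(2) by simp
qed

text \<open>For the complete graph the trace retains the whole relation \<open>before\<close>, a
  linear order of the letters, and this determines the word.\<close>

lemma subseq_iff_trace_le:
  assumes "\<forall>a b. a \<noteq> b \<longrightarrow> {a, b} \<in> E" "distinct v" "distinct w"
  shows "subseq v w \<longleftrightarrow> trace_le (word_trace E v) (word_trace E w)"
proof
  assume "subseq v w"
  then have "v = filter (\<lambda>x. x \<in> set v) w" using subseq_iff_filter[OF assms(3)] by simp
  then have eq: "word_trace E v = restr (word_trace E w) (set v)" by (metis trace_filter)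
  show "trace_le (word_trace E v) (word_trace E w)" unfolding trace_le_def fst_word_trace by (rule eq)
next
  have before_eq: "{(a, b) \<in> before u. {a, b} \<in> E} = before u" if "distinct u" for u
    using before_irrefl[OF that] assms(1) by blast
  have inj: "u = u'" if "distinct u" "distinct u'" "set u = set u'" "before u = before u'" for u u' :: "'a list"
    using that
  proof (induction u arbitrary: u')
    case (Cons x u)
    obtain y s where u': "u' = y # s" using Cons.prems(3) by (cases u') auto
    have xy: "x = y"
    proof (rule ccontr)
      assume "x \<noteq> y"
      then have "(x, y) \<in> before (x # u)" "(y, x) \<in> before u'" using Cons.prems(3) u' by auto
      then show False using Cons.prems(4) before_asym[OF Cons.prems(1)] by blast
    qed
    have "set u = set s" using Cons.prems(1-3) u' xy by (simp add: insert_ident)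
    moreover have "before u = before (x # u) \<inter> (- {x}) \<times> (- {x})" "before s = before u' \<inter> (- {y}) \<times> (- {y})"
      using before_subset[of u] before_subset[of s] Cons.prems(1,2) u' by auto
    ultimately show ?case using Cons.IH[of s] Cons.prems u' xy by simp
  qed simp
  assume "trace_le (word_trace E v) (word_trace E w)"
  then have eq: "word_trace E v = word_trace E (filter (\<lambda>x. x \<in> set v) w)" by (simp add: trace_le_def trace_filter)
  have "v = filter (\<lambda>x. x \<in> set v) w"
  proof (rule inj)
    show "set v = set (filter (\<lambda>x. x \<in> set v) w)" using eq by (metis fst_word_trace)
    show "before v = before (filter (\<lambda>x. x \<in> set v) w)"
      using eq before_eq[OF assms(2)] before_eq[OF distinct_filter[OF assms(3)]]
      by (simp add: word_trace_def)
  qed (use assms in auto)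
  then show "subseq v w" using subseq_iff_filter[OF assms(3)] by simp
qed

section \<open>Commutation classes as traces\<close>

lemma commutation_trace:
  assumes "(commutation E)\<^sup>*\<^sup>* w w'" "distinct w"
  shows "distinct w' \<and> word_trace E w' = word_trace E w"
  using assms
proof (induction rule: rtranclp_induct)
  case (step y z)
  then obtain u s s' v where "y = u @ [s, s'] @ v" "z = u @ [s', s] @ v" "{s, s'} \<notin> E"
    unfolding commutation_def by blast
  then show ?case using step by (auto simp: word_trace_def before_append insert_commute)
qed simp

lemma commutation_Cons: "(commutation E)\<^sup>*\<^sup>* w w' \<Longrightarrow> (commutation E)\<^sup>*\<^sup>* (a # w) (a # w')"
proof (induction rule: rtranclp_induct)
  case (step y z)
  then obtain u s s' v where "y = u @ [s, s'] @ v" "z = u @ [s', s] @ v" "{s, s'} \<notin> E"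
    unfolding commutation_def by blast
  then have "commutation E (a # y) (a # z)" unfolding commutation_def by (metis append_Cons)
  then show ?case using step.IH by simp
qed simp

lemma commutation_move:
  "(\<And>b. b \<in> set p \<Longrightarrow> {a, b} \<notin> E) \<Longrightarrow> (commutation E)\<^sup>*\<^sup>* (a # p @ q) (p @ a # q)"
proof (induction p)
  case (Cons b p)
  have "commutation E (a # b # p @ q) (b # a # p @ q)"
    unfolding commutation_def using Cons.prems[of b]
    by (intro exI[of _ "[]"] exI[of _ a] exI[of _ b] exI[of _ "p @ q"]) auto
  moreover have "(commutation E)\<^sup>*\<^sup>* (b # a # p @ q) (b # p @ a # q)"
    using Cons by (intro commutation_Cons) auto
  ultimately show ?case by simp
qed simp

text \<open>Let \<open>a\<close> be the first letter of \<open>w\<close>. A letter in front of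
  \<open>a\<close> in \<open>w'\<close> cannot be adjacent to \<open>a\<close>, since the edge would
  be oriented differently in \<open>w\<close>. So \<open>a\<close> can be commuted to the front of
  \<open>w'\<close>; both words then lose \<open>a\<close> and induction applies.\<close>

lemma trace_eq_imp_commutation:
  "distinct w \<Longrightarrow> distinct w' \<Longrightarrow> word_trace E w = word_trace E w' \<Longrightarrow> (commutation E)\<^sup>*\<^sup>* w w'"
proof (induction w arbitrary: w')
  case Nil
  then have "set w' = {}" by (metis fst_word_trace list.set(1))
  then show ?case by simp
next
  case (Cons a u)
  have sets: "set w' = set (a # u)" using Cons.prems(3) by (metis fst_word_trace)
  then obtain p q where w': "w' = p @ a # q" by (metis list.set_intros(1) split_list)
  have "{a, b} \<notin> E" if b: "b \<in> set p" for b
  proof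
    assume E: "{a, b} \<in> E"
    have "b \<in> set (a # u)" "b \<noteq> a" using b sets w' Cons.prems(2) by auto
    then have "(a, b) \<in> snd (word_trace E (a # u))" using E by (simp add: word_trace_def)
    then have "(a, b) \<in> before w'" unfolding Cons.prems(3) by (simp add: word_trace_def)
    moreover have "(b, a) \<in> before w'" using b w' by (simp add: before_append)
    ultimately show False using before_asym[OF Cons.prems(2)] by blast
  qed
  then have "(commutation E)\<^sup>*\<^sup>* (a # p @ q) w'" unfolding w' by (rule commutation_move)
  moreover have "(commutation E)\<^sup>*\<^sup>* (a # u) (a # p @ q)"
  proof (intro commutation_Cons Cons.IH)
    show "distinct u" "distinct (p @ q)" using Cons.prems w' by auto
    \<comment> \<open>Dropping \<open>a\<close> is written as a filter so that the equality of
      traces passes to the shorter words by restriction.\<close>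
    have f: "filter (\<lambda>x. x \<in> - {a}) v = v" if "a \<notin> set v" for v
      using that by (intro filter_True) auto
    have 1: "u = filter (\<lambda>x. x \<in> - {a}) (a # u)" and 2: "p @ q = filter (\<lambda>x. x \<in> - {a}) w'"
      using f[of u] f[of p] f[of q] Cons.prems(1,2) w' by simp_all
    show "word_trace E u = word_trace E (p @ q)"
      by (subst 1, subst 2) (simp only: trace_filter Cons.prems(3))
  qed
  ultimately show ?case by simp
qed

lemma commutation_class_iff_trace:
  assumes "distinct w"
  shows "w' \<in> commutation_class E w \<longleftrightarrow> distinct w' \<and> word_trace E w' = word_trace E w"
proof
  assume "w' \<in> commutation_class E w"
  then have "(commutation E)\<^sup>*\<^sup>* w w'" by (simp add: commutation_class_def)
  then show "distinct w' \<and> word_trace E w' = word_trace E w" using assms by (rule commutation_trace)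
next
  assume "distinct w' \<and> word_trace E w' = word_trace E w"
  then have "distinct w'" "word_trace E w = word_trace E w'" by simp_all
  with assms have "(commutation E)\<^sup>*\<^sup>* w w'" by (rule trace_eq_imp_commutation)
  then show "w' \<in> commutation_class E w" by (simp add: commutation_class_def)
qed

text \<open>Filtering \<open>w\<close> by the content of \<open>v\<close> produces a representative
  of the class of \<open>v\<close> below \<open>w\<close>, so the representative on the larger side
  may be fixed in advance.\<close>

lemma class_le_iff_trace_le:
  assumes "distinct v" "distinct w"
  shows "class_le (commutation_class E v) (commutation_class E w) \<longleftrightarrow>
    trace_le (word_trace E v) (word_trace E w)"
proof
  assume "class_le (commutation_class E v) (commutation_class E w)"
  then obtain v' w' where v': "distinct v'" "word_trace E v' = word_trace E v"
    and w': "distinct w'" "word_trace E w' = word_trace E w" and "subseq v' w'"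
    using assms by (auto simp: class_le_def commutation_class_iff_trace)
  then have "v' = filter (\<lambda>x. x \<in> set v') w'" using subseq_iff_filter[OF w'(1)] by simp
  then have "word_trace E v' = restr (word_trace E w') (set v')" by (metis trace_filter)
  then show "trace_le (word_trace E v) (word_trace E w)" using v' w' by (metis fst_word_trace trace_le_def)
next
  assume "trace_le (word_trace E v) (word_trace E w)"
  then have "word_trace E (filter (\<lambda>x. x \<in> set v) w) = word_trace E v" by (simp add: trace_filter trace_le_def)
  then have "filter (\<lambda>x. x \<in> set v) w \<in> commutation_class E v"
    using assms by (simp add: commutation_class_iff_trace)
  moreover have "w \<in> commutation_class E w" using assms by (simp add: commutation_class_iff_trace)
  ultimately show "class_le (commutation_class E v) (commutation_class E w)"
    unfolding class_le_def using subseq_filter_left by blast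
qed

lemma compatible_iff_nth:
  assumes "distinct w"
  shows "compatible P w \<longleftrightarrow> (\<forall>i < length w. \<forall>j < length w. (w ! i, w ! j) \<in> P \<and> w ! i \<noteq> w ! j \<longrightarrow> i < j)"
proof -
  have before_nth: "before u = {(u ! i, u ! j) |i j. i < j \<and> j < length u}" for u :: "'a list"
  proof (induction u)
    case (Cons x u)
    have "{((x # u) ! i, (x # u) ! j) |i j. i < j \<and> j < length (x # u)} =
        {x} \<times> set u \<union> {(u ! i, u ! j) |i j. i < j \<and> j < length u}" (is "?L = ?R")
    proof (intro set_eqI iffI)
      fix z assume "z \<in> ?L"
      then obtain i j where ij: "z = ((x # u) ! i, (x # u) ! j)" "i < j" "j < length (x # u)" by blast
      then obtain j' where j': "j = Suc j'" by (cases j) auto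
      show "z \<in> ?R" using ij j' by (cases i) auto
    next
      fix z assume "z \<in> ?R"
      then show "z \<in> ?L"
      proof
        assume "z \<in> {x} \<times> set u"
        then obtain j where "z = (x, u ! j)" "j < length u" by (auto simp: in_set_conv_nth)
        then show ?thesis by (intro CollectI exI[of _ 0] exI[of _ "Suc j"]) auto
      next
        assume "z \<in> {(u ! i, u ! j) |i j. i < j \<and> j < length u}"
        then obtain i j where "z = (u ! i, u ! j)" "i < j" "j < length u" by blast
        then show ?thesis by (intro CollectI exI[of _ "Suc i"] exI[of _ "Suc j"]) auto
      qed
    qed
    then show ?case using Cons by simp
  qed simp
  show ?thesis
  proof (intro iffI allI impI)
    fix i j assume *: "compatible P w" "i < length w" "j < length w" "(w ! i, w ! j) \<in> P \<and> w ! i \<noteq> w ! j"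
    show "i < j"
    proof (rule ccontr)
      assume "\<not> i < j"
      moreover have "i \<noteq> j" using * by auto
      ultimately have "j < i" by simp
      then have "(w ! j, w ! i) \<in> before w" using *(2) unfolding before_nth by blast
      then show False using * by (auto simp: compatible_def)
    qed
  next
    assume *: "\<forall>i < length w. \<forall>j < length w. (w ! i, w ! j) \<in> P \<and> w ! i \<noteq> w ! j \<longrightarrow> i < j"
    have "(w ! j, w ! i) \<notin> P" if "i < j" "j < length w" for i j
      using *[rule_format, of j i] that assms nth_eq_iff_index_eq[of w i j] by auto
    then show "compatible P w" unfolding compatible_def before_nth by auto
  qed
qed

theorem theorem1p5:
  fixes n :: nat and \<Delta> :: "nat set set"
  assumes "simplicial_complex_on {1..n} \<Delta>"
    and "doubly_homotopy_CM \<Delta>"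
  shows "(\<forall>P :: nat rel. partial_order_on {1..n} P \<longrightarrow>
            cell_doubly_homotopy_CM (Gamma_poset n \<Delta> P) subseq) \<and>
         (\<forall>E :: nat set set. graph_on {1..n} E \<longrightarrow>
            cell_doubly_homotopy_CM (Gamma_graph n \<Delta> E) class_le)"
proof (intro conjI allI impI)
  have Gamma: "Gamma n \<Delta> = {w. distinct w \<and> set w \<in> \<Delta>}"
    using simplicial_complex_onD(2)[OF assms(1)] by (auto simp: Gamma_def injective_words_def)
  fix P :: "nat rel" assume "partial_order_on {1..n} P"
  then have P: "trans P" "antisym P" by (auto simp: partial_order_on_def preorder_on_def)
  \<comment> \<open>The complete graph. Members that are not edges are harmless:
    \<open>word_trace\<close> consults \<open>E\<close> only for pairs of letters, and a word
    without repetitions has no letter before itself.\<close>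
  define E :: "nat set set" where "E = UNIV"
  have E: "\<forall>a b. a \<noteq> b \<longrightarrow> {a, b} \<in> E" by (simp add: E_def)
  have A: "Gamma_poset n \<Delta> P = words \<Delta> P"
    unfolding Gamma_poset_def Gamma words_def using compatible_iff_nth[of _ P] by blast
  have le: "subseq v w \<longleftrightarrow> trace_le (word_trace E v) (word_trace E w)"
    if "v \<in> words \<Delta> P" "w \<in> words \<Delta> P" for v w
    using that by (intro subseq_iff_trace_le[OF E]) (auto simp: words_def)
  show "cell_doubly_homotopy_CM (Gamma_poset n \<Delta> P) subseq"
    unfolding A
  proof (rule doubly_homotopy_CM_of_traces[OF assms P disjI1[OF E] _ _ le])
    show "inj_on (word_trace E) (words \<Delta> P)"
    proof (rule inj_onI)
      fix v w assume vw: "v \<in> words \<Delta> P" "w \<in> words \<Delta> P" "word_trace E v = word_trace E w"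
      then have "subseq v w" "subseq w v" using le trace_le_refl by metis+
      then show "v = w" by (rule subseq_order.antisym)
    qed
  qed (auto simp: traces_def)
next
  have Gamma: "Gamma n \<Delta> = words \<Delta> {}"
    using simplicial_complex_onD(2)[OF assms(1)]
    by (auto simp: Gamma_def injective_words_def words_def compatible_def)
  fix E :: "nat set set" assume "graph_on {1..n} E"
  \<comment> \<open>The trace is constant on a commutation class, so any representative will
    do.\<close>
  let ?\<tau> = "\<lambda>C. word_trace E (SOME w. w \<in> C)"
  have \<tau>: "?\<tau> (commutation_class E w) = word_trace E w" if "w \<in> words \<Delta> {}" for w
  proof -
    have d: "distinct w" using that by (simp add: words_def)
    then have "w \<in> commutation_class E w" by (simp add: commutation_class_iff_trace)
    then have "(SOME w'. w' \<in> commutation_class E w) \<in> commutation_class E w" by (rule someI)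
    then show ?thesis using d by (simp add: commutation_class_iff_trace)
  qed
  show "cell_doubly_homotopy_CM (Gamma_graph n \<Delta> E) class_le"
    unfolding Gamma_graph_def Gamma
  proof (rule doubly_homotopy_CM_of_traces[OF assms, where P = "{}" and E = E and \<tau> = ?\<tau>])
    show "inj_on ?\<tau> (commutation_class E ` words \<Delta> {})"
    proof (rule inj_onI, clarify)
      fix v w assume vw: "v \<in> words \<Delta> {}" "w \<in> words \<Delta> {}"
        "?\<tau> (commutation_class E v) = ?\<tau> (commutation_class E w)"
      then have "word_trace E v = word_trace E w" using \<tau> by simp
      moreover have "distinct v" "distinct w" using vw by (auto simp: words_def)
      ultimately show "commutation_class E v = commutation_class E w"
        by (auto simp: commutation_class_iff_trace)
    qed
    show "?\<tau> ` commutation_class E ` words \<Delta> {} = traces E \<Delta> {}"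
      unfolding traces_def image_image using \<tau> by (rule image_cong[OF refl])
    fix x y assume "x \<in> commutation_class E ` words \<Delta> {}" "y \<in> commutation_class E ` words \<Delta> {}"
    then obtain v w where "x = commutation_class E v" "y = commutation_class E w"
      "v \<in> words \<Delta> {}" "w \<in> words \<Delta> {}" by blast
    then show "class_le x y \<longleftrightarrow> trace_le (?\<tau> x) (?\<tau> y)"
      using \<tau> class_le_iff_trace_le[of v w E] by (simp add: words_def)
  qed auto
qed

end
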